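(* Let $H$ be a Hilbert space and let $K=\mathcal L(H,M_tH)$ be the algebra of bounded operators from $H$ to $M_tH$, with convolution as multiplication and unit $I$. If $A\in K$ is invertible in $K$, then $\widehat A(\lambda)$ is invertible (in $\mathcal L(H,H)$) for every $\lambda\in\mathbb R$. Conversely, assume that $A=I+L$ with $L\in K$, that $\widehat A(\lambda)$ is invertible for each $\lambda\in\mathbb R$, and that $$\lim_{\epsilon\to0}\|L(\cdot+\epsilon)-L\|_K=0,\qquad \lim_{R\to\infty}\|(1-\chi(t/R))L(t)\|_K=0.$$ Then $A$ is invertible in $K$.
   Context: $M_tH$ is the Banach space of $H$-valued Borel measures of finite mass on $\mathbb R$, with norm $\|\mu\|_{M_tH}=\sup\{\sum_{k=1}^n\|\mu(A_k)\|_H: A_k\text{ disjoint Borel sets}\}$. For $k\in K$ and $\mu\in M_tH$, the convolution $k*\mu\in M_tH$ is $(k*\mu)(A)=\tilde\mu(\{(t,s):t+s\in A\})$, where $\tilde\mu$ is the $H$-valued measure on $\mathbb R^2$ determined by $\tilde\mu(A\times B)=k(\mu(B))(A)$. This identifies $K$ with the bounded translation-invariant operators on $M_tH$; the product on $K$ is the corresponding composition, and the unit $I$ is $h\mapsto\delta_{t=0}h$. The Fourier transform of $k\in K$ is $\widehat k(\lambda)=\int_{\mathbb R}e^{-it\lambda}\,dk(t)\in\mathcal L(H,H)$. $L(\cdot+\epsilon)$ denotes the translate of $L$ in $t$. $\chi$ is a fixed continuous compactly supported function on $\mathbb R$ which equals one on a neighborhood of zero. *)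

theory Defs
  imports "HOL-Analysis.Analysis"
begin

section \<open>Complex Hilbert spaces and bounded complex-linear operators\<close>

class complex_vector = real_vector +
  fixes scaleC :: "complex \<Rightarrow> 'a \<Rightarrow> 'a"  (infixr \<open>*\<^sub>C\<close> 75)
  assumes scaleC_add_right: "c *\<^sub>C (x + y) = c *\<^sub>C x + c *\<^sub>C y"
    and scaleC_add_left: "(c + d) *\<^sub>C x = c *\<^sub>C x + d *\<^sub>C x"
    and scaleC_scaleC: "c *\<^sub>C d *\<^sub>C x = (c * d) *\<^sub>C x"
    and scaleR_scaleC: "r *\<^sub>R x = complex_of_real r *\<^sub>C x"

class complex_normed_vector = complex_vector + real_normed_vector +
  assumes norm_scaleC: "norm (c *\<^sub>C x) = cmod c * norm x"

text \<open>The inner product is linear in the first argument. Positive definiteness is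
  contained in \<open>cinner_same\<close>.\<close>

class complex_hilbert_space = complex_normed_vector + complete_space +
  fixes cinner :: "'a \<Rightarrow> 'a \<Rightarrow> complex"
  assumes cinner_commute: "cinner x y = cnj (cinner y x)"
    and cinner_add_left: "cinner (x + y) z = cinner x z + cinner y z"
    and cinner_scaleC_left: "cinner (c *\<^sub>C x) y = c * cinner x y"
    and cinner_same: "cinner x x = complex_of_real ((norm x)\<^sup>2)"

definition bounded_clinear :: "('a::complex_normed_vector \<Rightarrow> 'b::complex_normed_vector) \<Rightarrow> bool"
  where "bounded_clinear f \<longleftrightarrow> bounded_linear f \<and> (\<forall>c x. f (c *\<^sub>C x) = c *\<^sub>C f x)"

definition invertible_op :: "('a::complex_normed_vector \<Rightarrow> 'a) \<Rightarrow> bool"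
  where "invertible_op T \<longleftrightarrow>
    bounded_clinear T \<and> (\<exists>S. bounded_clinear S \<and> S \<circ> T = id \<and> T \<circ> S = id)"


section \<open>Vector-valued Borel measures of finite mass\<close>

definition mass_sums :: "('a::topological_space set \<Rightarrow> 'h::real_normed_vector) \<Rightarrow> real set"
  where "mass_sums \<mu> = {\<Sum>k<n. norm (\<mu> (A k)) | (n::nat) A.
    (\<forall>k<n. A k \<in> sets borel) \<and> disjoint_family_on A {..<n}}"

text \<open>A measure is a set function on all sets that vanishes outside the Borel sets, so that
  two measures are equal if and only if they agree on the Borel sets.\<close>

definition is_vmeasure :: "('a::topological_space set \<Rightarrow> 'h::real_normed_vector) \<Rightarrow> bool"
  where "is_vmeasure \<mu> \<longleftrightarrow>
    (\<forall>A. A \<notin> sets borel \<longrightarrow> \<mu> A = 0) \<and>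
    (\<forall>A::nat \<Rightarrow> 'a set. range A \<subseteq> sets borel \<longrightarrow> disjoint_family A \<longrightarrow>
      (\<lambda>n. \<mu> (A n)) sums \<mu> (\<Union>n. A n)) \<and>
    bdd_above (mass_sums \<mu>)"

lemma zero_in_mass_sums: "0 \<in> mass_sums \<mu>"
  unfolding mass_sums_def by (rule CollectI, rule exI[of _ 0]) (auto simp: disjoint_family_on_def)

lemma mass_sums_zero: "mass_sums (\<lambda>A. 0) = {0}"
  using zero_in_mass_sums[of "\<lambda>A. 0"] unfolding mass_sums_def by auto

lemma is_vmeasure_zero: "is_vmeasure (\<lambda>A. 0)"
  by (simp add: is_vmeasure_def mass_sums_zero)

typedef (overloaded) ('a::topological_space, 'h::real_normed_vector) vmeasure =
  "{\<mu> :: 'a set \<Rightarrow> 'h. is_vmeasure \<mu>}"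
  morphisms vmeas Abs_vmeasure
  using is_vmeasure_zero by blast

setup_lifting type_definition_vmeasure

lemma is_vmeasure_vmeas: "is_vmeasure (vmeas \<mu>)"
  using vmeas by blast

lemma mass_sums_add_le:
  assumes "is_vmeasure \<mu>" "is_vmeasure \<nu>" "x \<in> mass_sums (\<lambda>A. \<mu> A + \<nu> A)"
  shows "x \<le> Sup (mass_sums \<mu>) + Sup (mass_sums \<nu>)"
proof -
  obtain n :: nat and A where A: "\<forall>k<n. A k \<in> sets borel" "disjoint_family_on A {..<n}"
    and x: "x = (\<Sum>k<n. norm (\<mu> (A k) + \<nu> (A k)))"
    using assms(3) unfolding mass_sums_def by blast
  have 1: "(\<Sum>k<n. norm (\<mu> (A k))) \<le> Sup (mass_sums \<mu>)"
    using A assms(1) by (intro cSup_upper) (auto simp: mass_sums_def is_vmeasure_def)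
  have 2: "(\<Sum>k<n. norm (\<nu> (A k))) \<le> Sup (mass_sums \<nu>)"
    using A assms(2) by (intro cSup_upper) (auto simp: mass_sums_def is_vmeasure_def)
  have "x \<le> (\<Sum>k<n. norm (\<mu> (A k))) + (\<Sum>k<n. norm (\<nu> (A k)))"
    unfolding x sum.distrib[symmetric] by (intro sum_mono norm_triangle_ineq)
  with 1 2 show ?thesis by linarith
qed

lemma is_vmeasure_add:
  assumes "is_vmeasure \<mu>" "is_vmeasure \<nu>"
  shows "is_vmeasure (\<lambda>A. \<mu> A + \<nu> A)"
proof -
  have "bdd_above (mass_sums (\<lambda>A. \<mu> A + \<nu> A))"
    using mass_sums_add_le[OF assms] by (rule bdd_aboveI)
  then show ?thesis
    using assms by (auto simp: is_vmeasure_def intro!: sums_add)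
qed

lemma mass_sums_scale:
  assumes "\<And>x. norm (f x) = c * norm x"
  shows "mass_sums (\<lambda>A. f (\<mu> A)) = (*) c ` mass_sums \<mu>"
  unfolding mass_sums_def assms sum_distrib_left[symmetric] by blast

lemma is_vmeasure_scale:
  assumes "is_vmeasure \<mu>" "bounded_linear f" "\<And>x. norm (f x) = c * norm x" "c \<ge> 0"
  shows "is_vmeasure (\<lambda>A. f (\<mu> A))"
proof -
  obtain M where M: "\<And>x. x \<in> mass_sums \<mu> \<Longrightarrow> x \<le> M"
    using assms(1) by (auto simp: is_vmeasure_def bdd_above_def)
  have "bdd_above (mass_sums (\<lambda>A. f (\<mu> A)))"
    unfolding mass_sums_scale[of f c \<mu>, OF assms(3)]
    by (rule bdd_aboveI[of _ "c * M"]) (use M assms(4) in \<open>auto intro: mult_left_mono\<close>)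
  then show ?thesis
    using assms(1) bounded_linear.sums[OF assms(2)] linear_0[OF bounded_linear.linear[OF assms(2)]]
    by (auto simp: is_vmeasure_def)
qed

lemma Sup_mass_sums_scale:
  assumes "is_vmeasure \<mu>" "\<And>x. norm (f x) = c * norm x" "c \<ge> 0"
  shows "Sup (mass_sums (\<lambda>A. f (\<mu> A))) = c * Sup (mass_sums \<mu>)"
proof -
  have "c * Sup (mass_sums \<mu>) = (SUP x\<in>mass_sums \<mu>. c * x)"
    using assms zero_in_mass_sums[of \<mu>]
    by (intro continuous_at_Sup_mono)
      (auto simp: is_vmeasure_def mono_def mult_left_mono intro!: continuous_intros)
  then show ?thesis
    by (simp add: mass_sums_scale[of f c \<mu>, OF assms(2)])
qed

instantiation vmeasure :: (topological_space, real_normed_vector) real_normed_vector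
begin

lift_definition zero_vmeasure :: "('a, 'b) vmeasure" is "\<lambda>A. 0"
  by (rule is_vmeasure_zero)

lift_definition plus_vmeasure :: "('a, 'b) vmeasure \<Rightarrow> ('a, 'b) vmeasure \<Rightarrow> ('a, 'b) vmeasure"
  is "\<lambda>\<mu> \<nu> A. \<mu> A + \<nu> A"
  by (rule is_vmeasure_add)

lift_definition scaleR_vmeasure :: "real \<Rightarrow> ('a, 'b) vmeasure \<Rightarrow> ('a, 'b) vmeasure"
  is "\<lambda>r \<mu> A. r *\<^sub>R \<mu> A"
  by (rule is_vmeasure_scale[where c = "\<bar>_\<bar>"]) (auto intro: bounded_linear_scaleR_right)

lift_definition norm_vmeasure :: "('a, 'b) vmeasure \<Rightarrow> real" is "\<lambda>\<mu>. Sup (mass_sums \<mu>)" .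

definition uminus_vmeasure :: "('a, 'b) vmeasure \<Rightarrow> ('a, 'b) vmeasure"
  where "uminus_vmeasure \<mu> = (- 1) *\<^sub>R \<mu>"

definition minus_vmeasure :: "('a, 'b) vmeasure \<Rightarrow> ('a, 'b) vmeasure \<Rightarrow> ('a, 'b) vmeasure"
  where "minus_vmeasure \<mu> \<nu> = \<mu> + - \<nu>"

definition sgn_vmeasure :: "('a, 'b) vmeasure \<Rightarrow> ('a, 'b) vmeasure"
  where "sgn_vmeasure \<mu> = inverse (norm \<mu>) *\<^sub>R \<mu>"

definition dist_vmeasure :: "('a, 'b) vmeasure \<Rightarrow> ('a, 'b) vmeasure \<Rightarrow> real"
  where "dist_vmeasure \<mu> \<nu> = norm (\<mu> - \<nu>)"

definition uniformity_vmeasure :: "(('a, 'b) vmeasure \<times> ('a, 'b) vmeasure) filter"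
  where "uniformity_vmeasure = (INF e\<in>{0<..}. principal {(\<mu>, \<nu>). dist \<mu> \<nu> < e})"

definition open_vmeasure :: "('a, 'b) vmeasure set \<Rightarrow> bool"
  where "open_vmeasure U \<longleftrightarrow>
    (\<forall>\<mu>\<in>U. eventually (\<lambda>(\<mu>', \<nu>). \<mu>' = \<mu> \<longrightarrow> \<nu> \<in> U) uniformity)"

instance
proof
  fix \<mu> \<nu> \<rho> :: "('a, 'b) vmeasure" and r s :: real
  show "\<mu> + \<nu> + \<rho> = \<mu> + (\<nu> + \<rho>)" by transfer (simp add: add.assoc)
  show "\<mu> + \<nu> = \<nu> + \<mu>" by transfer (simp add: add.commute)
  show "0 + \<mu> = \<mu>" by transfer simp
  show "- \<mu> + \<mu> = 0" unfolding uminus_vmeasure_def by transfer simp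
  show "\<mu> - \<nu> = \<mu> + - \<nu>" by (rule minus_vmeasure_def)
  show "r *\<^sub>R (\<mu> + \<nu>) = r *\<^sub>R \<mu> + r *\<^sub>R \<nu>" by transfer (simp add: scaleR_add_right)
  show "(r + s) *\<^sub>R \<mu> = r *\<^sub>R \<mu> + s *\<^sub>R \<mu>" by transfer (simp add: scaleR_add_left)
  show "r *\<^sub>R s *\<^sub>R \<mu> = (r * s) *\<^sub>R \<mu>" by transfer simp
  show "1 *\<^sub>R \<mu> = \<mu>" by transfer simp
  show "dist \<mu> \<nu> = norm (\<mu> - \<nu>)" by (rule dist_vmeasure_def)
  show "sgn \<mu> = inverse (norm \<mu>) *\<^sub>R \<mu>" by (rule sgn_vmeasure_def)
  show "uniformity = (INF e\<in>{0<..}. principal {(\<mu>::('a, 'b) vmeasure, \<nu>). dist \<mu> \<nu> < e})"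
    by (rule uniformity_vmeasure_def)
  show "open U \<longleftrightarrow> (\<forall>\<mu>\<in>U. eventually (\<lambda>(\<mu>', \<nu>). \<mu>' = \<mu> \<longrightarrow> \<nu> \<in> U) uniformity)"
    for U :: "('a, 'b) vmeasure set"
    by (rule open_vmeasure_def)
  show "norm (\<mu> + \<nu>) \<le> norm \<mu> + norm \<nu>"
    by transfer (rule cSup_least, use zero_in_mass_sums in blast, rule mass_sums_add_le)
  show "norm (r *\<^sub>R \<mu>) = \<bar>r\<bar> * norm \<mu>"
    by transfer (rule Sup_mass_sums_scale, auto)
  show "norm \<mu> = 0 \<longleftrightarrow> \<mu> = 0"
  proof
    assume "norm \<mu> = 0"
    then have le: "x \<le> 0" if "x \<in> mass_sums (vmeas \<mu>)" for x
      using that is_vmeasure_vmeas[of \<mu>]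
      by (metis cSup_upper is_vmeasure_def norm_vmeasure.rep_eq)
    have "vmeas \<mu> A = 0" for A
    proof (cases "A \<in> sets borel")
      case True
      then have "norm (vmeas \<mu> A) \<in> mass_sums (vmeas \<mu>)"
        unfolding mass_sums_def
        by (intro CollectI exI[of _ "1::nat"] exI[of _ "\<lambda>_::nat. A"])
          (auto simp: disjoint_family_on_def)
      from le[OF this] show ?thesis by simp
    next
      case False
      then show ?thesis using is_vmeasure_vmeas[of \<mu>] by (simp add: is_vmeasure_def)
    qed
    then show "\<mu> = 0" by transfer auto
  next
    assume "\<mu> = 0"
    then show "norm \<mu> = 0" by transfer (simp add: mass_sums_zero)
  qed
qed

end

lemma bounded_linear_scaleC: "bounded_linear (\<lambda>x::'a::complex_normed_vector. c *\<^sub>C x)"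
proof (rule bounded_linear_intro)
  fix x y :: 'a and r :: real
  show "c *\<^sub>C (x + y) = c *\<^sub>C x + c *\<^sub>C y" by (rule scaleC_add_right)
  show "c *\<^sub>C (r *\<^sub>R x) = r *\<^sub>R c *\<^sub>C x"
    by (simp add: scaleR_scaleC scaleC_scaleC mult.commute)
  show "norm (c *\<^sub>C x) \<le> norm x * cmod c" by (simp add: norm_scaleC)
qed

instantiation vmeasure :: (topological_space, complex_normed_vector) complex_normed_vector
begin

lift_definition scaleC_vmeasure :: "complex \<Rightarrow> ('a, 'b) vmeasure \<Rightarrow> ('a, 'b) vmeasure"
  is "\<lambda>c \<mu> A. c *\<^sub>C \<mu> A"
  by (rule is_vmeasure_scale[where c = "cmod _"]) (auto intro: bounded_linear_scaleC norm_scaleC)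

instance
proof
  fix \<mu> \<nu> :: "('a, 'b) vmeasure" and c d :: complex and r :: real
  show "c *\<^sub>C (\<mu> + \<nu>) = c *\<^sub>C \<mu> + c *\<^sub>C \<nu>" by transfer (simp add: scaleC_add_right)
  show "(c + d) *\<^sub>C \<mu> = c *\<^sub>C \<mu> + d *\<^sub>C \<mu>" by transfer (simp add: scaleC_add_left)
  show "c *\<^sub>C d *\<^sub>C \<mu> = (c * d) *\<^sub>C \<mu>" by transfer (simp add: scaleC_scaleC)
  show "r *\<^sub>R \<mu> = complex_of_real r *\<^sub>C \<mu>" by transfer (simp add: scaleR_scaleC)
  show "norm (c *\<^sub>C \<mu>) = cmod c * norm \<mu>"
    by transfer (rule Sup_mass_sums_scale, auto simp: norm_scaleC)
qed

end


section \<open>Point masses, images, integrals and densities\<close>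

lemma norm_indicator_sum_le:
  assumes "disjoint_family_on A {..<n::nat}"
  shows "(\<Sum>k<n. norm (indicator (A k) x *\<^sub>R h)) \<le> norm h"
proof (cases "\<exists>j<n. x \<in> A j")
  case True
  then obtain j where j: "j < n" "x \<in> A j" by blast
  have "(\<Sum>k<n. norm (indicator (A k) x *\<^sub>R h)) = (\<Sum>k<n. if k = j then norm h else 0)"
    using assms j by (intro sum.cong) (auto simp: disjoint_family_on_def indicator_def)
  also have "\<dots> = norm h" using j(1) by simp
  finally show ?thesis by (rule eq_refl)
next
  case False
  then have "(\<Sum>k<n. norm (indicator (A k) x *\<^sub>R h)) = 0" by (intro sum.neutral) auto
  then show ?thesis by (rule ord_eq_le_trans) simp
qed

lift_definition point_mass :: "'a::topological_space \<Rightarrow> 'h::real_normed_vector \<Rightarrow> ('a, 'h) vmeasure"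
  is "\<lambda>x h A. if A \<in> sets borel then indicator A x *\<^sub>R h else 0"
proof -
  fix x :: 'a and h :: 'h
  let ?\<mu> = "\<lambda>A. if A \<in> sets borel then indicator A x *\<^sub>R h else 0"
  have "(\<lambda>n. ?\<mu> (A n)) sums ?\<mu> (\<Union>n. A n)"
    if A: "range A \<subseteq> sets borel" "disjoint_family A" for A :: "nat \<Rightarrow> 'a set"
  proof -
    have "(\<lambda>n. indicator (A n) x *\<^sub>R h) sums (indicator (\<Union>n. A n) x *\<^sub>R h)"
      by (intro bounded_linear.sums[OF bounded_linear_scaleR_left] indicator_sums)
        (use A in \<open>auto simp: disjoint_family_on_def\<close>)
    moreover have "A n \<in> sets borel" for n using A by auto
    moreover have "(\<Union>n. A n) \<in> sets borel" using A by auto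
    ultimately show ?thesis by simp
  qed
  moreover have "bdd_above (mass_sums ?\<mu>)"
  proof (rule bdd_aboveI)
    fix y assume "y \<in> mass_sums ?\<mu>"
    then obtain n :: nat and A where A: "\<forall>k<n. A k \<in> sets borel" "disjoint_family_on A {..<n}"
      and y: "y = (\<Sum>k<n. norm (?\<mu> (A k)))"
      unfolding mass_sums_def by blast
    have "y = (\<Sum>k<n. norm (indicator (A k) x *\<^sub>R h))"
      unfolding y using A by (intro sum.cong) auto
    also have "\<dots> \<le> norm h" by (rule norm_indicator_sum_le[OF A(2)])
    finally show "y \<le> norm h" .
  qed
  ultimately show "is_vmeasure ?\<mu>" by (simp add: is_vmeasure_def)
qed

text \<open>The guard makes the image measure total: a map that is not Borel gives the zero measure.\<close>

lift_definition image_vmeasure ::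
  "('a::topological_space \<Rightarrow> 'b::topological_space) \<Rightarrow>
    ('a, 'h::real_normed_vector) vmeasure \<Rightarrow> ('b, 'h) vmeasure"
  is "\<lambda>f \<mu> A. if f \<in> borel_measurable borel \<and> A \<in> sets borel then \<mu> (f -` A) else 0"
proof -
  fix f :: "'a \<Rightarrow> 'b" and \<mu> :: "'a set \<Rightarrow> 'h"
  let ?\<nu> = "\<lambda>A. if f \<in> borel_measurable borel \<and> A \<in> sets borel then \<mu> (f -` A) else 0"
  assume \<mu>: "is_vmeasure \<mu>"
  show "is_vmeasure ?\<nu>"
  proof (cases "f \<in> borel_measurable borel")
    case False
    then show ?thesis by (simp add: is_vmeasure_zero)
  next
    case f: True
    have pre: "f -` A \<in> sets borel" if "A \<in> sets borel" for A
      using measurable_sets[OF f that] by simp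
    have "(\<lambda>n. ?\<nu> (A n)) sums ?\<nu> (\<Union>n. A n)"
      if A: "range A \<subseteq> sets borel" "disjoint_family A" for A :: "nat \<Rightarrow> 'b set"
    proof -
      have "range (\<lambda>n. f -` A n) \<subseteq> sets borel" using A pre by blast
      moreover have "disjoint_family (\<lambda>n. f -` A n)"
        using A by (fastforce simp: disjoint_family_on_def)
      ultimately have "(\<lambda>n. \<mu> (f -` A n)) sums \<mu> (\<Union>n. f -` A n)"
        using \<mu> unfolding is_vmeasure_def by blast
      moreover have "A n \<in> sets borel" for n using A by auto
      moreover have "(\<Union>n. A n) \<in> sets borel" using A by auto
      ultimately show ?thesis using f by (simp add: vimage_UN)
    qed
    moreover have "mass_sums ?\<nu> \<subseteq> mass_sums \<mu>"
    proof
      fix y assume "y \<in> mass_sums ?\<nu>"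
      then obtain n :: nat and A where A: "\<forall>k<n. A k \<in> sets borel" "disjoint_family_on A {..<n}"
        and y: "y = (\<Sum>k<n. norm (?\<nu> (A k)))"
        unfolding mass_sums_def by blast
      have "y = (\<Sum>k<n. norm (\<mu> (f -` A k)))"
        unfolding y using A f by (intro sum.cong) auto
      moreover have "disjoint_family_on (\<lambda>k. f -` A k) {..<n}"
        using A by (fastforce simp: disjoint_family_on_def)
      ultimately show "y \<in> mass_sums \<mu>"
        unfolding mass_sums_def using A pre
        by (intro CollectI exI[of _ n] exI[of _ "\<lambda>k. f -` A k"]) auto
    qed
    then have "bdd_above (mass_sums ?\<nu>)"
      using \<mu> unfolding is_vmeasure_def by (meson bdd_above_mono)
    ultimately show ?thesis by (simp add: is_vmeasure_def)
  qed
qed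

text \<open>The integral of a bounded Borel function against a vector measure: the limit of the
  integrals of simple functions converging uniformly. It does not depend on the choice of the
  simple functions, since the integral of a simple function \<open>s\<close> is bounded by
  \<open>sup \<bar>s\<bar> * norm \<mu>\<close>.\<close>

definition simple_vintegral ::
  "('a::topological_space, 'h::complex_normed_vector) vmeasure \<Rightarrow> ('a \<Rightarrow> complex) \<Rightarrow> 'h"
  where "simple_vintegral \<mu> s = (\<Sum>y\<in>range s. y *\<^sub>C vmeas \<mu> (s -` {y}))"

definition has_vintegral ::
  "('a::topological_space, 'h::complex_normed_vector) vmeasure \<Rightarrow> ('a \<Rightarrow> complex) \<Rightarrow> 'h \<Rightarrow> bool"
  where "has_vintegral \<mu> f I \<longleftrightarrow>
    (\<exists>s. (\<forall>n. simple_function borel (s n)) \<and> uniform_limit UNIV s f sequentially \<and>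
      (\<lambda>n. simple_vintegral \<mu> (s n)) \<longlonglongrightarrow> I)"

definition vintegral ::
  "('a::topological_space, 'h::complex_normed_vector) vmeasure \<Rightarrow> ('a \<Rightarrow> complex) \<Rightarrow> 'h"
  where "vintegral \<mu> f = (THE I. has_vintegral \<mu> f I)"

text \<open>The measure \<open>g \<mu>\<close>, for a bounded Borel function \<open>g\<close>.\<close>

definition density_vmeasure ::
  "('a::topological_space \<Rightarrow> complex) \<Rightarrow> ('a, 'h::complex_normed_vector) vmeasure \<Rightarrow>
    ('a, 'h) vmeasure"
  where "density_vmeasure g \<mu> =
    (THE \<nu>. \<forall>A\<in>sets borel. vmeas \<nu> A = vintegral \<mu> (\<lambda>t. indicator A t * g t))"


section \<open>The convolution algebra\<close>

text \<open>The norm of an element \<open>k\<close> of \<open>conv_alg\<close> is \<open>onorm k\<close>.\<close>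

definition conv_alg :: "('h::complex_hilbert_space \<Rightarrow> (real, 'h) vmeasure) set"
  where "conv_alg = {k. bounded_clinear k}"

definition tilde_vmeasure ::
  "('h::complex_hilbert_space \<Rightarrow> (real, 'h) vmeasure) \<Rightarrow> (real, 'h) vmeasure \<Rightarrow>
    (real \<times> real, 'h) vmeasure"
  where "tilde_vmeasure k \<mu> =
    (THE \<nu>. \<forall>A\<in>sets borel. \<forall>B\<in>sets borel. vmeas \<nu> (A \<times> B) = vmeas (k (vmeas \<mu> B)) A)"

definition convolve ::
  "('h::complex_hilbert_space \<Rightarrow> (real, 'h) vmeasure) \<Rightarrow> (real, 'h) vmeasure \<Rightarrow> (real, 'h) vmeasure"
  where "convolve k \<mu> = image_vmeasure (\<lambda>(t, s). t + s) (tilde_vmeasure k \<mu>)"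

text \<open>An element \<open>k\<close> is recovered from the operator \<open>convolve k\<close> by evaluating it
  at \<open>point_mass 0 h\<close>. So the element whose operator is \<open>convolve k \<circ> convolve l\<close>
  sends \<open>h\<close> to \<open>convolve k (convolve l (point_mass 0 h)) = convolve k (l h)\<close>.\<close>

definition conv_mult ::
  "('h::complex_hilbert_space \<Rightarrow> (real, 'h) vmeasure) \<Rightarrow> ('h \<Rightarrow> (real, 'h) vmeasure) \<Rightarrow>
    'h \<Rightarrow> (real, 'h) vmeasure"
  where "conv_mult k l = (\<lambda>h. convolve k (l h))"

definition conv_unit :: "'h::complex_hilbert_space \<Rightarrow> (real, 'h) vmeasure"
  where "conv_unit = point_mass 0"

definition conv_invertible :: "('h::complex_hilbert_space \<Rightarrow> (real, 'h) vmeasure) \<Rightarrow> bool"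
  where "conv_invertible k \<longleftrightarrow> k \<in> conv_alg \<and>
    (\<exists>l\<in>conv_alg. conv_mult k l = conv_unit \<and> conv_mult l k = conv_unit)"

definition fourier :: "('h::complex_hilbert_space \<Rightarrow> (real, 'h) vmeasure) \<Rightarrow> real \<Rightarrow> 'h \<Rightarrow> 'h"
  where "fourier k \<omega> = (\<lambda>h. vintegral (k h) (\<lambda>t. exp (- \<i> * of_real t * of_real \<omega>)))"

text \<open>\<open>k(\<cdot> + \<epsilon>)\<close> is the translate in the sense of densities: its value at \<open>A\<close>
  is the value of \<open>k\<close> at \<open>A + \<epsilon>\<close>, the preimage of \<open>A\<close> under \<open>t \<mapsto> t - \<epsilon>\<close>.\<close>

definition translate ::
  "real \<Rightarrow> ('h::complex_hilbert_space \<Rightarrow> (real, 'h) vmeasure) \<Rightarrow> 'h \<Rightarrow> (real, 'h) vmeasure"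
  where "translate \<epsilon> k = (\<lambda>h. image_vmeasure (\<lambda>t. t - \<epsilon>) (k h))"

definition mult_fun ::
  "(real \<Rightarrow> complex) \<Rightarrow> ('h::complex_hilbert_space \<Rightarrow> (real, 'h) vmeasure) \<Rightarrow>
    'h \<Rightarrow> (real, 'h) vmeasure"
  where "mult_fun g k = (\<lambda>h. density_vmeasure g (k h))"

end

theory Submission
  imports Defs "HOL-Probability.Levy"
begin

text \<open>The Fourier transform turns convolution into composition, which gives the first half and,
  with its injectivity, the uniqueness needed for two-sided inverses. For the converse write
  \<open>F\<close> for convolution with \<open>A = I + L\<close> and measure operators modulo the right ideal of multiples
  \<open>F Y\<close>. Modulo this ideal \<open>L\<close> is \<open>-1\<close>, so small translations are close to the identity,
  and \<open>L\<close> may be replaced by a finite combination of translates \<open>\<tau>\<close> by multiples of a small step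
  with coefficients in \<open>\<L>(H, H)\<close>. Invertibility of the Fourier transform at a frequency
  (bounded frequencies), or smallness of \<open>\<tau> L - L\<close> (high frequencies), then bounds every
  operator \<open>Q\<close> commuting with \<open>L\<close> by \<open>C Q (z \<tau> - 1)\<close>, uniformly in \<open>\<bar>z\<bar> = 1\<close>. Applied twice to the
  Fejer sum of order \<open>n\<close> in \<open>z \<tau>\<close> this yields \<open>O(1/n)\<close>. The average of these sums over the \<open>n\<close>-th
  roots of unity \<open>z\<close> is the identity, so the identity lies in the closure of the ideal.\<close>

section \<open>Vector measures\<close>

text \<open>Bounded operators on H do not commute, so the maximal ideal argument behind Wiener's
  theorem is not at hand, and the pointwise inverses have to be glued by estimates. The main
  obstacle is that \<open>L\<close> need not be close in norm to any combination of point masses: a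
  diffuse measure stays at least its own norm away from discrete ones. Translation continuity only
  makes \<open>L * (L - l)\<close> small for a discretization \<open>l\<close>. Modulo the ideal
  this suffices, as left multiplication by \<open>L\<close> only changes a sign there; commuting
  with \<open>L\<close> is what lets \<open>Q\<close> be moved past it. The Fejer sum is used since
  one geometric sum would bound the identity only by a constant. \<open>C\<close> may grow with the
  number of translates, because \<open>n\<close> is chosen after it. The outcome is a right inverse,
  merely a real-linear operator; injectivity of convolution with \<open>A\<close> makes it
  complex-linear and two-sided, and its values at point masses form the inverse element. Before all
  this, convolution has to be shown to exist: the measure on the plane is first built for step
  densities, which are dense because H is a Hilbert space.\<close>

lemma scaleC_zero [simp]: "c *\<^sub>C (0::'a::complex_normed_vector) = 0"
  by (rule linear_0[OF bounded_linear.linear[OF bounded_linear_scaleC]])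

lemma vmeas_notborel: "A \<notin> sets borel \<Longrightarrow> vmeas \<mu> A = 0"
  using is_vmeasure_vmeas[of \<mu>] by (simp add: is_vmeasure_def)

lemma vmeas_sums:
  "range A \<subseteq> sets borel \<Longrightarrow> disjoint_family A \<Longrightarrow> (\<lambda>n. vmeas \<mu> (A n)) sums vmeas \<mu> (\<Union>n. A n)"
  using is_vmeasure_vmeas[of \<mu>] by (simp add: is_vmeasure_def)

lemma vmeasure_eqI:
  assumes "\<And>A. A \<in> sets borel \<Longrightarrow> vmeas \<mu> A = vmeas \<nu> A"
  shows "\<mu> = \<nu>"
proof -
  have "vmeas \<mu> A = vmeas \<nu> A" for A
    using assms by (cases "A \<in> sets borel") (auto simp: vmeas_notborel)
  then show ?thesis by (simp add: vmeas_inject[symmetric] fun_eq_iff)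
qed

lemma vmeas_uminus: "vmeas (- \<mu>) A = - vmeas \<mu> A"
  unfolding uminus_vmeasure_def scaleR_vmeasure.rep_eq by simp

lemma vmeas_diff: "vmeas (\<mu> - \<nu>) A = vmeas \<mu> A - vmeas \<nu> A"
  unfolding minus_vmeasure_def plus_vmeasure.rep_eq vmeas_uminus by simp

lemmas vmeas_simps = zero_vmeasure.rep_eq plus_vmeasure.rep_eq scaleR_vmeasure.rep_eq
  scaleC_vmeasure.rep_eq vmeas_uminus vmeas_diff

lemma vmeas_sum: "vmeas (\<Sum>i\<in>I. \<mu> i) A = (\<Sum>i\<in>I. vmeas (\<mu> i) A)"
  by (induction I rule: infinite_finite_induct) (auto simp: vmeas_simps)

lemma vmeas_empty [simp]: "vmeas \<mu> {} = 0"
proof -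
  have "(\<lambda>n. vmeas \<mu> {}) sums vmeas \<mu> (\<Union>n::nat. {})"
    by (rule vmeas_sums) (auto simp: disjoint_family_on_def)
  then have "(\<lambda>n::nat. vmeas \<mu> {}) \<longlonglongrightarrow> 0"
    by (intro summable_LIMSEQ_zero) (rule sums_summable)
  then show ?thesis by (simp add: LIMSEQ_const_iff)
qed

lemma vmeas_UN_finite:
  assumes "finite I" "\<And>i. i \<in> I \<Longrightarrow> A i \<in> sets borel" "disjoint_family_on A I"
  shows "vmeas \<mu> (\<Union>i\<in>I. A i) = (\<Sum>i\<in>I. vmeas \<mu> (A i))"
proof -
  obtain e where e: "bij_betw e {..<card I} I"
    using assms(1) by (metis bij_betw_from_nat_into_finite)
  define B where "B n = (if n < card I then A (e n) else {})" for n
  have eI: "e n \<in> I" if "n < card I" for n using e that by (auto simp: bij_betw_def)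
  have "e m \<noteq> e n" if "m < card I" "n < card I" "m \<noteq> n" for m n
    using e that by (auto simp: bij_betw_def inj_on_def)
  then have "disjoint_family B"
    using assms(3) eI by (auto simp: disjoint_family_on_def B_def)
  moreover have "range B \<subseteq> sets borel" using assms(2) eI by (auto simp: B_def)
  ultimately have "(\<lambda>n. vmeas \<mu> (B n)) sums vmeas \<mu> (\<Union>n. B n)" by (intro vmeas_sums)
  moreover have "(\<lambda>n. vmeas \<mu> (B n)) sums (\<Sum>n<card I. vmeas \<mu> (B n))"
    by (rule sums_finite) (auto simp: B_def)
  ultimately have "vmeas \<mu> (\<Union>n. B n) = (\<Sum>n<card I. vmeas \<mu> (B n))" by (rule sums_unique2)
  also have "\<dots> = (\<Sum>n<card I. vmeas \<mu> (A (e n)))" by (intro sum.cong) (auto simp: B_def)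
  also have "\<dots> = (\<Sum>i\<in>I. vmeas \<mu> (A i))" using e by (rule sum.reindex_bij_betw)
  also have "(\<Union>n. B n) = (\<Union>i\<in>I. A i)"
    using e eI by (auto simp: B_def bij_betw_def split: if_splits) (metis imageE lessThan_iff)
  finally show ?thesis .
qed

lemma vmeas_Un:
  assumes "A \<in> sets borel" "B \<in> sets borel" "A \<inter> B = {}"
  shows "vmeas \<mu> (A \<union> B) = vmeas \<mu> A + vmeas \<mu> B"
proof -
  have "vmeas \<mu> (\<Union>b\<in>UNIV. if b then A else B) = (\<Sum>b\<in>UNIV. vmeas \<mu> (if b then A else B))"
    by (rule vmeas_UN_finite) (use assms in \<open>auto simp: disjoint_family_on_def\<close>)
  then show ?thesis by (simp add: UNIV_bool Un_commute add.commute)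
qed

lemma bdd_mass: "bdd_above (mass_sums (vmeas \<mu>))"
  using is_vmeasure_vmeas[of \<mu>] by (simp add: is_vmeasure_def)

lemma sum_norm_vmeas_le:
  assumes "finite I" "\<And>i. i \<in> I \<Longrightarrow> A i \<in> sets borel" "disjoint_family_on A I"
  shows "(\<Sum>i\<in>I. norm (vmeas \<mu> (A i))) \<le> norm \<mu>"
proof -
  obtain e where e: "bij_betw e {..<card I} I"
    using assms(1) by (metis bij_betw_from_nat_into_finite)
  have eI: "e n \<in> I" if "n < card I" for n using e that by (auto simp: bij_betw_def)
  have "e m \<noteq> e n" if "m < card I" "n < card I" "m \<noteq> n" for m n
    using e that by (auto simp: bij_betw_def inj_on_def)
  then have d: "disjoint_family_on (A \<circ> e) {..<card I}"
    using assms(3) eI by (auto simp: disjoint_family_on_def)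
  have "(\<Sum>i\<in>I. norm (vmeas \<mu> (A i))) = (\<Sum>n<card I. norm (vmeas \<mu> ((A \<circ> e) n)))"
    using sum.reindex_bij_betw[OF e, of "\<lambda>i. norm (vmeas \<mu> (A i))"] by simp
  also have "\<dots> \<in> mass_sums (vmeas \<mu>)"
    unfolding mass_sums_def using d assms(2) eI
    by (intro CollectI exI[of _ "card I"] exI[of _ "A \<circ> e"]) auto
  finally have "(\<Sum>i\<in>I. norm (vmeas \<mu> (A i))) \<in> mass_sums (vmeas \<mu>)" .
  then show ?thesis by (simp add: norm_vmeasure.rep_eq cSup_upper bdd_mass)
qed

lemma norm_vmeas_le: "norm (vmeas \<mu> A) \<le> norm \<mu>"
proof (cases "A \<in> sets borel")
  case True
  then show ?thesis using sum_norm_vmeas_le[of "{()}" "\<lambda>_. A" \<mu>]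
    by (auto simp: disjoint_family_on_def)
qed (simp add: vmeas_notborel)

lemma norm_vmeasure_leI:
  assumes "\<And>(n::nat) A. (\<And>k. k < n \<Longrightarrow> A k \<in> sets borel) \<Longrightarrow> disjoint_family_on A {..<n} \<Longrightarrow>
    (\<Sum>k<n. norm (vmeas \<mu> (A k))) \<le> C"
  shows "norm \<mu> \<le> C"
  unfolding norm_vmeasure.rep_eq
proof (rule cSup_least)
  show "mass_sums (vmeas \<mu>) \<noteq> {}" using zero_in_mass_sums by blast
qed (use assms in \<open>auto simp: mass_sums_def\<close>)

lemma bounded_linear_vmeas: "bounded_linear (\<lambda>\<mu>. vmeas \<mu> A)"
  by (rule bounded_linear_intro[of _ 1]) (auto simp: vmeas_simps norm_vmeas_le)

text \<open>Countable additivity is reduced to continuity at the empty set: the tails of a disjoint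
  family decrease to the empty set. Restrictions, limits and integrals meet this form directly,
  since additivity on two sets is algebra and the tail condition is a limit statement.\<close>

lemma is_vmeasureI:
  fixes \<mu> :: "'a::topological_space set \<Rightarrow> 'h::real_normed_vector"
  assumes out: "\<And>A. A \<notin> sets borel \<Longrightarrow> \<mu> A = 0"
    and add: "\<And>A B. A \<in> sets borel \<Longrightarrow> B \<in> sets borel \<Longrightarrow> A \<inter> B = {} \<Longrightarrow> \<mu> (A \<union> B) = \<mu> A + \<mu> B"
    and tail: "\<And>A. range A \<subseteq> sets borel \<Longrightarrow> decseq A \<Longrightarrow> (\<Inter>n. A n) = {} \<Longrightarrow> (\<lambda>n. \<mu> (A n)) \<longlonglongrightarrow> 0"
    and mass: "\<And>(n::nat) A. (\<And>k. k < n \<Longrightarrow> A k \<in> sets borel) \<Longrightarrow> disjoint_family_on A {..<n} \<Longrightarrow>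
      (\<Sum>k<n. norm (\<mu> (A k))) \<le> C"
  shows "is_vmeasure \<mu>"
  unfolding is_vmeasure_def
proof (intro conjI allI impI out)
  show "bdd_above (mass_sums \<mu>)" using mass by (auto simp: mass_sums_def intro!: bdd_aboveI[of _ C])
next
  fix A :: "nat \<Rightarrow> 'a set"
  assume A: "range A \<subseteq> sets borel" "disjoint_family A"
  have An: "A n \<in> sets borel" for n using A by auto
  have e: "\<mu> {} = 0" using add[of "{}" "{}"] by simp
  have fin: "(\<Sum>i<n. \<mu> (A i)) = \<mu> (\<Union>i<n. A i)" for n
  proof (induction n)
    case 0
    then show ?case using e by simp
  next
    case (Suc n)
    have "(\<Union>i<n. A i) \<inter> A n = {}"
      using A(2) unfolding disjoint_family_on_def by (auto simp: set_eq_iff) (metis nat_neq_iff)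
    moreover have "(\<Union>i<n. A i) \<in> sets borel" by (intro sets.finite_UN An) simp
    ultimately have "\<mu> ((\<Union>i<n. A i) \<union> A n) = \<mu> (\<Union>i<n. A i) + \<mu> (A n)"
      using An by (intro add)
    moreover have "(\<Union>i<Suc n. A i) = (\<Union>i<n. A i) \<union> A n" by (auto simp: lessThan_Suc)
    ultimately show ?case using Suc by (simp only: sum.lessThan_Suc)
  qed
  define T where "T n = (\<Union>i\<in>{n..}. A i)" for n
  have Tb: "range T \<subseteq> sets borel" using An by (auto simp: T_def)
  have "decseq T" unfolding T_def decseq_def by (meson UN_mono atLeast_subset_iff order_refl)
  have "(\<Inter>n. T n) = {}"
  proof -
    have False if x: "\<And>n. x \<in> T n" for x
    proof -
      obtain i where i: "x \<in> A i" using x[of 0] by (auto simp: T_def)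
      obtain j where "j \<ge> Suc i" "x \<in> A j" using x[of "Suc i"] by (auto simp: T_def)
      moreover from this have "i \<noteq> j" by simp
      ultimately show False using i disjoint_family_onD[OF A(2), of i j] by auto
    qed
    then show ?thesis by auto
  qed
  with tail[OF Tb \<open>decseq T\<close>] have "(\<lambda>n. \<mu> (T n)) \<longlonglongrightarrow> 0" by blast
  then have "(\<lambda>n. \<mu> (\<Union>i. A i) - \<mu> (T n)) \<longlonglongrightarrow> \<mu> (\<Union>i. A i) - 0" by (intro tendsto_intros)
  moreover have "\<mu> (\<Union>i. A i) - \<mu> (T n) = (\<Sum>i<n. \<mu> (A i))" for n
  proof -
    have "(\<Union>i. A i) = (\<Union>i<n. A i) \<union> T n" by (auto simp: T_def) (metis atLeast_iff lessThan_iff not_le)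
    moreover have "(\<Union>i<n. A i) \<inter> T n = {}"
    proof -
      have "i = j" if "x \<in> A i" "x \<in> A j" for x i j
        using A(2) that by (auto simp: disjoint_family_on_def)
      then show ?thesis unfolding T_def by fastforce
    qed
    ultimately show ?thesis using An Tb add[of "\<Union>i<n. A i" "T n"] by (auto simp: fin)
  qed
  ultimately show "(\<lambda>n. \<mu> (A n)) sums \<mu> (\<Union>n. A n)" by (simp add: sums_def)
qed

text \<open>The converse of the reduction in \<open>is_vmeasureI\<close>: the differences
  \<open>D n\<close> are disjoint and exhaust \<open>A 0\<close>, and their partial sums telescope
  to the value at \<open>A 0\<close> minus the value at \<open>A n\<close>.\<close>

lemma vmeas_tail:
  assumes A: "range A \<subseteq> sets borel" "decseq A" "(\<Inter>n. A n) = {}"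
  shows "(\<lambda>n. vmeas \<mu> (A n)) \<longlonglongrightarrow> 0"
proof -
  have An: "A n \<in> sets borel" for n using A by auto
  define D where "D n = A n - A (Suc n)" for n
  have D: "D n \<in> sets borel" for n using An by (auto simp: D_def)
  have dec: "A n \<subseteq> A m" if "m \<le> n" for m n using A(2) that by (auto simp: decseq_def)
  have dj: "disjoint_family D"
  proof -
    have "D m \<inter> D n = {}" if "m < n" for m n
      using dec[of "Suc m" n] that by (auto simp: D_def)
    then show ?thesis unfolding disjoint_family_on_def by (metis Int_commute nat_neq_iff)
  qed
  have "(\<lambda>n. vmeas \<mu> (D n)) sums vmeas \<mu> (\<Union>n. D n)"
    using D dj by (intro vmeas_sums) auto
  moreover have sumD: "A 0 = (\<Union>i<n. D i) \<union> A n" for n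
  proof (induction n)
    case (Suc n)
    then show ?case using dec[of n "Suc n"] by (auto simp: D_def lessThan_Suc)
  qed simp
  have "(\<Sum>i<n. vmeas \<mu> (D i)) = vmeas \<mu> (A 0) - vmeas \<mu> (A n)" for n
  proof -
    have "D i \<inter> A n = {}" if "i < n" for i
      using dec[of "Suc i" n] that by (auto simp: D_def)
    then have "(\<Union>i<n. D i) \<inter> A n = {}" by blast
    then have "vmeas \<mu> (A 0) = vmeas \<mu> (\<Union>i<n. D i) + vmeas \<mu> (A n)"
      using D An by (subst sumD[of n], subst vmeas_Un) auto
    also have "vmeas \<mu> (\<Union>i<n. D i) = (\<Sum>i<n. vmeas \<mu> (D i))"
      using D dj by (intro vmeas_UN_finite) (auto simp: disjoint_family_on_def)
    finally show ?thesis by simp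
  qed
  moreover have "(\<Union>n. D n) = A 0"
  proof
    show "(\<Union>n. D n) \<subseteq> A 0" using dec[of 0] by (auto simp: D_def)
    show "A 0 \<subseteq> (\<Union>n. D n)"
    proof
      fix x assume "x \<in> A 0"
      obtain n where "x \<notin> A n" using A(3) by auto
      with sumD[of n] \<open>x \<in> A 0\<close> show "x \<in> (\<Union>n. D n)" by auto
    qed
  qed
  ultimately have "(\<lambda>n. vmeas \<mu> (A 0) - vmeas \<mu> (A n)) \<longlonglongrightarrow> vmeas \<mu> (A 0)"
    by (simp add: sums_def)
  from tendsto_diff[OF tendsto_const[of "vmeas \<mu> (A 0)"] this] show ?thesis by simp
qed

subsection \<open>Completeness\<close>

instance complex_hilbert_space \<subseteq> banach ..

text \<open>The setwise limit exists because evaluation at a set is a contraction. A Cauchy sequence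
  in the mass norm converges uniformly over all Borel sets, and this uniformity carries continuity
  at the empty set over to the limit.\<close>

instance vmeasure :: (topological_space, banach) banach
proof
  fix X :: "nat \<Rightarrow> ('a, 'b) vmeasure"
  assume X: "Cauchy X"
  have "convergent (\<lambda>n. vmeas (X n) A)" for A
    by (intro Cauchy_convergent bounded_linear.Cauchy[OF bounded_linear_vmeas X])
  then have lim: "(\<lambda>n. vmeas (X n) A) \<longlonglongrightarrow> lim (\<lambda>n. vmeas (X n) A)" for A
    by (simp add: convergent_LIMSEQ_iff)
  define \<mu> where "\<mu> A = lim (\<lambda>n. vmeas (X n) A)" for A
  note lim = lim[folded \<mu>_def]
  \<comment> \<open>The index \<open>n\<close> is kept fixed while the second index of the Cauchy
    estimate tends to infinity, so one \<open>N\<close> serves all finite disjoint families at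
    once.\<close>
  have close: "\<exists>N. \<forall>n\<ge>N. \<forall>m A. (\<forall>k<m. A k \<in> sets borel) \<longrightarrow> disjoint_family_on A {..<m::nat} \<longrightarrow>
    (\<Sum>k<m. norm (vmeas (X n) (A k) - \<mu> (A k))) \<le> e" if "e > 0" for e
  proof -
    obtain N where N: "\<And>n m. n \<ge> N \<Longrightarrow> m \<ge> N \<Longrightarrow> norm (X n - X m) < e"
      using X \<open>e > 0\<close> by (auto simp: Cauchy_def dist_norm) metis
    have "(\<Sum>k<m. norm (vmeas (X n) (A k) - \<mu> (A k))) \<le> e"
      if n: "n \<ge> N" and A: "\<forall>k<m. A k \<in> sets borel" "disjoint_family_on A {..<m::nat}" for n m A
    proof (rule LIMSEQ_le_const2)
      show "(\<lambda>j. \<Sum>k<m. norm (vmeas (X n) (A k) - vmeas (X j) (A k)))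
        \<longlonglongrightarrow> (\<Sum>k<m. norm (vmeas (X n) (A k) - \<mu> (A k)))"
        by (intro tendsto_intros lim)
      have "(\<Sum>k<m. norm (vmeas (X n) (A k) - vmeas (X j) (A k))) \<le> e" if "j \<ge> N" for j
        using sum_norm_vmeas_le[of "{..<m}" A "X n - X j"] A N[OF n that]
        by (force simp: vmeas_diff)
      then show "\<exists>N. \<forall>j\<ge>N. (\<Sum>k<m. norm (vmeas (X n) (A k) - vmeas (X j) (A k))) \<le> e" by blast
    qed
    then show ?thesis by blast
  qed
  have single: "\<exists>N. \<forall>n\<ge>N. \<forall>A\<in>sets borel. norm (vmeas (X n) A - \<mu> A) \<le> e" if e: "e > 0" for e
  proof -
    obtain N where N: "\<And>n m A. n \<ge> N \<Longrightarrow> \<forall>k<m. A k \<in> sets borel \<Longrightarrow> disjoint_family_on A {..<m::nat} \<Longrightarrow>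
      (\<Sum>k<m. norm (vmeas (X n) (A k) - \<mu> (A k))) \<le> e" using close[OF e] by blast
    have "norm (vmeas (X n) A - \<mu> A) \<le> e" if "n \<ge> N" "A \<in> sets borel" for n A
      using N[OF that(1), of 1 "\<lambda>_. A"] that(2) by (auto simp: disjoint_family_on_def)
    then show ?thesis by blast
  qed
  obtain N0 where N0: "\<And>m A. \<forall>k<m. A k \<in> sets borel \<Longrightarrow> disjoint_family_on A {..<m::nat} \<Longrightarrow>
      (\<Sum>k<m. norm (vmeas (X N0) (A k) - \<mu> (A k))) \<le> 1" using close[of 1] by (metis order_refl zero_less_one)
  have "is_vmeasure \<mu>"
  proof (rule is_vmeasureI[where C = "1 + norm (X N0)"])
    fix A :: "'a set" assume "A \<notin> sets borel"
    then show "\<mu> A = 0" by (simp add: \<mu>_def vmeas_notborel)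
  next
    fix A B :: "'a set" assume AB: "A \<in> sets borel" "B \<in> sets borel" "A \<inter> B = {}"
    have "(\<lambda>n. vmeas (X n) (A \<union> B)) \<longlonglongrightarrow> \<mu> A + \<mu> B"
      using AB by (simp add: vmeas_Un tendsto_add lim)
    then show "\<mu> (A \<union> B) = \<mu> A + \<mu> B" using lim LIMSEQ_unique by blast
  next
    fix A :: "nat \<Rightarrow> 'a set"
    assume A: "range A \<subseteq> sets borel" "decseq A" "(\<Inter>n. A n) = {}"
    show "(\<lambda>n. \<mu> (A n)) \<longlonglongrightarrow> 0"
    proof (rule LIMSEQ_I)
      fix e :: real assume "e > 0"
      obtain N where N: "\<forall>A\<in>sets borel. norm (vmeas (X N) A - \<mu> A) \<le> e/2"
        using single[of "e/2"] \<open>e > 0\<close> by auto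
      obtain M where M: "\<And>n. n \<ge> M \<Longrightarrow> norm (vmeas (X N) (A n)) < e/2"
        using LIMSEQ_D[OF vmeas_tail[OF A, of "X N"], of "e/2"] \<open>e > 0\<close> by auto
      have "norm (\<mu> (A n)) < e" if "n \<ge> M" for n
      proof -
        have "norm (vmeas (X N) (A n) - \<mu> (A n)) \<le> e/2" using N A by auto
        with M[OF that] norm_triangle_ineq4[of "vmeas (X N) (A n)" "vmeas (X N) (A n) - \<mu> (A n)"]
        show ?thesis by simp
      qed
      then show "\<exists>M. \<forall>n\<ge>M. norm (\<mu> (A n) - 0) < e" by auto
    qed
  next
    fix n :: nat and A :: "nat \<Rightarrow> 'a set"
    assume A: "\<And>k. k < n \<Longrightarrow> A k \<in> sets borel" "disjoint_family_on A {..<n}"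
    have "(\<Sum>k<n. norm (\<mu> (A k))) \<le>
      (\<Sum>k<n. norm (vmeas (X N0) (A k) - \<mu> (A k)) + norm (vmeas (X N0) (A k)))"
      by (intro sum_mono) (metis norm_minus_commute norm_triangle_sub add.commute)
    also have "\<dots> \<le> 1 + norm (X N0)"
      unfolding sum.distrib using A by (intro add_mono N0 sum_norm_vmeas_le) auto
    finally show "(\<Sum>k<n. norm (\<mu> (A k))) \<le> 1 + norm (X N0)" .
  qed
  then have \<mu>: "vmeas (Abs_vmeasure \<mu>) = \<mu>" by (simp add: Abs_vmeasure_inverse)
  have "X \<longlonglongrightarrow> Abs_vmeasure \<mu>"
  proof (rule LIMSEQ_I)
    fix e :: real assume "e > 0"
    obtain N where N: "\<And>n m A. n \<ge> N \<Longrightarrow> \<forall>k<m. A k \<in> sets borel \<Longrightarrow> disjoint_family_on A {..<m::nat} \<Longrightarrow>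
      (\<Sum>k<m. norm (vmeas (X n) (A k) - \<mu> (A k))) \<le> e/2" using close[of "e/2"] \<open>e > 0\<close> by (metis half_gt_zero)
    have "norm (X n - Abs_vmeasure \<mu>) \<le> e/2" if "n \<ge> N" for n
      by (rule norm_vmeasure_leI) (use N[OF that] in \<open>auto simp: vmeas_diff \<mu>\<close>)
    then show "\<exists>N. \<forall>n\<ge>N. norm (X n - Abs_vmeasure \<mu>) < e"
      using \<open>e > 0\<close> by (intro exI[of _ N]) (metis field_sum_of_halves less_add_same_cancel2 linorder_not_le order.trans half_gt_zero)
  qed
  then show "convergent X" by (rule convergentI)
qed

subsection \<open>Restriction and total variation\<close>

lift_definition restrict_vmeasure ::
  "'a::topological_space set \<Rightarrow> ('a, 'h::real_normed_vector) vmeasure \<Rightarrow> ('a, 'h) vmeasure"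
  is "\<lambda>E \<mu> A. if E \<in> sets borel \<and> A \<in> sets borel then \<mu> (E \<inter> A) else 0"
proof -
  fix E :: "'a set" and \<mu> :: "'a set \<Rightarrow> 'h"
  assume \<mu>: "is_vmeasure \<mu>"
  define m where "m = Abs_vmeasure \<mu>"
  have m: "vmeas m = \<mu>" using \<mu> by (simp add: m_def Abs_vmeasure_inverse)
  show "is_vmeasure (\<lambda>A. if E \<in> sets borel \<and> A \<in> sets borel then \<mu> (E \<inter> A) else 0)"
  proof (cases "E \<in> sets borel")
    case True
    show ?thesis
    proof (rule is_vmeasureI[where C = "norm m"])
      fix A B :: "'a set" assume "A \<in> sets borel" "B \<in> sets borel" "A \<inter> B = {}"
      then show "(if E \<in> sets borel \<and> A \<union> B \<in> sets borel then \<mu> (E \<inter> (A \<union> B)) else 0) =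
        (if E \<in> sets borel \<and> A \<in> sets borel then \<mu> (E \<inter> A) else 0) +
        (if E \<in> sets borel \<and> B \<in> sets borel then \<mu> (E \<inter> B) else 0)"
        using True vmeas_Un[of "E \<inter> A" "E \<inter> B" m] by (auto simp: m Int_Un_distrib)
    next
      fix A :: "nat \<Rightarrow> 'a set"
      assume A: "range A \<subseteq> sets borel" "decseq A" "(\<Inter>n. A n) = {}"
      then have "A n \<in> sets borel" for n by auto
      moreover have "(\<lambda>n. vmeas m (E \<inter> A n)) \<longlonglongrightarrow> 0"
        using A True by (intro vmeas_tail) (auto simp: decseq_def)
      ultimately show "(\<lambda>n. if E \<in> sets borel \<and> A n \<in> sets borel then \<mu> (E \<inter> A n) else 0) \<longlonglongrightarrow> 0"
        using True by (simp add: m)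
    next
      fix n :: nat and A :: "nat \<Rightarrow> 'a set"
      assume A: "\<And>k. k < n \<Longrightarrow> A k \<in> sets borel" "disjoint_family_on A {..<n}"
      have "(\<Sum>k<n. norm (vmeas m (E \<inter> A k))) \<le> norm m"
        using A True by (intro sum_norm_vmeas_le) (auto simp: disjoint_family_on_def)
      then show "(\<Sum>k<n. norm (if E \<in> sets borel \<and> A k \<in> sets borel then \<mu> (E \<inter> A k) else 0)) \<le> norm m"
        using True A by (simp add: m)
    qed auto
  qed (simp add: is_vmeasure_zero)
qed

lemma vmeas_restrict:
  "E \<in> sets borel \<Longrightarrow> A \<in> sets borel \<Longrightarrow> vmeas (restrict_vmeasure E \<mu>) A = vmeas \<mu> (E \<inter> A)"
  by (simp add: restrict_vmeasure.rep_eq)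

lemma restrict_add: "restrict_vmeasure E (\<mu> + \<nu>) = restrict_vmeasure E \<mu> + restrict_vmeasure E \<nu>"
  by transfer auto

lemma restrict_scaleR: "restrict_vmeasure E (r *\<^sub>R \<mu>) = r *\<^sub>R restrict_vmeasure E \<mu>"
  by transfer auto

lemma restrict_scaleC:
  fixes \<mu> :: "('a::topological_space, 'b::complex_normed_vector) vmeasure"
  shows "restrict_vmeasure E (c *\<^sub>C \<mu>) = c *\<^sub>C restrict_vmeasure E \<mu>"
proof (cases "E \<in> sets borel")
  case True
  then show ?thesis by (intro vmeasure_eqI) (simp add: vmeas_restrict vmeas_simps)
next
  case False
  then have "restrict_vmeasure E \<nu> = 0" for \<nu> :: "('a, 'b) vmeasure" by transfer simp
  then show ?thesis by simp
qed

lemma restrict_UNIV: "restrict_vmeasure UNIV \<mu> = \<mu>"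
  by (rule vmeasure_eqI) (simp add: vmeas_restrict)

lemma restrict_restrict:
  "E \<in> sets borel \<Longrightarrow> F \<in> sets borel \<Longrightarrow>
    restrict_vmeasure E (restrict_vmeasure F \<mu>) = restrict_vmeasure (E \<inter> F) \<mu>"
  by (rule vmeasure_eqI) (simp add: vmeas_restrict Int_assoc Int_left_commute)

text \<open>Total variation is superadditive: test families inside \<open>E\<close> and inside
  \<open>F\<close> join to one test family inside \<open>E \<union> F\<close>, indexed by a sum
  type. The two suprema are then taken one after the other, each time with the other sum moved to
  the right-hand side.\<close>

lemma sum_norm_restrict_le:
  fixes \<mu> :: "('a::topological_space, 'b::real_normed_vector) vmeasure"
  assumes "finite I" "\<And>i. i \<in> I \<Longrightarrow> A i \<in> sets borel" "disjoint_family_on A I"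
  shows "(\<Sum>i\<in>I. norm (restrict_vmeasure (A i) \<mu>)) \<le> norm \<mu>"
proof -
  have two: "norm (restrict_vmeasure E \<nu>) + norm (restrict_vmeasure F \<nu>) \<le> norm (restrict_vmeasure (E \<union> F) \<nu>)"
    if EF: "E \<in> sets borel" "F \<in> sets borel" "E \<inter> F = {}" for E F and \<nu> :: "('a, 'b) vmeasure"
  proof -
    let ?R = "norm (restrict_vmeasure (E \<union> F) \<nu>)"
    have 1: "(\<Sum>k<n. norm (vmeas \<nu> (E \<inter> A k))) + (\<Sum>k<m. norm (vmeas \<nu> (F \<inter> B k))) \<le> ?R"
      if A: "\<And>k. k < n \<Longrightarrow> A k \<in> sets borel" "disjoint_family_on A {..<n}"
        and B: "\<And>k. k < m \<Longrightarrow> B k \<in> sets borel" "disjoint_family_on B {..<m}" for n m :: nat and A B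
    proof -
      define C where "C = case_sum (\<lambda>k. E \<inter> A k) (\<lambda>k. F \<inter> B k)"
      have "disjoint_family_on C ({..<n} <+> {..<m})"
        unfolding disjoint_family_on_def
      proof (intro ballI impI)
        fix i j assume ij: "i \<in> {..<n} <+> {..<m}" "j \<in> {..<n} <+> {..<m}" "i \<noteq> j"
        show "C i \<inter> C j = {}"
        proof (cases i; cases j)
          fix a b assume "i = Inl a" "j = Inl b"
          then show ?thesis using ij disjoint_family_onD[OF A(2), of a b] by (auto simp: C_def)
        next
          fix a b assume "i = Inr a" "j = Inr b"
          then show ?thesis using ij disjoint_family_onD[OF B(2), of a b] by (auto simp: C_def)
        qed (use EF(3) in \<open>auto simp: C_def\<close>)
      qed
      then have "(\<Sum>i\<in>{..<n} <+> {..<m}. norm (vmeas (restrict_vmeasure (E \<union> F) \<nu>) (C i))) \<le> ?R"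
        using A(1) B(1) EF(1,2) by (intro sum_norm_vmeas_le) (auto simp: C_def)
      moreover have "(\<Sum>i\<in>{..<n} <+> {..<m}. norm (vmeas (restrict_vmeasure (E \<union> F) \<nu>) (C i)))
        = (\<Sum>k<n. norm (vmeas (restrict_vmeasure (E \<union> F) \<nu>) (E \<inter> A k))) +
          (\<Sum>k<m. norm (vmeas (restrict_vmeasure (E \<union> F) \<nu>) (F \<inter> B k)))"
        by (subst sum.Plus) (auto simp: C_def)
      moreover have "(E \<union> F) \<inter> (E \<inter> A k) = E \<inter> A k" "(E \<union> F) \<inter> (F \<inter> B k) = F \<inter> B k" for k by auto
      ultimately show ?thesis using A B EF by (simp add: vmeas_restrict)
    qed
    have 2: "norm (restrict_vmeasure E \<nu>) \<le> ?R - (\<Sum>k<m. norm (vmeas \<nu> (F \<inter> B k)))"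
      if B: "\<And>k. k < m \<Longrightarrow> B k \<in> sets borel" "disjoint_family_on B {..<m}" for m :: nat and B
    proof (rule norm_vmeasure_leI)
      fix n :: nat and A :: "nat \<Rightarrow> 'a set"
      assume A: "\<And>k. k < n \<Longrightarrow> A k \<in> sets borel" "disjoint_family_on A {..<n}"
      have "(\<Sum>k<n. norm (vmeas (restrict_vmeasure E \<nu>) (A k))) = (\<Sum>k<n. norm (vmeas \<nu> (E \<inter> A k)))"
        using A EF by (intro sum.cong) (auto simp: vmeas_restrict)
      with 1[OF A B] show "(\<Sum>k<n. norm (vmeas (restrict_vmeasure E \<nu>) (A k))) \<le>
        ?R - (\<Sum>k<m. norm (vmeas \<nu> (F \<inter> B k)))" by linarith
    qed
    have "norm (restrict_vmeasure F \<nu>) \<le> ?R - norm (restrict_vmeasure E \<nu>)"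
    proof (rule norm_vmeasure_leI)
      fix n :: nat and A :: "nat \<Rightarrow> 'a set"
      assume A: "\<And>k. k < n \<Longrightarrow> A k \<in> sets borel" "disjoint_family_on A {..<n}"
      have "(\<Sum>k<n. norm (vmeas (restrict_vmeasure F \<nu>) (A k))) = (\<Sum>k<n. norm (vmeas \<nu> (F \<inter> A k)))"
        using A EF by (intro sum.cong) (auto simp: vmeas_restrict)
      with 2[OF A] show "(\<Sum>k<n. norm (vmeas (restrict_vmeasure F \<nu>) (A k))) \<le>
        ?R - norm (restrict_vmeasure E \<nu>)" by linarith
    qed
    then show ?thesis by simp
  qed
  have norm_le: "norm (restrict_vmeasure E \<mu>) \<le> norm \<mu>" if "E \<in> sets borel" for E
  proof -
    have "- E \<in> sets borel" using that by (simp add: sets.compl_sets Compl_eq_Diff_UNIV)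
    then have "norm (restrict_vmeasure E \<mu>) + norm (restrict_vmeasure (- E) \<mu>) \<le> norm (restrict_vmeasure UNIV \<mu>)"
      using two[of E "- E" \<mu>] that by simp
    then show ?thesis using norm_ge_zero[of "restrict_vmeasure (- E) \<mu>"]
      unfolding restrict_UNIV by linarith
  qed
  have "(\<Sum>i\<in>I. norm (restrict_vmeasure (A i) \<mu>)) \<le> norm (restrict_vmeasure (\<Union>i\<in>I. A i) \<mu>)"
    using assms
  proof (induction I rule: finite_induct)
    case (insert i I)
    have "A i \<inter> (\<Union>i\<in>I. A i) = {}"
      using insert by (auto simp: disjoint_family_on_def)
    moreover have "(\<Sum>i\<in>I. norm (restrict_vmeasure (A i) \<mu>)) \<le> norm (restrict_vmeasure (\<Union>i\<in>I. A i) \<mu>)"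
      using insert by (auto simp: disjoint_family_on_def)
    moreover have "(\<Union>i\<in>I. A i) \<in> sets borel" using insert by auto
    ultimately show ?case using insert two[of "A i" "\<Union>i\<in>I. A i" \<mu>] by auto
  qed simp
  also have "\<dots> \<le> norm \<mu>" using assms by (intro norm_le) auto
  finally show ?thesis .
qed

lemma norm_restrict_le: "norm (restrict_vmeasure E \<mu>) \<le> norm \<mu>"
proof (cases "E \<in> sets borel")
  case True
  then show ?thesis using sum_norm_restrict_le[of "{()}" "\<lambda>_. E" \<mu>]
    by (simp add: disjoint_family_on_def)
next
  case False
  then have "restrict_vmeasure E \<mu> = 0" by transfer simp
  then show ?thesis by simp
qed

text \<open>The norm of a restriction is already the supremum over disjoint pieces of
  \<open>A\<close>, so this is the classical total variation measure.\<close>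

definition variation :: "('a::topological_space, 'h::real_normed_vector) vmeasure \<Rightarrow> 'a measure"
  where "variation \<mu> = measure_of UNIV (sets borel) (\<lambda>A. ennreal (norm (restrict_vmeasure A \<mu>)))"

lemma sets_variation [simp, measurable_cong]: "sets (variation \<mu>) = sets borel"
  using sets.sets_measure_of_eq[of "borel :: 'a::topological_space measure"]
  by (simp add: variation_def)

lemma space_variation [simp]: "space (variation \<mu>) = UNIV"
  using sets_eq_imp_space_eq[OF sets_variation[of \<mu>]] by simp

text \<open>Countable additivity has two halves. Superadditivity on finite subfamilies bounds the
  sum by the whole; conversely each test set \<open>B k\<close> is cut along the \<open>A i\<close>,
  and a finite sum is interchanged with a series.\<close>

lemma emeasure_variation:
  fixes \<mu> :: "('a::topological_space, 'h::real_normed_vector) vmeasure"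
  assumes "A \<in> sets borel"
  shows "emeasure (variation \<mu>) A = ennreal (norm (restrict_vmeasure A \<mu>))"
proof (rule emeasure_measure_of[OF variation_def])
  show "positive (sets (variation \<mu>)) (\<lambda>A. ennreal (norm (restrict_vmeasure A \<mu>)))"
  proof -
    have "restrict_vmeasure {} \<mu> = 0" by (rule vmeasure_eqI) (simp add: vmeas_restrict vmeas_simps)
    then show ?thesis by (simp add: positive_def)
  qed
  show "countably_additive (sets (variation \<mu>)) (\<lambda>A. ennreal (norm (restrict_vmeasure A \<mu>)))"
  proof (rule countably_additiveI)
    fix A :: "nat \<Rightarrow> 'a set"
    assume A': "range A \<subseteq> sets (variation \<mu>)" "disjoint_family A" "(\<Union>i. A i) \<in> sets (variation \<mu>)"
    then have A: "A i \<in> sets borel" for i by auto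
    let ?a = "\<lambda>i. norm (restrict_vmeasure (A i) \<mu>)"
    have bound: "(\<Sum>i<n. ?a i) \<le> norm (restrict_vmeasure (\<Union>i. A i) \<mu>)" for n
    proof -
      have "(\<Sum>i<n. norm (restrict_vmeasure (A i) (restrict_vmeasure (\<Union>i. A i) \<mu>))) \<le> norm (restrict_vmeasure (\<Union>i. A i) \<mu>)"
        using A A'(2) by (intro sum_norm_restrict_le) (auto simp: disjoint_family_on_def)
      moreover have "A i \<inter> (\<Union>i. A i) = A i" for i by auto
      ultimately show ?thesis using A A'(3) by (simp add: restrict_restrict)
    qed
    have sm: "summable ?a" by (rule summableI_nonneg_bounded[OF _ bound]) simp
    have "(\<Sum>i. ?a i) = norm (restrict_vmeasure (\<Union>i. A i) \<mu>)"
    proof (rule antisym)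
      show "(\<Sum>i. ?a i) \<le> norm (restrict_vmeasure (\<Union>i. A i) \<mu>)"
        using bound by (intro suminf_le_const sm)
      show "norm (restrict_vmeasure (\<Union>i. A i) \<mu>) \<le> (\<Sum>i. ?a i)"
      proof (rule norm_vmeasure_leI)
        fix n :: nat and B :: "nat \<Rightarrow> 'a set"
        assume B: "\<And>k. k < n \<Longrightarrow> B k \<in> sets borel" "disjoint_family_on B {..<n}"
        have s: "summable (\<lambda>i. norm (vmeas \<mu> (A i \<inter> B k)))" if "k < n" for k
        proof (rule summable_comparison_test'[OF sm])
          fix i show "norm (norm (vmeas \<mu> (A i \<inter> B k))) \<le> ?a i"
            using norm_vmeas_le[of "restrict_vmeasure (A i) \<mu>" "B k"] A B that by (simp add: vmeas_restrict)
        qed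
        have "(\<Sum>k<n. norm (vmeas (restrict_vmeasure (\<Union>i. A i) \<mu>) (B k))) \<le>
          (\<Sum>k<n. \<Sum>i. norm (vmeas \<mu> (A i \<inter> B k)))"
        proof (rule sum_mono)
          fix k assume k: "k \<in> {..<n}"
          have "(\<lambda>i. vmeas \<mu> (A i \<inter> B k)) sums vmeas \<mu> (\<Union>i. A i \<inter> B k)"
            using A A'(2) B k by (intro vmeas_sums) (auto simp: disjoint_family_on_def)
          then have "vmeas \<mu> (\<Union>i. A i \<inter> B k) = (\<Sum>i. vmeas \<mu> (A i \<inter> B k))" by (rule sums_unique)
          moreover have "norm (\<Sum>i. vmeas \<mu> (A i \<inter> B k)) \<le> (\<Sum>i. norm (vmeas \<mu> (A i \<inter> B k)))"
          proof (rule LIMSEQ_le)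
            show "(\<lambda>N. norm (\<Sum>i<N. vmeas \<mu> (A i \<inter> B k))) \<longlonglongrightarrow> norm (\<Sum>i. vmeas \<mu> (A i \<inter> B k))"
              using \<open>(\<lambda>i. vmeas \<mu> (A i \<inter> B k)) sums _\<close>
              by (intro tendsto_norm summable_LIMSEQ) (rule sums_summable)
            show "(\<lambda>N. \<Sum>i<N. norm (vmeas \<mu> (A i \<inter> B k))) \<longlonglongrightarrow> (\<Sum>i. norm (vmeas \<mu> (A i \<inter> B k)))"
              using s k by (intro summable_LIMSEQ) auto
          qed (auto intro: norm_sum)
          ultimately show "norm (vmeas (restrict_vmeasure (\<Union>i. A i) \<mu>) (B k)) \<le> (\<Sum>i. norm (vmeas \<mu> (A i \<inter> B k)))"
            using A B k by (simp add: vmeas_restrict)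
        qed
        also have "\<dots> = (\<Sum>i. \<Sum>k<n. norm (vmeas \<mu> (A i \<inter> B k)))"
          using s by (subst suminf_sum) auto
        also have "\<dots> \<le> (\<Sum>i. ?a i)"
        proof (rule suminf_le)
          show "(\<Sum>k<n. norm (vmeas \<mu> (A i \<inter> B k))) \<le> ?a i" for i
            using sum_norm_vmeas_le[of "{..<n}" B "restrict_vmeasure (A i) \<mu>"] A B
            by (simp add: vmeas_restrict)
          show "summable (\<lambda>i. \<Sum>k<n. norm (vmeas \<mu> (A i \<inter> B k)))" using s by (intro summable_sum) auto
        qed (rule sm)
        finally show "(\<Sum>k<n. norm (vmeas (restrict_vmeasure (\<Union>i. A i) \<mu>) (B k))) \<le> (\<Sum>i. ?a i)" .
      qed
    qed
    then show "(\<Sum>i. ennreal (?a i)) = ennreal (norm (restrict_vmeasure (\<Union>i. A i) \<mu>))"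
      using sm by (subst suminf_ennreal2) auto
  qed
qed (use assms in auto)

lemma measure_variation:
  "A \<in> sets borel \<Longrightarrow> measure (variation \<mu>) A = norm (restrict_vmeasure A \<mu>)"
  by (simp add: measure_def emeasure_variation)

lemma finite_measure_variation: "finite_measure (variation \<mu>)"
  by (rule finite_measureI) (simp add: emeasure_variation)

lemma norm_vmeas_le_variation: "A \<in> sets borel \<Longrightarrow> norm (vmeas \<mu> A) \<le> measure (variation \<mu>) A"
  using norm_vmeas_le[of "restrict_vmeasure A \<mu>" UNIV] by (simp add: measure_variation vmeas_restrict)

section \<open>Integration of bounded Borel functions\<close>

definition bdd_borel :: "('a::topological_space \<Rightarrow> complex) set"
  where "bdd_borel = {f. f \<in> borel_measurable borel \<and> (\<exists>B. \<forall>x. cmod (f x) \<le> B)}"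

lemma bdd_borelI: "f \<in> borel_measurable borel \<Longrightarrow> (\<And>x. cmod (f x) \<le> B) \<Longrightarrow> f \<in> bdd_borel"
  by (auto simp: bdd_borel_def)

lemma bdd_borel_measurable: "f \<in> bdd_borel \<Longrightarrow> f \<in> borel_measurable borel"
  by (auto simp: bdd_borel_def)

lemma bdd_borelE:
  assumes "f \<in> bdd_borel"
  obtains B where "B > 0" "\<And>x. cmod (f x) \<le> B"
proof -
  obtain B where B: "\<And>x. cmod (f x) \<le> B" using assms by (auto simp: bdd_borel_def)
  have "cmod (f x) \<le> max B 1" for x using B[of x] by simp
  then show ?thesis using that[of "max B 1"] by simp
qed

lemma bdd_borel_const: "(\<lambda>_. c) \<in> bdd_borel"
  by (rule bdd_borelI[of _ "cmod c"]) auto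

lemma bdd_borel_indicator: "A \<in> sets borel \<Longrightarrow> (\<lambda>x. indicator A x) \<in> bdd_borel"
  by (rule bdd_borelI[of _ 1]) (auto simp: indicator_def)

lemma bdd_borel_add:
  assumes "f \<in> bdd_borel" "g \<in> bdd_borel" shows "(\<lambda>x. f x + g x) \<in> bdd_borel"
proof -
  obtain B C where "\<And>x. cmod (f x) \<le> B" "\<And>x. cmod (g x) \<le> C"
    using assms by (auto simp: bdd_borel_def)
  then have "cmod (f x + g x) \<le> B + C" for x by (metis add_mono norm_triangle_le)
  then show ?thesis using assms by (intro bdd_borelI[of _ "B + C"]) (auto simp: bdd_borel_def)
qed

lemma bdd_borel_mult:
  assumes "f \<in> bdd_borel" "g \<in> bdd_borel" shows "(\<lambda>x. f x * g x) \<in> bdd_borel"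
proof -
  obtain B C where BC: "B > 0" "\<And>x. cmod (f x) \<le> B" "C > 0" "\<And>x. cmod (g x) \<le> C"
    using assms by (meson bdd_borelE)
  then have "cmod (f x * g x) \<le> B * C" for x by (simp add: norm_mult mult_mono)
  then show ?thesis using assms by (intro bdd_borelI[of _ "B * C"]) (auto simp: bdd_borel_def)
qed

lemma bdd_borel_cmult: "f \<in> bdd_borel \<Longrightarrow> (\<lambda>x. c * f x) \<in> bdd_borel"
  using bdd_borel_mult[OF bdd_borel_const] .

lemma bdd_borel_diff:
  "f \<in> bdd_borel \<Longrightarrow> g \<in> bdd_borel \<Longrightarrow> (\<lambda>x. f x - g x) \<in> bdd_borel"
  using bdd_borel_add[OF _ bdd_borel_cmult[of g "-1"]] by simp

lemma bdd_borel_compose: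
  "f \<in> bdd_borel \<Longrightarrow> g \<in> borel_measurable borel \<Longrightarrow> (\<lambda>x. f (g x)) \<in> bdd_borel"
  by (auto simp: bdd_borel_def intro: measurable_compose)

lemma bdd_borel_of_real_Re: "f \<in> bdd_borel \<Longrightarrow> (\<lambda>x. complex_of_real (Re (f x))) \<in> bdd_borel"
  by (auto simp: bdd_borel_def intro: order_trans[OF abs_Re_le_cmod])

lemma simple_function_bdd_borel:
  assumes "simple_function borel s" shows "s \<in> bdd_borel"
proof -
  have "finite (range s)" using assms by (simp add: simple_function_def)
  then obtain B where "\<And>x. cmod (s x) \<le> B"
    by (metis finite_imp_bounded bounded_iff rangeI)
  then show ?thesis by (intro bdd_borelI borel_measurable_simple_function assms)
qed

lemma simple_function_fibre: "simple_function borel s \<Longrightarrow> s -` {y} \<in> sets borel"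
  using simple_functionD(2)[of borel s "{y}"] by simp

lemma simple_function_range: "simple_function borel s \<Longrightarrow> finite (range s)"
  using simple_functionD(1)[of borel s] by simp

lemma uniform_simple_approx:
  assumes "f \<in> bdd_borel" "e > 0"
  obtains s where "simple_function borel s" "\<And>x. cmod (s x - f x) \<le> e"
proof -
  obtain B where B: "B > 0" "\<And>x. cmod (f x) \<le> B" using assms by (auto elim: bdd_borelE)
  have [measurable]: "f \<in> borel_measurable borel" using assms by (simp add: bdd_borel_def)
  \<comment> \<open>Rounding down to a grid of width \<open>e/2\<close>, separately in real and
    imaginary part, so that both errors add up to at most \<open>e\<close>.\<close>
  define g where "g u = e/2 * of_int \<lfloor>u / (e/2)\<rfloor>" for u :: real
  have g: "\<bar>g u - u\<bar> \<le> e/2" for u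
  proof -
    have "\<bar>of_int \<lfloor>u / (e/2)\<rfloor> - u / (e/2)\<bar> \<le> 1" by linarith
    then have "\<bar>e/2\<bar> * \<bar>of_int \<lfloor>u / (e/2)\<rfloor> - u / (e/2)\<bar> \<le> e/2"
      using assms(2) by (simp add: mult_left_le)
    also have "\<bar>e/2\<bar> * \<bar>of_int \<lfloor>u / (e/2)\<rfloor> - u / (e/2)\<bar> = \<bar>g u - u\<bar>"
      unfolding abs_mult[symmetric] g_def using assms(2) by (simp add: right_diff_distrib)
    finally show ?thesis .
  qed
  define s where "s x = Complex (g (Re (f x))) (g (Im (f x)))" for x
  have "s = (\<lambda>x. of_real (g (Re (f x))) + \<i> * of_real (g (Im (f x))))"
    by (auto simp: s_def complex_eq_iff)
  then have m: "s \<in> borel_measurable borel" by (simp add: g_def)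
  define N where "N = \<lceil>B / (e/2)\<rceil> + 1"
  define G where "G = (\<lambda>i. e/2 * of_int i) ` {-N..N}"
  have gG: "g u \<in> G" if "\<bar>u\<bar> \<le> B" for u
  proof -
    have "\<bar>u / (e/2)\<bar> \<le> B / (e/2)" using that assms(2) by (simp add: divide_right_mono)
    then have "\<lfloor>u / (e/2)\<rfloor> \<in> {-N..N}" unfolding N_def atLeastAtMost_iff by linarith
    then show ?thesis by (auto simp: g_def G_def)
  qed
  have "range s \<subseteq> (\<lambda>(a, b). Complex a b) ` (G \<times> G)"
    using B gG by (force simp: s_def intro: order_trans[OF abs_Re_le_cmod] order_trans[OF abs_Im_le_cmod])
  then have "finite (range s)" by (rule finite_subset) (simp add: G_def)
  then have "simple_function borel s" using m by (intro simple_function_borel_measurable) auto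
  moreover have "cmod (s x - f x) \<le> e" for x
  proof -
    have "cmod (s x - f x) \<le> \<bar>Re (s x - f x)\<bar> + \<bar>Im (s x - f x)\<bar>" by (rule cmod_le)
    with g[of "Re (f x)"] g[of "Im (f x)"] show ?thesis by (simp add: s_def)
  qed
  ultimately show ?thesis using that by blast
qed

lemma vmeas_fibre_sum:
  assumes "finite (range r)" "\<And>j. r -` {j} \<in> sets borel"
  shows "vmeas \<mu> ((\<lambda>x. g (r x)) -` {y}) = (\<Sum>j | j \<in> range r \<and> g j = y. vmeas \<mu> (r -` {j}))"
proof -
  have "vmeas \<mu> (\<Union>j\<in>{j \<in> range r. g j = y}. r -` {j}) = (\<Sum>j | j \<in> range r \<and> g j = y. vmeas \<mu> (r -` {j}))"
    using assms by (intro vmeas_UN_finite) (auto simp: disjoint_family_on_def)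
  moreover have "(\<Union>j\<in>{j \<in> range r. g j = y}. r -` {j}) = (\<lambda>x. g (r x)) -` {y}" by auto
  ultimately show ?thesis by simp
qed

lemma scaleC_sum_right: "c *\<^sub>C (\<Sum>i\<in>I. x i) = (\<Sum>i\<in>I. c *\<^sub>C (x i :: 'a::complex_normed_vector))"
  by (rule linear_sum[OF bounded_linear.linear[OF bounded_linear_scaleC]])

text \<open>The integral may be computed on any finer finite partition. Taking for \<open>r\<close>
  the pair of two simple functions puts both on one partition, where additivity holds term by
  term.\<close>

lemma simple_vintegral_refine:
  assumes "finite (range r)" "\<And>j. r -` {j} \<in> sets borel"
  shows "simple_vintegral \<mu> (\<lambda>x. g (r x)) = (\<Sum>j\<in>range r. g j *\<^sub>C vmeas \<mu> (r -` {j}))"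
proof -
  have "simple_vintegral \<mu> (\<lambda>x. g (r x)) =
    (\<Sum>y\<in>g ` range r. \<Sum>j | j \<in> range r \<and> g j = y. g j *\<^sub>C vmeas \<mu> (r -` {j}))"
    unfolding simple_vintegral_def vmeas_fibre_sum[OF assms] scaleC_sum_right
    by (intro sum.cong) auto
  also have "\<dots> = (\<Sum>j\<in>range r. g j *\<^sub>C vmeas \<mu> (r -` {j}))"
    using assms(1) by (subst sum.image_gen[of "range r" _ g]) auto
  finally show ?thesis .
qed

lemma pair_fibres:
  assumes "finite (range s)" "\<And>j. s -` {j} \<in> sets M" "finite (range t)" "\<And>j. t -` {j} \<in> sets M"
  shows "finite (range (\<lambda>x. (s x, t x)))" "(\<lambda>x. (s x, t x)) -` {j} \<in> sets M"
proof -
  have "range (\<lambda>x. (s x, t x)) \<subseteq> range s \<times> range t" by auto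
  then show "finite (range (\<lambda>x. (s x, t x)))" using assms by (meson finite_SigmaI finite_subset)
  have "(\<lambda>x. (s x, t x)) -` {j} = s -` {fst j} \<inter> t -` {snd j}" by (cases j) auto
  then show "(\<lambda>x. (s x, t x)) -` {j} \<in> sets M" using assms by auto
qed

lemma simple_vintegral_add:
  assumes "simple_function borel s" "simple_function borel t"
  shows "simple_vintegral \<mu> (\<lambda>x. s x + t x) = simple_vintegral \<mu> s + simple_vintegral \<mu> t"
proof -
  let ?r = "\<lambda>x. (s x, t x)"
  note r = pair_fibres[OF simple_function_range[OF assms(1)] simple_function_fibre[OF assms(1)]
      simple_function_range[OF assms(2)] simple_function_fibre[OF assms(2)]]
  show ?thesis
    using simple_vintegral_refine[OF r, of \<mu> "\<lambda>p. fst p + snd p"]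
      simple_vintegral_refine[OF r, of \<mu> fst] simple_vintegral_refine[OF r, of \<mu> snd]
    by (simp add: scaleC_add_left sum.distrib)
qed

lemma simple_vintegral_cmult:
  assumes "simple_function borel s"
  shows "simple_vintegral \<mu> (\<lambda>x. c * s x) = c *\<^sub>C simple_vintegral \<mu> s"
  using simple_vintegral_refine[OF simple_function_range[OF assms] simple_function_fibre[OF assms], of \<mu> "\<lambda>y. c * y"]
  by (simp add: simple_vintegral_def scaleC_sum_right scaleC_scaleC)

lemma scaleC_minus_one: "(- 1) *\<^sub>C x = - (x :: 'a::complex_normed_vector)"
  using scaleR_scaleC[of "-1" x] by simp

lemma simple_function_add_complex:
  fixes s t :: "'a \<Rightarrow> complex"
  shows "simple_function M s \<Longrightarrow> simple_function M t \<Longrightarrow> simple_function M (\<lambda>x. s x + c * t x)"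
  by (rule simple_function_compose2)

lemma simple_vintegral_diff:
  assumes "simple_function borel s" "simple_function borel t"
  shows "simple_vintegral \<mu> (\<lambda>x. s x - t x) = simple_vintegral \<mu> s - simple_vintegral \<mu> t"
proof -
  have "simple_function borel (\<lambda>x. (-1) * t x)"
    using simple_function_compose1[OF assms(2), of "\<lambda>y. (-1) * y"] by simp
  from simple_vintegral_add[OF assms(1) this, of \<mu>] show ?thesis
    using simple_vintegral_cmult[OF assms(2), of \<mu> "-1"] by (simp add: scaleC_minus_one)
qed

lemma norm_simple_vintegral_le_sum:
  assumes "simple_function borel s"
  shows "norm (simple_vintegral \<mu> s) \<le> (\<Sum>y\<in>range s. cmod y * norm (vmeas \<mu> (s -` {y})))"
  unfolding simple_vintegral_def by (rule sum_norm_le) (simp add: norm_scaleC)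

lemma norm_simple_vintegral_le:
  assumes "simple_function borel s" "\<And>x. cmod (s x) \<le> B"
  shows "norm (simple_vintegral \<mu> s) \<le> B * norm \<mu>"
proof -
  have "norm (simple_vintegral \<mu> s) \<le> (\<Sum>y\<in>range s. cmod y * norm (vmeas \<mu> (s -` {y})))"
    by (rule norm_simple_vintegral_le_sum[OF assms(1)])
  also have "\<dots> \<le> (\<Sum>y\<in>range s. B * norm (vmeas \<mu> (s -` {y})))"
    using assms(2) by (intro sum_mono mult_right_mono) auto
  also have "\<dots> \<le> B * norm \<mu>"
    unfolding sum_distrib_left[symmetric]
    using order_trans[OF norm_ge_zero assms(2)] assms(1)
    by (intro mult_left_mono sum_norm_vmeas_le simple_function_range simple_function_fibre)
      (auto simp: disjoint_family_on_def)
  finally show ?thesis .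
qed

lemma simple_vintegral_indicator:
  assumes "A \<in> sets borel"
  shows "simple_vintegral \<mu> (\<lambda>x. c * indicator A x) = c *\<^sub>C vmeas \<mu> A"
proof -
  let ?r = "\<lambda>x. x \<in> A"
  have *: "?r -` {b} \<in> sets borel" for b
  proof -
    have "?r -` {b} = (if b then A else - A)" by auto
    then show ?thesis using assms by (auto simp: Compl_eq_Diff_UNIV)
  qed
  have "simple_vintegral \<mu> (\<lambda>x. (\<lambda>b. if b then c else 0) (?r x)) =
    (\<Sum>b\<in>range ?r. (if b then c else 0) *\<^sub>C vmeas \<mu> (?r -` {b}))"
    by (rule simple_vintegral_refine) (simp_all add: *)
  also have "\<dots> = (\<Sum>b\<in>UNIV. (if b then c else 0) *\<^sub>C vmeas \<mu> (?r -` {b}))"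
    by (rule sum.mono_neutral_left) auto
  also have "\<dots> = c *\<^sub>C vmeas \<mu> A"
    using scaleR_scaleC[of 0] by (simp add: UNIV_bool vimage_def)
  also have "(\<lambda>x. (\<lambda>b. if b then c else 0) (?r x)) = (\<lambda>x. c * indicator A x)"
    by (auto simp: indicator_def)
  finally show ?thesis .
qed

lemma simple_vintegral_close:
  assumes "simple_function borel s" "simple_function borel t"
    "\<And>x. cmod (s x - f x) \<le> d" "\<And>x. cmod (t x - f x) \<le> e"
  shows "norm (simple_vintegral \<mu> s - simple_vintegral \<mu> t) \<le> (d + e) * norm \<mu>"
  unfolding simple_vintegral_diff[OF assms(1,2), symmetric]
proof (rule norm_simple_vintegral_le)
  have "simple_function borel (\<lambda>x. (\<lambda>(a, b). a - b) (s x, t x))"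
    using simple_function_compose1[OF simple_function_Pair[OF assms(1,2)]] .
  then show "simple_function borel (\<lambda>x. s x - t x)" by simp
  show "cmod (s x - t x) \<le> d + e" for x
    using assms(3,4)[of x] norm_triangle_ineq4[of "s x - f x" "t x - f x"] by simp
qed

text \<open>A quantitative form of the independence from the approximating sequence: two candidates
  for the integral are compared with the same simple function \<open>t\<close>.\<close>

lemma has_vintegral_close:
  assumes "has_vintegral \<mu> f I" "simple_function borel t" "\<And>x. cmod (t x - f x) \<le> e"
  shows "norm (simple_vintegral \<mu> t - I) \<le> e * norm \<mu>"
proof -
  obtain s where s: "\<And>n. simple_function borel (s n)" "uniform_limit UNIV s f sequentially"
    "(\<lambda>n. simple_vintegral \<mu> (s n)) \<longlonglongrightarrow> I"
    using assms(1) by (auto simp: has_vintegral_def)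
  have "norm (simple_vintegral \<mu> t - I) \<le> (e + d) * norm \<mu>" if d: "d > 0" for d
  proof (rule tendsto_upperbound)
    show "(\<lambda>n. norm (simple_vintegral \<mu> t - simple_vintegral \<mu> (s n))) \<longlonglongrightarrow> norm (simple_vintegral \<mu> t - I)"
      by (intro tendsto_intros s)
    have "\<forall>\<^sub>F n in sequentially. \<forall>x\<in>UNIV. dist (s n x) (f x) < d"
      using uniform_limitD[OF s(2) d] .
    then show "\<forall>\<^sub>F n in sequentially. norm (simple_vintegral \<mu> t - simple_vintegral \<mu> (s n)) \<le> (e + d) * norm \<mu>"
      by eventually_elim (rule simple_vintegral_close[OF assms(2) s(1) assms(3)], auto simp: dist_norm less_imp_le)
  qed simp
  then have "\<forall>\<^sub>F d in at_right 0. norm (simple_vintegral \<mu> t - I) \<le> (e + d) * norm \<mu>"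
    by (auto simp: eventually_at_filter)
  moreover have "((\<lambda>d. (e + d) * norm \<mu>) \<longlongrightarrow> (e + 0) * norm \<mu>) (at_right 0)"
    by (intro tendsto_intros)
  ultimately show ?thesis using tendsto_lowerbound[of "\<lambda>d. (e + d) * norm \<mu>"] by force
qed

lemma has_vintegral_unique:
  assumes "has_vintegral \<mu> f I" "has_vintegral \<mu> f J" "f \<in> bdd_borel"
  shows "I = J"
proof -
  have "norm (I - J) \<le> 2 * e * norm \<mu>" if e: "e > 0" for e
  proof -
    obtain t where t: "simple_function borel t" "\<And>x. cmod (t x - f x) \<le> e"
      using uniform_simple_approx[OF assms(3) e] by blast
    from has_vintegral_close[OF assms(1) t] has_vintegral_close[OF assms(2) t]
    show ?thesis using norm_triangle_ineq4[of "simple_vintegral \<mu> t - J" "simple_vintegral \<mu> t - I"] by simp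
  qed
  then have "\<forall>\<^sub>F e in at_right 0. norm (I - J) \<le> 2 * e * norm \<mu>"
    by (auto simp: eventually_at_filter)
  moreover have "((\<lambda>e. 2 * e * norm \<mu>) \<longlongrightarrow> 2 * 0 * norm \<mu>) (at_right 0)"
    by (intro tendsto_intros)
  ultimately have "norm (I - J) \<le> 2 * 0 * norm \<mu>"
    using tendsto_lowerbound[of "\<lambda>e. 2 * e * norm \<mu>"] by force
  then show ?thesis by simp
qed

lemma has_vintegral_vintegral:
  fixes \<mu> :: "('a::topological_space, 'h::{complex_normed_vector, banach}) vmeasure"
  assumes "f \<in> bdd_borel"
  shows "has_vintegral \<mu> f (vintegral \<mu> f)"
proof -
  have "\<forall>n. \<exists>s. simple_function borel s \<and> (\<forall>x. cmod (s x - f x) \<le> inverse (real (Suc n)))"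
    using uniform_simple_approx[OF assms] by (metis inverse_positive_iff_positive of_nat_0_less_iff zero_less_Suc)
  then obtain s where s: "\<And>n. simple_function borel (s n)"
    "\<And>n x. cmod (s n x - f x) \<le> inverse (real (Suc n))" by metis
  have lim0: "(\<lambda>n. inverse (real (Suc n))) \<longlonglongrightarrow> 0" by (rule LIMSEQ_inverse_real_of_nat)
  have "Cauchy (\<lambda>n. simple_vintegral \<mu> (s n))"
  proof (rule metric_CauchyI)
    fix e :: real assume e: "e > 0"
    have "(\<lambda>n. 2 * inverse (real (Suc n)) * norm \<mu>) \<longlonglongrightarrow> 2 * 0 * norm \<mu>"
      by (intro tendsto_intros lim0)
    then obtain N where N: "2 * inverse (real (Suc N)) * norm \<mu> < e"
      using order_tendstoD(2)[of _ 0 sequentially e] e by (auto simp: eventually_sequentially)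
    have "dist (simple_vintegral \<mu> (s m)) (simple_vintegral \<mu> (s n)) < e" if "m \<ge> N" "n \<ge> N" for m n
    proof -
      have i: "inverse (real (Suc k)) \<le> inverse (real (Suc N))" if "k \<ge> N" for k
        using that by (intro le_imp_inverse_le) auto
      have "dist (simple_vintegral \<mu> (s m)) (simple_vintegral \<mu> (s n)) \<le>
        (inverse (real (Suc N)) + inverse (real (Suc N))) * norm \<mu>"
        unfolding dist_norm
        by (rule simple_vintegral_close[OF s(1) s(1), of _ f])
          (use order_trans[OF s(2) i] that in blast)+
      with N show ?thesis by (simp add: algebra_simps)
    qed
    then show "\<exists>N. \<forall>m\<ge>N. \<forall>n\<ge>N. dist (simple_vintegral \<mu> (s m)) (simple_vintegral \<mu> (s n)) < e" by blast
  qed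
  then obtain I where I: "(\<lambda>n. simple_vintegral \<mu> (s n)) \<longlonglongrightarrow> I"
    using Cauchy_convergent convergent_def by blast
  have "uniform_limit UNIV s f sequentially"
  proof (rule uniform_limitI)
    fix e :: real assume "e > 0"
    then have "\<forall>\<^sub>F n in sequentially. inverse (real (Suc n)) < e" by (rule order_tendstoD(2)[OF lim0])
    then show "\<forall>\<^sub>F n in sequentially. \<forall>x\<in>UNIV. dist (s n x) (f x) < e"
      by eventually_elim (use s(2) in \<open>auto simp: dist_norm intro: le_less_trans\<close>)
  qed
  with I s(1) have hI: "has_vintegral \<mu> f I" unfolding has_vintegral_def by blast
  then have "vintegral \<mu> f = I"
    unfolding vintegral_def using has_vintegral_unique[OF _ _ assms] by blast
  with hI show ?thesis by simp
qed

lemma vintegral_close: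
  fixes \<mu> :: "('a::topological_space, 'h::{complex_normed_vector, banach}) vmeasure"
  assumes "f \<in> bdd_borel" "simple_function borel t" "\<And>x. cmod (t x - f x) \<le> e"
  shows "norm (simple_vintegral \<mu> t - vintegral \<mu> f) \<le> e * norm \<mu>"
  using has_vintegral_close[OF has_vintegral_vintegral[OF assms(1)] assms(2,3)] .

lemma vintegral_simple:
  fixes \<mu> :: "('a::topological_space, 'h::{complex_normed_vector, banach}) vmeasure"
  assumes "simple_function borel s"
  shows "vintegral \<mu> s = simple_vintegral \<mu> s"
  using vintegral_close[OF simple_function_bdd_borel[OF assms] assms, of 0 \<mu>] by simp

lemma vintegral_indicator:
  fixes \<mu> :: "('a::topological_space, 'h::{complex_normed_vector, banach}) vmeasure"
  assumes "A \<in> sets borel"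
  shows "vintegral \<mu> (\<lambda>x. c * indicator A x) = c *\<^sub>C vmeas \<mu> A"
proof -
  have "simple_function borel (indicator A :: 'a \<Rightarrow> complex)" using assms by (intro simple_function_indicator) 
  then have "simple_function borel (\<lambda>x. c * indicator A x)" by (rule simple_function_compose1)
  then show ?thesis by (simp add: vintegral_simple simple_vintegral_indicator assms)
qed

lemma norm_vintegral_le:
  fixes \<mu> :: "('a::topological_space, 'h::{complex_normed_vector, banach}) vmeasure"
  assumes "f \<in> bdd_borel" "\<And>x. cmod (f x) \<le> B"
  shows "norm (vintegral \<mu> f) \<le> B * norm \<mu>"
proof (rule field_le_epsilon)
  fix e' :: real assume e': "e' > 0"
  define e where "e = e' / (2 * norm \<mu> + 1)"
  have e: "e > 0" "2 * e * norm \<mu> \<le> e'" using e' by (auto simp: e_def field_simps add_pos_nonneg)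
  obtain t where t: "simple_function borel t" "\<And>x. cmod (t x - f x) \<le> e"
    using uniform_simple_approx[OF assms(1) e(1)] by blast
  have "cmod (t x) \<le> B + e" for x
    using assms(2)[of x] t(2)[of x] norm_triangle_ineq2[of "t x" "f x"] by simp
  from norm_simple_vintegral_le[OF t(1) this, of \<mu>] vintegral_close[OF assms(1) t, of \<mu>]
  show "norm (vintegral \<mu> f) \<le> B * norm \<mu> + e'"
    using e norm_triangle_sub[of "vintegral \<mu> f" "simple_vintegral \<mu> t"]
    by (simp add: norm_minus_commute algebra_simps)
qed

lemma vintegral_add:
  fixes \<mu> :: "('a::topological_space, 'h::{complex_normed_vector, banach}) vmeasure"
  assumes f: "f \<in> bdd_borel" and g: "g \<in> bdd_borel"
  shows "vintegral \<mu> (\<lambda>x. f x + g x) = vintegral \<mu> f + vintegral \<mu> g"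
proof -
  have "norm (vintegral \<mu> (\<lambda>x. f x + g x) - (vintegral \<mu> f + vintegral \<mu> g)) \<le> 0 + e'" if e': "e' > 0" for e'
  proof -
    define e where "e = e' / (4 * norm \<mu> + 1)"
    have e: "e > 0" "4 * e * norm \<mu> \<le> e'" using e' by (auto simp: e_def field_simps add_pos_nonneg)
    obtain s t where s: "simple_function borel s" "\<And>x. cmod (s x - f x) \<le> e"
      and t: "simple_function borel t" "\<And>x. cmod (t x - g x) \<le> e"
      using uniform_simple_approx[OF f e(1)] uniform_simple_approx[OF g e(1)] by metis
    have st: "simple_function borel (\<lambda>x. s x + t x)" using simple_function_add_complex[OF s(1) t(1), of 1] by simp
    have "cmod (s x + t x - (f x + g x)) \<le> 2 * e" for x
      using s(2)[of x] t(2)[of x] norm_triangle_ineq[of "s x - f x" "t x - g x"] by (simp add: algebra_simps)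
    from vintegral_close[OF bdd_borel_add[OF f g] st this, of \<mu>] vintegral_close[OF f s, of \<mu>] vintegral_close[OF g t, of \<mu>]
    have 1: "norm (simple_vintegral \<mu> s + simple_vintegral \<mu> t - vintegral \<mu> (\<lambda>x. f x + g x)) \<le> 2 * e * norm \<mu>"
      "norm (simple_vintegral \<mu> s - vintegral \<mu> f) \<le> e * norm \<mu>"
      "norm (simple_vintegral \<mu> t - vintegral \<mu> g) \<le> e * norm \<mu>"
      by (simp_all add: simple_vintegral_add s t)
    have "vintegral \<mu> (\<lambda>x. f x + g x) - (vintegral \<mu> f + vintegral \<mu> g) =
      (simple_vintegral \<mu> s - vintegral \<mu> f) + (simple_vintegral \<mu> t - vintegral \<mu> g)
      - (simple_vintegral \<mu> s + simple_vintegral \<mu> t - vintegral \<mu> (\<lambda>x. f x + g x))" by simp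
    also have "norm \<dots> \<le> e * norm \<mu> + e * norm \<mu> + 2 * e * norm \<mu>"
      using 1 by (meson add_mono norm_triangle_le norm_triangle_le_diff)
    finally show ?thesis using e by simp
  qed
  then have "norm (vintegral \<mu> (\<lambda>x. f x + g x) - (vintegral \<mu> f + vintegral \<mu> g)) \<le> 0"
    by (rule field_le_epsilon)
  then show ?thesis by simp
qed

text \<open>Simple functions are uniformly dense, so a bounded additive functional is determined by
  its values on multiples of indicators. Scalars enter only through \<open>ind\<close>, which admits
  functionals that are merely real-linear, such as those built from real parts. Most identities
  between integrals below are obtained in this way.\<close>

lemma bdd_borel_zero_principle:
  fixes \<Phi> :: "('a::topological_space \<Rightarrow> complex) \<Rightarrow> 'b::real_normed_vector"
  assumes add: "\<And>f g. f \<in> bdd_borel \<Longrightarrow> g \<in> bdd_borel \<Longrightarrow> \<Phi> (\<lambda>x. f x + g x) = \<Phi> f + \<Phi> g"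
    and bound: "\<And>f B. f \<in> bdd_borel \<Longrightarrow> (\<And>x. cmod (f x) \<le> B) \<Longrightarrow> norm (\<Phi> f) \<le> C * B"
    and ind: "\<And>c A. A \<in> sets borel \<Longrightarrow> \<Phi> (\<lambda>x. c * indicator A x) = 0"
    and f: "f \<in> bdd_borel"
  shows "\<Phi> f = 0"
proof -
  have sum0: "\<Phi> (\<lambda>x. \<Sum>i\<in>I. c i * indicator (A i) x) = 0 \<and> (\<lambda>x. \<Sum>i\<in>I. c i * indicator (A i) x) \<in> bdd_borel"
    if "finite I" "\<And>i. A i \<in> sets borel" for I :: "complex set" and c A
    using that
  proof (induction I rule: finite_induct)
    case empty
    then show ?case using ind[of "{}" 0] bdd_borel_const[of 0] by simp
  next
    case (insert i I)
    then show ?case using add[of "\<lambda>x. c i * indicator (A i) x" "\<lambda>x. \<Sum>i\<in>I. c i * indicator (A i) x"] ind[of "A i" "c i"]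
        bdd_borel_add[of "\<lambda>x. c i * indicator (A i) x" "\<lambda>x. \<Sum>i\<in>I. c i * indicator (A i) x"]
        bdd_borel_cmult[OF bdd_borel_indicator[of "A i"], of "c i"]
      by (simp del: sum_mult_indicator sum_indicator_mult)
  qed
  have simple: "\<Phi> s = 0" if s: "simple_function borel s" for s
  proof -
    have "s x = (\<Sum>y\<in>range s. y * indicator (s -` {y}) x)" for x
    proof -
      have "(\<Sum>y\<in>range s. y * indicator (s -` {y}) x) = (\<Sum>y\<in>range s. if y = s x then y else 0)"
        by (intro sum.cong) (auto simp: indicator_def)
      then show ?thesis using simple_function_range[OF s] by simp
    qed
    then have "s = (\<lambda>x. \<Sum>y\<in>range s. y * indicator (s -` {y}) x)" by blast
    with sum0[OF simple_function_range[OF s], of "\<lambda>y. s -` {y}" "\<lambda>y. y"] simple_function_fibre[OF s]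
    show ?thesis by simp
  qed
  have "norm (\<Phi> f) \<le> 0 + e'" if e': "e' > 0" for e'
  proof -
    define e where "e = e' / (\<bar>C\<bar> + 1)"
    have e: "e > 0" using e' by (auto simp: e_def add_nonneg_pos)
    have "C * e \<le> (\<bar>C\<bar> + 1) * e" using e by (intro mult_right_mono) auto
    also have "\<dots> = e'" by (simp add: e_def add_nonneg_pos less_imp_neq[symmetric])
    finally have Ce: "C * e \<le> e'" .
    obtain s where s: "simple_function borel s" "\<And>x. cmod (s x - f x) \<le> e"
      using uniform_simple_approx[OF f e] by blast
    have fs: "(\<lambda>x. f x - s x) \<in> bdd_borel" by (intro bdd_borel_diff f simple_function_bdd_borel s)
    have "\<Phi> f = \<Phi> (\<lambda>x. f x - s x)" using add[OF fs simple_function_bdd_borel[OF s(1)]] simple[OF s(1)] by simp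
    moreover have "norm (\<Phi> (\<lambda>x. f x - s x)) \<le> C * e"
      using s(2) by (intro bound fs) (simp add: norm_minus_commute)
    ultimately show ?thesis using Ce by simp
  qed
  then have "norm (\<Phi> f) \<le> 0" by (rule field_le_epsilon)
  then show ?thesis by simp
qed

lemma vintegral_eqI:
  fixes \<Phi> :: "('a::topological_space \<Rightarrow> complex) \<Rightarrow> 'h::{complex_normed_vector, banach}"
  assumes add: "\<And>f g. f \<in> bdd_borel \<Longrightarrow> g \<in> bdd_borel \<Longrightarrow> \<Phi> (\<lambda>x. f x + g x) = \<Phi> f + \<Phi> g"
    and bound: "\<And>f B. f \<in> bdd_borel \<Longrightarrow> (\<And>x. cmod (f x) \<le> B) \<Longrightarrow> norm (\<Phi> f) \<le> C * B"
    and ind: "\<And>c A. A \<in> sets borel \<Longrightarrow> \<Phi> (\<lambda>x. c * indicator A x) = c *\<^sub>C vmeas \<mu> A"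
    and f: "f \<in> bdd_borel"
  shows "vintegral \<mu> f = \<Phi> f"
proof -
  have "\<Phi> f - vintegral \<mu> f = 0"
  proof (rule bdd_borel_zero_principle[where \<Phi> = "\<lambda>f. \<Phi> f - vintegral \<mu> f" and C = "C + norm \<mu>"])
    fix f :: "'a \<Rightarrow> complex" and B assume "f \<in> bdd_borel" "\<And>x. cmod (f x) \<le> B"
    with bound[OF this] norm_vintegral_le[OF this, of \<mu>]
    show "norm (\<Phi> f - vintegral \<mu> f) \<le> (C + norm \<mu>) * B"
      using norm_triangle_ineq4[of "\<Phi> f" "vintegral \<mu> f"] by (simp add: algebra_simps)
  qed (simp_all add: add vintegral_add ind vintegral_indicator f)
  then show ?thesis by simp
qed

lemma vintegral_scaleC_measure:
  fixes \<mu> :: "('a::topological_space, 'h::{complex_normed_vector, banach}) vmeasure"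
  assumes "f \<in> bdd_borel"
  shows "vintegral (c *\<^sub>C \<mu>) f = c *\<^sub>C vintegral \<mu> f"
proof (rule vintegral_eqI[where C = "cmod c * norm \<mu>"])
  fix f :: "'a \<Rightarrow> complex" and B assume f: "f \<in> bdd_borel" "\<And>x. cmod (f x) \<le> B"
  from norm_vintegral_le[OF this, of \<mu>]
  show "norm (c *\<^sub>C vintegral \<mu> f) \<le> cmod c * norm \<mu> * B"
    using mult_left_mono[of "norm (vintegral \<mu> f)" "B * norm \<mu>" "cmod c"] by (simp add: norm_scaleC mult_ac)
qed (use assms in \<open>simp_all add: vintegral_add scaleC_add_right vintegral_indicator vmeas_simps scaleC_scaleC mult_ac\<close>)

lemma vintegral_cmult:
  fixes \<mu> :: "('a::topological_space, 'h::{complex_normed_vector, banach}) vmeasure"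
  assumes "f \<in> bdd_borel"
  shows "vintegral \<mu> (\<lambda>x. c * f x) = c *\<^sub>C vintegral \<mu> f"
proof -
  have "vintegral (c *\<^sub>C \<mu>) f = vintegral \<mu> (\<lambda>x. c * f x)"
  proof (rule vintegral_eqI[where C = "cmod c * norm \<mu>"])
    fix f g :: "'a \<Rightarrow> complex" assume fg: "f \<in> bdd_borel" "g \<in> bdd_borel"
    then show "vintegral \<mu> (\<lambda>x. c * (f x + g x)) = vintegral \<mu> (\<lambda>x. c * f x) + vintegral \<mu> (\<lambda>x. c * g x)"
      using vintegral_add[OF bdd_borel_cmult[OF fg(1), of c] bdd_borel_cmult[OF fg(2), of c], of \<mu>]
      by (simp add: algebra_simps)
  next
    fix f :: "'a \<Rightarrow> complex" and B assume f: "f \<in> bdd_borel" "\<And>x. cmod (f x) \<le> B"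
    then have "cmod (c * f x) \<le> cmod c * B" for x by (simp add: norm_mult mult_left_mono)
    from norm_vintegral_le[OF bdd_borel_cmult[OF f(1)] this, of \<mu>]
    show "norm (vintegral \<mu> (\<lambda>x. c * f x)) \<le> cmod c * norm \<mu> * B" by (simp add: algebra_simps)
  next
    fix d and A :: "'a set" assume "A \<in> sets borel"
    then show "vintegral \<mu> (\<lambda>x. c * (d * indicator A x)) = d *\<^sub>C vmeas (c *\<^sub>C \<mu>) A"
      using vintegral_indicator[of A \<mu> "c * d"] by (simp add: vmeas_simps scaleC_scaleC mult_ac)
  qed (rule assms)
  then show ?thesis using vintegral_scaleC_measure[OF assms] by metis
qed

lemma vintegral_add_measure:
  fixes \<mu> \<nu> :: "('a::topological_space, 'h::{complex_normed_vector, banach}) vmeasure"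
  assumes "f \<in> bdd_borel"
  shows "vintegral (\<mu> + \<nu>) f = vintegral \<mu> f + vintegral \<nu> f"
proof (rule vintegral_eqI[where C = "norm \<mu> + norm \<nu>"])
  fix f :: "'a \<Rightarrow> complex" and B assume f: "f \<in> bdd_borel" "\<And>x. cmod (f x) \<le> B"
  from norm_vintegral_le[OF this, of \<mu>] norm_vintegral_le[OF this, of \<nu>]
  show "norm (vintegral \<mu> f + vintegral \<nu> f) \<le> (norm \<mu> + norm \<nu>) * B"
    using norm_triangle_ineq[of "vintegral \<mu> f" "vintegral \<nu> f"] by (simp add: algebra_simps)
qed (use assms in \<open>simp_all add: vintegral_add vintegral_indicator vmeas_simps scaleC_add_right\<close>)

lemma bounded_linear_vintegral:
  fixes f :: "'a::topological_space \<Rightarrow> complex"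
  assumes "f \<in> bdd_borel"
  shows "bounded_linear (\<lambda>\<mu> :: ('a, 'h::{complex_normed_vector, banach}) vmeasure. vintegral \<mu> f)"
proof -
  obtain B where B: "\<And>x. cmod (f x) \<le> B" using assms unfolding bdd_borel_def by blast
  show ?thesis
    by (rule bounded_linear_intro[of _ B])
      (simp_all add: assms vintegral_add_measure scaleR_scaleC vintegral_scaleC_measure
        norm_vintegral_le[OF assms B] mult.commute)
qed

lemma vmeas_image:
  "g \<in> borel_measurable borel \<Longrightarrow> A \<in> sets borel \<Longrightarrow> vmeas (image_vmeasure g \<mu>) A = vmeas \<mu> (g -` A)"
  by (simp add: image_vmeasure.rep_eq)

lemma vintegral_image:
  fixes \<mu> :: "('a::topological_space, 'h::{complex_normed_vector, banach}) vmeasure"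
  assumes f: "f \<in> bdd_borel" and g: "g \<in> borel_measurable borel"
  shows "vintegral (image_vmeasure g \<mu>) f = vintegral \<mu> (\<lambda>x. f (g x))"
proof (rule vintegral_eqI[where C = "norm \<mu>"])
  fix f :: "'b \<Rightarrow> complex" and B assume f: "f \<in> bdd_borel" "\<And>x. cmod (f x) \<le> B"
  from norm_vintegral_le[OF bdd_borel_compose[OF f(1) g], of B \<mu>] f(2)
  show "norm (vintegral \<mu> (\<lambda>x. f (g x))) \<le> norm \<mu> * B" by (simp add: mult.commute)
next
  fix c and A :: "'b set" assume A: "A \<in> sets borel"
  have "g -` A \<in> sets borel" using measurable_sets[OF g A] by simp
  then show "vintegral \<mu> (\<lambda>x. c * indicator A (g x)) = c *\<^sub>C vmeas (image_vmeasure g \<mu>) A"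
    using vintegral_indicator[of "g -` A" \<mu> c] A g by (simp add: vmeas_image indicator_vimage)
qed (use f g in \<open>simp_all add: vintegral_add bdd_borel_compose\<close>)

lemma vintegral_restrict:
  fixes \<mu> :: "('a::topological_space, 'h::{complex_normed_vector, banach}) vmeasure"
  assumes f: "f \<in> bdd_borel" and E: "E \<in> sets borel"
  shows "vintegral (restrict_vmeasure E \<mu>) f = vintegral \<mu> (\<lambda>x. indicator E x * f x)"
proof (rule vintegral_eqI[where C = "norm \<mu>"])
  fix f :: "'a \<Rightarrow> complex" and B assume f: "f \<in> bdd_borel" "\<And>x. cmod (f x) \<le> B"
  have "cmod (indicator E x * f x) \<le> B" for x
    using f(2)[of x] order_trans[OF norm_ge_zero f(2)] by (auto simp: indicator_def)
  from norm_vintegral_le[OF bdd_borel_mult[OF bdd_borel_indicator[OF E] f(1)] this, of \<mu>]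
  show "norm (vintegral \<mu> (\<lambda>x. indicator E x * f x)) \<le> norm \<mu> * B" by (simp add: mult.commute)
next
  fix f g :: "'a \<Rightarrow> complex" assume fg: "f \<in> bdd_borel" "g \<in> bdd_borel"
  show "vintegral \<mu> (\<lambda>x. indicator E x * (f x + g x)) =
    vintegral \<mu> (\<lambda>x. indicator E x * f x) + vintegral \<mu> (\<lambda>x. indicator E x * g x)"
    unfolding distrib_left by (intro vintegral_add bdd_borel_mult bdd_borel_indicator E fg)
next
  fix c and A :: "'a set" assume A: "A \<in> sets borel"
  have "(\<lambda>x. indicator E x * (c * indicator A x)) = (\<lambda>x. c * indicator (E \<inter> A) x :: complex)"
    by (auto simp: indicator_def)
  then show "vintegral \<mu> (\<lambda>x. indicator E x * (c * indicator A x)) = c *\<^sub>C vmeas (restrict_vmeasure E \<mu>) A"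
    using A E vintegral_indicator[of "E \<inter> A" \<mu> c] by (simp add: vmeas_restrict)
qed (rule f)

text \<open>Sharper than the bound by the supremum of \<open>f\<close>: it brings scalar convergence
  theorems for the variation to bear on integrands that tend to zero only pointwise.\<close>

lemma norm_vintegral_le_variation:
  fixes \<mu> :: "('a::topological_space, 'h::{complex_normed_vector, banach}) vmeasure"
  assumes f: "f \<in> bdd_borel"
  shows "norm (vintegral \<mu> f) \<le> (\<integral>x. cmod (f x) \<partial>variation \<mu>)"
proof -
  interpret finite_measure "variation \<mu>" by (rule finite_measure_variation)
  have int: "integrable (variation \<mu>) (\<lambda>x. cmod (g x))" if g: "g \<in> bdd_borel" for g :: "'a \<Rightarrow> complex"
  proof -
    have [measurable]: "g \<in> borel_measurable borel" using g by (rule bdd_borel_measurable)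
    from g obtain B where "\<And>x. cmod (g x) \<le> B" unfolding bdd_borel_def by blast
    then show ?thesis by (intro integrable_const_bound[of _ B]) auto
  qed
  have simple: "norm (simple_vintegral \<mu> s) \<le> (\<integral>x. cmod (s x) \<partial>variation \<mu>)" if s: "simple_function borel s" for s
  proof -
    have "cmod (s x) = (\<Sum>y\<in>range s. cmod y * indicator (s -` {y}) x)" for x
    proof -
      have "(\<Sum>y\<in>range s. cmod y * indicator (s -` {y}) x) = (\<Sum>y\<in>range s. if y = s x then cmod y else 0)"
        by (intro sum.cong) (auto simp: indicator_def)
      then show ?thesis using simple_function_range[OF s] by simp
    qed
    then have "(\<integral>x. cmod (s x) \<partial>variation \<mu>) = (\<integral>x. (\<Sum>y\<in>range s. cmod y * indicator (s -` {y}) x) \<partial>variation \<mu>)"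
      by simp
    also have "\<dots> = (\<Sum>y\<in>range s. \<integral>x. cmod y * indicator (s -` {y}) x \<partial>variation \<mu>)"
      using simple_function_fibre[OF s]
      by (intro Bochner_Integration.integral_sum integrable_mult_right integrable_real_indicator) (auto simp: less_top[symmetric])
    also have "\<dots> = (\<Sum>y\<in>range s. cmod y * measure (variation \<mu>) (s -` {y}))" by simp
    also have "\<dots> \<ge> (\<Sum>y\<in>range s. cmod y * norm (vmeas \<mu> (s -` {y})))"
      by (intro sum_mono mult_left_mono norm_vmeas_le_variation simple_function_fibre[OF s]) auto
    finally show ?thesis using norm_simple_vintegral_le_sum[OF s, of \<mu>] by linarith
  qed
  show ?thesis
  proof (rule field_le_epsilon)
    fix e' :: real assume e': "e' > 0"
    define e where "e = e' / (2 * norm \<mu> + 1)"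
    have e: "e > 0" "2 * e * norm \<mu> \<le> e'" using e' by (auto simp: e_def field_simps add_pos_nonneg)
    obtain t where t: "simple_function borel t" "\<And>x. cmod (t x - f x) \<le> e"
      using uniform_simple_approx[OF f e(1)] by blast
    have "cmod (t x) \<le> cmod (f x) + e" for x
      using t(2)[of x] norm_triangle_sub[of "t x" "f x"] by simp
    then have "(\<integral>x. cmod (t x) \<partial>variation \<mu>) \<le> (\<integral>x. cmod (f x) + e \<partial>variation \<mu>)"
      by (intro integral_mono Bochner_Integration.integrable_add int f simple_function_bdd_borel t) auto
    also have "\<dots> = (\<integral>x. cmod (f x) \<partial>variation \<mu>) + e * norm \<mu>"
      using int[OF f] measure_variation[of UNIV \<mu>] by (simp add: restrict_UNIV)
    finally show "norm (vintegral \<mu> f) \<le> (\<integral>x. cmod (f x) \<partial>variation \<mu>) + e'"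
      using simple[OF t(1)] vintegral_close[OF f t, of \<mu>] e
        norm_triangle_sub[of "vintegral \<mu> f" "simple_vintegral \<mu> t"]
      by (simp add: norm_minus_commute algebra_simps)
  qed
qed

lemma norm_vintegral_restrict_le:
  fixes \<mu> :: "('a::topological_space, 'h::{complex_normed_vector, banach}) vmeasure"
  assumes "f \<in> bdd_borel" "E \<in> sets borel" "\<And>x. x \<in> E \<Longrightarrow> cmod (f x) \<le> B" "B \<ge> 0"
  shows "norm (vintegral (restrict_vmeasure E \<mu>) f) \<le> B * norm (restrict_vmeasure E \<mu>)"
proof -
  let ?f = "\<lambda>x. indicator E x * f x"
  have "vintegral (restrict_vmeasure E \<mu>) f = vintegral (restrict_vmeasure E (restrict_vmeasure E \<mu>)) f"
    using assms by (simp add: restrict_restrict)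
  also have "\<dots> = vintegral (restrict_vmeasure E \<mu>) ?f" by (rule vintegral_restrict[OF assms(1,2)])
  also have "norm \<dots> \<le> B * norm (restrict_vmeasure E \<mu>)"
    using assms by (intro norm_vintegral_le bdd_borel_mult bdd_borel_indicator) (auto simp: indicator_def)
  finally show ?thesis .
qed

section \<open>Approximation by measures with simple density\<close>

definition vector_multiple :: "'a::topological_space measure \<Rightarrow> 'h::real_normed_vector \<Rightarrow> ('a, 'h) vmeasure"
  where "vector_multiple M h = Abs_vmeasure (\<lambda>A. if A \<in> sets borel then measure M A *\<^sub>R h else 0)"

lemma vmeas_vector_multiple:
  fixes M :: "'a::topological_space measure"
  assumes M: "finite_measure M" "sets M = sets borel" and A: "A \<in> sets borel"
  shows "vmeas (vector_multiple M h) A = measure M A *\<^sub>R h"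
proof -
  interpret finite_measure M by fact
  have "is_vmeasure (\<lambda>A. if A \<in> sets borel then measure M A *\<^sub>R h else 0)"
  proof (rule is_vmeasureI[where C = "measure M (space M) * norm h"])
    fix A B :: "'a set" assume "A \<in> sets borel" "B \<in> sets borel" "A \<inter> B = {}"
    then show "(if A \<union> B \<in> sets borel then measure M (A \<union> B) *\<^sub>R h else 0) =
      (if A \<in> sets borel then measure M A *\<^sub>R h else 0) + (if B \<in> sets borel then measure M B *\<^sub>R h else 0)"
      using finite_measure_Union[of A B] by (simp add: M scaleR_add_left)
  next
    fix A :: "nat \<Rightarrow> 'a set" assume A: "range A \<subseteq> sets borel" "decseq A" "(\<Inter>n. A n) = {}"
    then have "(\<lambda>n. measure M (A n)) \<longlonglongrightarrow> measure M (\<Inter>n. A n)"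
      by (intro finite_Lim_measure_decseq) (auto simp: M)
    then have "(\<lambda>n. measure M (A n) *\<^sub>R h) \<longlonglongrightarrow> 0 *\<^sub>R h" using A by (intro tendsto_intros) simp
    moreover have "A n \<in> sets borel" for n using A by auto
    ultimately show "(\<lambda>n. if A n \<in> sets borel then measure M (A n) *\<^sub>R h else 0) \<longlonglongrightarrow> 0" by simp
  next
    fix n :: nat and A :: "nat \<Rightarrow> 'a set"
    assume A: "\<And>k. k < n \<Longrightarrow> A k \<in> sets borel" "disjoint_family_on A {..<n}"
    have "(\<Sum>k<n. norm (if A k \<in> sets borel then measure M (A k) *\<^sub>R h else 0)) = (\<Sum>k<n. measure M (A k)) * norm h"
      unfolding sum_distrib_right using A by (intro sum.cong) auto
    also have "(\<Sum>k<n. measure M (A k)) = measure M (\<Union>k<n. A k)"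
      using A by (intro finite_measure_finite_Union[symmetric]) (auto simp: M)
    also have "measure M (\<Union>k<n. A k) * norm h \<le> measure M (space M) * norm h"
      by (intro mult_right_mono bounded_measure) auto
    finally show "(\<Sum>k<n. norm (if A k \<in> sets borel then measure M (A k) *\<^sub>R h else 0)) \<le> measure M (space M) * norm h" .
  qed auto
  then show ?thesis using A by (simp add: vector_multiple_def Abs_vmeasure_inverse)
qed

definition borel_partition :: "('a::topological_space \<Rightarrow> 'i) \<Rightarrow> bool"
  where "borel_partition p \<longleftrightarrow> finite (range p) \<and> (\<forall>i. p -` {i} \<in> sets borel)"

text \<open>The measure with density \<open>c (p x)\<close> with respect to \<open>M\<close>,
  written as a finite sum over the cells of the partition.\<close>

definition step_vmeasure ::
  "'a::topological_space measure \<Rightarrow> ('a \<Rightarrow> 'i) \<Rightarrow> ('i \<Rightarrow> 'h::real_normed_vector) \<Rightarrow> ('a, 'h) vmeasure"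
  where "step_vmeasure M p c = (\<Sum>i\<in>range p. restrict_vmeasure (p -` {i}) (vector_multiple M (c i)))"

lemma borel_partition_pair:
  "borel_partition p \<Longrightarrow> borel_partition q \<Longrightarrow> borel_partition (\<lambda>x. (p x, q x))"
  using pair_fibres[of p borel q] by (auto simp: borel_partition_def)

lemma vmeas_step:
  assumes "finite_measure M" "sets M = sets borel" "borel_partition p" "A \<in> sets borel"
  shows "vmeas (step_vmeasure M p c) A = (\<Sum>i\<in>range p. measure M (p -` {i} \<inter> A) *\<^sub>R c i)"
proof -
  have "p -` {i} \<in> sets borel" for i using assms(3) by (simp add: borel_partition_def)
  then show ?thesis using assms(4)
    by (simp add: step_vmeasure_def vmeas_sum vmeas_restrict vmeas_vector_multiple[OF assms(1,2)])
qed

lemma measure_fibre_sum: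
  assumes M: "finite_measure M" "sets M = sets borel" and r: "borel_partition r" and A: "A \<in> sets borel"
  shows "measure M ((\<lambda>x. g (r x)) -` {y} \<inter> A) = (\<Sum>j | j \<in> range r \<and> g j = y. measure M (r -` {j} \<inter> A))"
proof -
  interpret finite_measure M by fact
  have "measure M (\<Union>j\<in>{j \<in> range r. g j = y}. r -` {j} \<inter> A) = (\<Sum>j | j \<in> range r \<and> g j = y. measure M (r -` {j} \<inter> A))"
    using r A by (intro finite_measure_finite_Union) (auto simp: disjoint_family_on_def borel_partition_def M)
  moreover have "(\<Union>j\<in>{j \<in> range r. g j = y}. r -` {j} \<inter> A) = (\<lambda>x. g (r x)) -` {y} \<inter> A" by auto
  ultimately show ?thesis by simp
qed

lemma vmeas_step_refine:
  assumes M: "finite_measure M" "sets M = sets borel" and r: "borel_partition r" and A: "A \<in> sets borel"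
    and p: "borel_partition (\<lambda>x. g (r x))"
  shows "vmeas (step_vmeasure M (\<lambda>x. g (r x)) c) A = (\<Sum>j\<in>range r. measure M (r -` {j} \<inter> A) *\<^sub>R c (g j))"
proof -
  have "vmeas (step_vmeasure M (\<lambda>x. g (r x)) c) A =
    (\<Sum>y\<in>g ` range r. \<Sum>j | j \<in> range r \<and> g j = y. measure M (r -` {j} \<inter> A) *\<^sub>R c (g j))"
    unfolding vmeas_step[OF M p A] measure_fibre_sum[OF M r A] scaleR_sum_left
    by (intro sum.cong) auto
  also have "\<dots> = (\<Sum>j\<in>range r. measure M (r -` {j} \<inter> A) *\<^sub>R c (g j))"
    using r by (subst sum.image_gen[of "range r" _ g]) (auto simp: borel_partition_def)
  finally show ?thesis .
qed

text \<open>Differences of step measures stay in the class, over the common refinement. An estimate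
  for step measures therefore also controls differences and yields Cauchy sequences.\<close>

lemma step_diff:
  assumes M: "finite_measure M" "sets M = sets borel" and p: "borel_partition p" and q: "borel_partition q"
  shows "step_vmeasure M p c - step_vmeasure M q d = step_vmeasure M (\<lambda>x. (p x, q x)) (\<lambda>(i, j). c i - d j)"
proof (rule vmeasure_eqI)
  fix A :: "'a set" assume A: "A \<in> sets borel"
  note r = borel_partition_pair[OF p q]
  have "vmeas (step_vmeasure M p c) A - vmeas (step_vmeasure M q d) A =
    (\<Sum>j\<in>range (\<lambda>x. (p x, q x)). measure M ((\<lambda>x. (p x, q x)) -` {j} \<inter> A) *\<^sub>R c (fst j)) -
    (\<Sum>j\<in>range (\<lambda>x. (p x, q x)). measure M ((\<lambda>x. (p x, q x)) -` {j} \<inter> A) *\<^sub>R d (snd j))"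
    using vmeas_step_refine[OF M r A, of fst c] vmeas_step_refine[OF M r A, of snd d] p q by simp
  also have "\<dots> = vmeas (step_vmeasure M (\<lambda>x. (p x, q x)) (\<lambda>(i, j). c i - d j)) A"
    unfolding vmeas_step[OF M r A] sum_subtractf[symmetric]
    by (intro sum.cong) (auto simp: scaleR_diff_right)
  finally show "vmeas (step_vmeasure M p c - step_vmeasure M q d) A =
    vmeas (step_vmeasure M (\<lambda>x. (p x, q x)) (\<lambda>(i, j). c i - d j)) A" by (simp add: vmeas_diff)
qed

lemma norm_diff_square:
  fixes x m :: "'h::complex_hilbert_space"
  shows "(norm (x - t *\<^sub>R m))\<^sup>2 = (norm x)\<^sup>2 - 2 * t * Re (cinner x m) + t\<^sup>2 * (norm m)\<^sup>2"
proof -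
  have r: "cinner a (u + v) = cinner a u + cinner a v" for a u v :: 'h
    by (metis cinner_commute cinner_add_left complex_cnj_add)
  have s: "cinner a (c *\<^sub>C u) = cnj c * cinner a u" for a u :: 'h and c
    by (metis cinner_commute cinner_scaleC_left complex_cnj_mult)
  have "x - t *\<^sub>R m = x + complex_of_real (- t) *\<^sub>C m" using scaleR_scaleC[of "- t" m] by simp
  then have "complex_of_real ((norm (x - t *\<^sub>R m))\<^sup>2) =
    cinner (x + complex_of_real (- t) *\<^sub>C m) (x + complex_of_real (- t) *\<^sub>C m)"
    using cinner_same by metis
  also have "\<dots> = cinner x x - t * (cinner m x + cinner x m) + t\<^sup>2 * cinner m m"
    by (simp add: cinner_add_left r s cinner_scaleC_left algebra_simps power2_eq_square)
  finally have "Re (complex_of_real ((norm (x - t *\<^sub>R m))\<^sup>2)) = Re (cinner x x - t * (cinner m x + cinner x m) + t\<^sup>2 * cinner m m)"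
    by simp
  moreover have "Re (cinner m x) = Re (cinner x m)" by (subst cinner_commute) simp
  ultimately show ?thesis by (simp add: cinner_same power2_eq_square)
qed

text \<open>Pythagoras for conditional expectations: the energy of a finer partition exceeds that of a
  coarser one by the squared distance of the corresponding step densities. The division by zero
  on null cells is harmless, as the vectors vanish there.\<close>

lemma energy_identity:
  fixes x :: "'j \<Rightarrow> 'h::complex_hilbert_space"
  assumes "finite J" "\<And>j. j \<in> J \<Longrightarrow> norm (x j) \<le> l j"
  defines "m \<equiv> \<Sum>j\<in>J. x j" and "L \<equiv> \<Sum>j\<in>J. l j"
  shows "(\<Sum>j\<in>J. (norm (x j - (l j / L) *\<^sub>R m))\<^sup>2 / l j) = (\<Sum>j\<in>J. (norm (x j))\<^sup>2 / l j) - (norm m)\<^sup>2 / L"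
proof (cases "L = 0")
  case True
  have "l j \<ge> 0" if "j \<in> J" for j using assms(2)[OF that] norm_ge_zero order_trans by blast
  then have "l j = 0" if "j \<in> J" for j
    using True sum_nonneg_eq_0_iff[OF assms(1), of l] that by (auto simp: L_def)
  then show ?thesis using True by simp
next
  case False
  have sR: "(\<Sum>j\<in>J. Re (cinner (x j) m)) = Re (cinner (\<Sum>j\<in>J. x j) m)"
    using assms(1)
  proof (induction J rule: finite_induct)
    case empty
    show ?case using cinner_scaleC_left[of 0 0 m] by simp
  qed (simp add: cinner_add_left)
  have "(\<Sum>j\<in>J. (norm (x j - (l j / L) *\<^sub>R m))\<^sup>2 / l j) =
    (\<Sum>j\<in>J. (norm (x j))\<^sup>2 / l j - 2 / L * Re (cinner (x j) m) + l j / L\<^sup>2 * (norm m)\<^sup>2)"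
  proof (rule sum.cong)
    fix j assume j: "j \<in> J"
    show "(norm (x j - (l j / L) *\<^sub>R m))\<^sup>2 / l j =
      (norm (x j))\<^sup>2 / l j - 2 / L * Re (cinner (x j) m) + l j / L\<^sup>2 * (norm m)\<^sup>2"
    proof (cases "l j = 0")
      case True
      then have "x j = 0" using assms(2)[OF j] by simp
      then show ?thesis using True cinner_scaleC_left[of 0 0 m] by simp
    next
      case l: False
      show ?thesis unfolding norm_diff_square using l False
        by (simp add: field_simps power2_eq_square)
    qed
  qed simp
  also have "\<dots> = (\<Sum>j\<in>J. (norm (x j))\<^sup>2 / l j) - 2 / L * Re (cinner m m) + L / L\<^sup>2 * (norm m)\<^sup>2"
    unfolding sum.distrib sum_subtractf sum_distrib_left[symmetric] sum_distrib_right[symmetric]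
      sum_divide_distrib[symmetric] L_def[symmetric] sR m_def[symmetric] by simp
  also have "\<dots> = (\<Sum>j\<in>J. (norm (x j))\<^sup>2 / l j) - (norm m)\<^sup>2 / L"
    using False by (simp add: cinner_same field_simps power2_eq_square)
  finally show ?thesis .
qed

text \<open>The squared L2 norm, with respect to the variation, of the conditional expectation of
  the density of \<open>\<mu>\<close> on the partition. Null cells contribute zero by the convention
  for division.\<close>

definition energy :: "('a::topological_space, 'h::real_normed_vector) vmeasure \<Rightarrow> ('a \<Rightarrow> 'i) \<Rightarrow> real"
  where "energy \<mu> p = (\<Sum>i\<in>range p. (norm (vmeas \<mu> (p -` {i})))\<^sup>2 / measure (variation \<mu>) (p -` {i}))"

text \<open>With respect to the variation the averaged density has norm at most one, so its square
  is dominated by its norm. This makes the supremum of all energies finite.\<close>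

lemma energy_le:
  assumes "borel_partition p"
  shows "energy \<mu> p \<le> norm \<mu>"
proof -
  have "energy \<mu> p \<le> (\<Sum>i\<in>range p. norm (vmeas \<mu> (p -` {i})))"
    unfolding energy_def
  proof (rule sum_mono)
    fix i
    have le: "norm (vmeas \<mu> (p -` {i})) \<le> measure (variation \<mu>) (p -` {i})"
      using assms by (intro norm_vmeas_le_variation) (auto simp: borel_partition_def)
    show "(norm (vmeas \<mu> (p -` {i})))\<^sup>2 / measure (variation \<mu>) (p -` {i}) \<le> norm (vmeas \<mu> (p -` {i}))"
    proof (cases "measure (variation \<mu>) (p -` {i}) = 0")
      case False
      then have "measure (variation \<mu>) (p -` {i}) > 0" by (simp add: zero_less_measure_iff)
      then show ?thesis using le
        by (simp add: divide_le_eq power2_eq_square mult_left_mono)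
    qed simp
  qed
  also have "\<dots> \<le> norm \<mu>"
    using assms by (intro sum_norm_vmeas_le) (auto simp: borel_partition_def disjoint_family_on_def)
  finally show ?thesis .
qed

text \<open>A Radon--Nikodym property of Hilbert spaces: the density is approximated by averages over
  a partition of almost maximal energy.\<close>

lemma step_approx:
  fixes \<mu> :: "('a::topological_space, 'h::complex_hilbert_space) vmeasure"
  assumes "e > 0"
  obtains p :: "'a \<Rightarrow> nat" and c where "borel_partition p" "norm (\<mu> - step_vmeasure (variation \<mu>) p c) \<le> e"
proof -
  \<comment> \<open>Sized for the final estimate, which is \<open>d/2 + d * norm \<mu> / 2\<close>
    and hence at most \<open>d * (norm \<mu> + 1)\<close>.\<close>
  define d where "d = e / (norm \<mu> + 1)"
  have d: "d > 0" "d * (norm \<mu> + 1) = e"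
    using assms by (auto simp: d_def add_nonneg_pos less_imp_neq[symmetric])
  let ?l = "variation \<mu>"
  note M = finite_measure_variation[of \<mu>] sets_variation[of \<mu>]
  interpret finite_measure ?l by (rule M)
  define S where "S = Sup (energy \<mu> ` {p :: 'a \<Rightarrow> nat. borel_partition p})"
  have bdd: "bdd_above (energy \<mu> ` {p :: 'a \<Rightarrow> nat. borel_partition p})"
    using energy_le by (auto intro!: bdd_aboveI[of _ "norm \<mu>"])
  have ne: "borel_partition (\<lambda>_::'a. 0::nat)" by (auto simp: borel_partition_def vimage_def)
  have "\<exists>x\<in>energy \<mu> ` {p :: 'a \<Rightarrow> nat. borel_partition p}. S - d\<^sup>2 < x"
    unfolding S_def using d ne by (intro less_cSupD) auto
  then obtain p :: "'a \<Rightarrow> nat" where p: "borel_partition p" "energy \<mu> p > S - d\<^sup>2" by blast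
  \<comment> \<open>The mean of the density of \<open>\<mu>\<close> over each cell, that is, its
    conditional expectation.\<close>
  define c where "c i = (1 / measure ?l (p -` {i})) *\<^sub>R vmeas \<mu> (p -` {i})" for i
  define \<nu> where "\<nu> = step_vmeasure ?l p c"
  have "norm (\<mu> - \<nu>) \<le> e"
  proof (rule norm_vmeasure_leI)
    fix n :: nat and C :: "nat \<Rightarrow> 'a set"
    assume C: "\<And>k. k < n \<Longrightarrow> C k \<in> sets borel" "disjoint_family_on C {..<n}"
    \<comment> \<open>Turns the test family into a partition: label \<open>Suc k\<close> on
      \<open>C k\<close>, label \<open>0\<close> on what is left over.\<close>
    define q where "q x = (if \<exists>k<n. x \<in> C k then Suc (THE k. k < n \<and> x \<in> C k) else 0)" for x
    have qC: "q x = Suc k" if "k < n" "x \<in> C k" for x k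
    proof -
      have "(THE k. k < n \<and> x \<in> C k) = k"
        using that C(2) by (intro the_equality) (auto simp: disjoint_family_on_def)
      then show ?thesis using that by (auto simp: q_def)
    qed
    have q0: "q x = 0 \<longleftrightarrow> (\<forall>k<n. x \<notin> C k)" for x by (auto simp: q_def)
    have fS: "q -` {Suc k} = C k" if "k < n" for k
    proof (intro set_eqI iffI)
      fix x assume "x \<in> q -` {Suc k}"
      then have "q x = Suc k" by simp
      moreover then obtain j where "j < n" "x \<in> C j" using q0[of x] by auto
      ultimately show "x \<in> C k" using qC[of j x] by simp
    qed (use qC that in auto)
    have range_q: "q x \<le> n" for x
      using qC[of _ x] q0[of x] by (cases "\<exists>k<n. x \<in> C k") auto
    have "q -` {i} \<in> sets borel" for i
    proof (cases i)
      case 0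
      have "q -` {0} = UNIV - (\<Union>k<n. C k)" using q0 by auto
      moreover have "(\<Union>k<n. C k) \<in> sets borel" using C(1) by (intro sets.finite_UN) auto
      ultimately show ?thesis using 0 by auto
    next
      case (Suc k)
      show ?thesis
      proof (cases "k < n")
        case False
        then have "q x \<noteq> i" for x using range_q[of x] Suc by auto
        then have "q -` {i} = {}" by auto
        then show ?thesis by simp
      qed (use Suc fS C in auto)
    qed
    moreover have "finite (range q)" by (rule finite_subset[of _ "{..n}"]) (use range_q in auto)
    ultimately have q: "borel_partition q" by (simp add: borel_partition_def)
    define r where "r x = (p x, q x)" for x
    have r: "borel_partition r" unfolding r_def by (rule borel_partition_pair[OF p(1) q])
    have rfin: "finite (range r)" and rb: "r -` {j} \<in> sets borel" for j
      using r unfolding borel_partition_def by blast+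
    have pr: "p = (\<lambda>x. fst (r x))" and qr: "q = (\<lambda>x. snd (r x))" by (auto simp: r_def)
    define x where "x j = vmeas \<mu> (r -` {j})" for j
    define l where "l j = measure ?l (r -` {j})" for j
    have xl: "norm (x j) \<le> l j" for j unfolding x_def l_def by (rule norm_vmeas_le_variation[OF rb])
    let ?J = "\<lambda>i. {j \<in> range r. fst j = i}"
    have mp: "vmeas \<mu> (p -` {i}) = (\<Sum>j\<in>?J i. x j)" for i
      using vmeas_fibre_sum[OF rfin rb, of \<mu> fst i] by (simp add: pr[symmetric] x_def)
    have lp: "measure ?l (p -` {i}) = (\<Sum>j\<in>?J i. l j)" for i
      using measure_fibre_sum[OF M r, of UNIV fst i] by (simp add: pr[symmetric] l_def)
    have \<nu>r: "vmeas \<nu> (r -` {j}) = l j *\<^sub>R c (fst j)" if "j \<in> range r" for j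
    proof -
      have "vmeas \<nu> (r -` {j}) = (\<Sum>j'\<in>range r. measure ?l (r -` {j'} \<inter> r -` {j}) *\<^sub>R c (fst j'))"
        unfolding \<nu>_def pr by (rule vmeas_step_refine[OF M r rb]) (use p(1) in \<open>simp add: pr[symmetric]\<close>)
      also have "\<dots> = (\<Sum>j'\<in>range r. if j' = j then l j *\<^sub>R c (fst j) else 0)"
      proof (rule sum.cong)
        fix j'
        have "r -` {j'} \<inter> r -` {j} = (if j' = j then r -` {j} else {})" by auto
        then show "measure ?l (r -` {j'} \<inter> r -` {j}) *\<^sub>R c (fst j') = (if j' = j then l j *\<^sub>R c (fst j) else 0)"
          by (simp add: l_def)
      qed simp
      finally show ?thesis using that rfin by simp
    qed
    define y where "y j = x j - l j *\<^sub>R c (fst j)" for j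
    \<comment> \<open>Pythagoras on each cell of \<open>p\<close>, split by the finer partition
      \<open>r\<close>. The total is the gain of energy, which is at most \<open>d\<^sup>2\<close>
      because \<open>p\<close> is nearly maximal.\<close>
    have ysq: "(\<Sum>j\<in>range r. (norm (y j))\<^sup>2 / l j) = energy \<mu> r - energy \<mu> p"
    proof -
      have "(\<Sum>j\<in>range r. (norm (y j))\<^sup>2 / l j) = (\<Sum>i\<in>fst ` range r. \<Sum>j\<in>?J i. (norm (y j))\<^sup>2 / l j)"
        using rfin by (rule sum.image_gen)
      also have "\<dots> = (\<Sum>i\<in>fst ` range r. (\<Sum>j\<in>?J i. (norm (x j))\<^sup>2 / l j) - (norm (vmeas \<mu> (p -` {i})))\<^sup>2 / measure ?l (p -` {i}))"
      proof (rule sum.cong)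
        fix i
        have "(\<Sum>j\<in>?J i. (norm (y j))\<^sup>2 / l j) =
          (\<Sum>j\<in>?J i. (norm (x j - (l j / (\<Sum>j\<in>?J i. l j)) *\<^sub>R (\<Sum>j\<in>?J i. x j)))\<^sup>2 / l j)"
          by (intro sum.cong) (auto simp: y_def c_def mp lp)
        also have "\<dots> = (\<Sum>j\<in>?J i. (norm (x j))\<^sup>2 / l j) - (norm (\<Sum>j\<in>?J i. x j))\<^sup>2 / (\<Sum>j\<in>?J i. l j)"
          using rfin xl by (intro energy_identity) auto
        finally show "(\<Sum>j\<in>?J i. (norm (y j))\<^sup>2 / l j) = (\<Sum>j\<in>?J i. (norm (x j))\<^sup>2 / l j) -
          (norm (vmeas \<mu> (p -` {i})))\<^sup>2 / measure ?l (p -` {i})" by (simp only: mp lp)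
      qed simp
      also have "\<dots> = (\<Sum>j\<in>range r. (norm (x j))\<^sup>2 / l j) - energy \<mu> p"
      proof -
        have "fst ` range r = range p" by (auto simp: pr image_image)
        then show ?thesis
          unfolding sum_subtractf energy_def using sum.image_gen[OF rfin, of "\<lambda>j. (norm (x j))\<^sup>2 / l j" fst] by simp
      qed
      finally show ?thesis by (simp add: energy_def x_def l_def)
    qed
    have er: "energy \<mu> r \<le> S"
    proof -
      \<comment> \<open>\<open>S\<close> ranges over partitions labelled by natural numbers, so the
        pairs are encoded.\<close>
      let ?f = "\<lambda>x. prod_encode (r x)"
      have f: "?f -` {i} = r -` {prod_decode i}" for i
        by (auto simp: vimage_def)
      have "range ?f = prod_encode ` range r" by auto
      then have "energy \<mu> ?f = energy \<mu> r"
        unfolding energy_def by (simp add: f sum.reindex[OF inj_prod_encode])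
      moreover have "borel_partition ?f"
        using rfin rb by (auto simp: borel_partition_def f \<open>range ?f = prod_encode ` range r\<close>)
      then have "energy \<mu> ?f \<le> S" unfolding S_def by (intro cSup_upper bdd) blast
      ultimately show ?thesis by simp
    qed
    \<comment> \<open>A weighted arithmetic-geometric mean inequality takes the place of
      Cauchy-Schwarz in passing from squares divided by \<open>l j\<close> to first powers.\<close>
    have amgm: "norm (y j) \<le> (norm (y j))\<^sup>2 / l j / (2 * d) + d * l j / 2" for j
    proof (cases "l j = 0")
      case True
      then have "x j = 0" using xl[of j] by simp
      then show ?thesis using True by (simp add: y_def)
    next
      case False
      have l0: "l j > 0" using False by (simp add: l_def zero_less_measure_iff)
      have "0 \<le> (norm (y j) - d * l j)\<^sup>2 / (2 * d * l j)" using l0 d by simp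
      also have "\<dots> = (norm (y j))\<^sup>2 / l j / (2 * d) + d * l j / 2 - norm (y j)"
        using l0 d by (simp add: field_simps power2_eq_square)
      finally show ?thesis by simp
    qed
    have "(\<Sum>k<n. norm (vmeas (\<mu> - \<nu>) (C k))) \<le> (\<Sum>k<n. \<Sum>j | j \<in> range r \<and> snd j = Suc k. norm (y j))"
    proof (rule sum_mono)
      fix k assume k: "k \<in> {..<n}"
      have "C k = (\<lambda>x. snd (r x)) -` {Suc k}" using fS k by (simp add: qr[symmetric])
      then have "vmeas (\<mu> - \<nu>) (C k) = (\<Sum>j | j \<in> range r \<and> snd j = Suc k. vmeas (\<mu> - \<nu>) (r -` {j}))"
        using vmeas_fibre_sum[OF rfin rb, of "\<mu> - \<nu>" snd "Suc k"] by simp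
      also have "\<dots> = (\<Sum>j | j \<in> range r \<and> snd j = Suc k. y j)"
        by (intro sum.cong) (auto simp: vmeas_diff \<nu>r y_def x_def)
      finally show "norm (vmeas (\<mu> - \<nu>) (C k)) \<le> (\<Sum>j | j \<in> range r \<and> snd j = Suc k. norm (y j))"
        by (simp add: norm_sum)
    qed
    also have "\<dots> = sum (\<lambda>j. norm (y j)) (\<Union>k<n. {j \<in> range r. snd j = Suc k})"
      using rfin by (intro sum.UNION_disjoint[symmetric]) auto
    also have "\<dots> \<le> (\<Sum>j\<in>range r. norm (y j))"
      using rfin by (intro sum_mono2) auto
    also have "\<dots> \<le> (\<Sum>j\<in>range r. (norm (y j))\<^sup>2 / l j / (2 * d) + d * l j / 2)"
      by (intro sum_mono amgm)
    also have "\<dots> = (energy \<mu> r - energy \<mu> p) / (2 * d) + d * (\<Sum>j\<in>range r. l j) / 2"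
      unfolding sum.distrib sum_divide_distrib[symmetric] sum_distrib_left[symmetric] ysq ..
    also have "\<dots> \<le> d\<^sup>2 / (2 * d) + d * norm \<mu> / 2"
    proof -
      have "(\<Sum>j\<in>range r. l j) = measure ?l UNIV"
        using measure_fibre_sum[OF M r, of UNIV "\<lambda>_. ()" "()"] by (simp add: l_def vimage_def)
      also have "\<dots> = norm \<mu>" by (simp add: measure_variation restrict_UNIV)
      finally show ?thesis using er p(2) d by (intro add_mono divide_right_mono) auto
    qed
    also have "\<dots> \<le> d * (norm \<mu> + 1)"
    proof -
      have "0 \<le> d * norm \<mu>" using d(1) by simp
      moreover have "d\<^sup>2 / (2 * d) = d / 2" using d(1) by (simp add: power2_eq_square)
      ultimately show ?thesis using d(1) unfolding distrib_left mult_1_right by linarith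
    qed
    finally show "(\<Sum>k<n. norm (vmeas (\<mu> - \<nu>) (C k))) \<le> e" using d by simp
  qed
  with p(1) show ?thesis using that unfolding \<nu>_def by blast
qed

section \<open>The measure on the product\<close>

lemma vmeasure_eq_rect:
  fixes \<mu> \<nu> :: "('a::second_countable_topology \<times> 'b::second_countable_topology, 'h::real_normed_vector) vmeasure"
  assumes "\<And>A B. A \<in> sets borel \<Longrightarrow> B \<in> sets borel \<Longrightarrow> vmeas \<mu> (A \<times> B) = vmeas \<nu> (A \<times> B)"
  shows "\<mu> = \<nu>"
proof (rule vmeasure_eqI)
  let ?G = "{a \<times> b | a b. a \<in> sets (borel :: 'a measure) \<and> b \<in> sets (borel :: 'b measure)}"
  have sb: "sets (borel :: ('a \<times> 'b) measure) = sigma_sets UNIV ?G"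
    unfolding borel_prod[symmetric] sets_pair_measure by simp
  fix A :: "('a \<times> 'b) set" assume "A \<in> sets borel"
  then have A: "A \<in> sigma_sets UNIV ?G" by (simp add: sb)
  show "vmeas \<mu> A = vmeas \<nu> A"
  proof (rule sigma_sets_induct_disjoint[OF Int_stable_pair_measure_generator[of borel borel] _ A])
    show "?G \<subseteq> Pow UNIV" by simp
    show "vmeas \<mu> E = vmeas \<nu> E" if "E \<in> ?G" for E using that assms by auto
    show "vmeas \<mu> {} = vmeas \<nu> {}" by simp
    fix E assume E: "E \<in> sigma_sets UNIV ?G" "vmeas \<mu> E = vmeas \<nu> E"
    have "vmeas \<rho> (UNIV - E) = vmeas \<rho> (UNIV \<times> UNIV) - vmeas \<rho> E" for \<rho> :: "('a \<times> 'b, 'h) vmeasure"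
      using vmeas_Un[of E "UNIV - E" \<rho>] E(1) by (simp add: sb[symmetric] Un_absorb1)
    then show "vmeas \<mu> (UNIV - E) = vmeas \<nu> (UNIV - E)" using E(2) assms[of UNIV UNIV] by simp
  next
    fix E :: "nat \<Rightarrow> ('a \<times> 'b) set"
    assume E: "disjoint_family E" "range E \<subseteq> sigma_sets UNIV ?G" "\<And>i. vmeas \<mu> (E i) = vmeas \<nu> (E i)"
    then have "range E \<subseteq> sets borel" by (simp add: sb)
    from vmeas_sums[OF this E(1), of \<mu>] vmeas_sums[OF this E(1), of \<nu>] E(3)
    show "vmeas \<mu> (\<Union>i. E i) = vmeas \<nu> (\<Union>i. E i)" by (simp add: sums_unique2)
  qed
qed

text \<open>The witness integrates the scalar measure of the sections of a set, cut down to
  \<open>B\<close>, against \<open>\<sigma>\<close>. Replacing \<open>\<sigma>\<close> by its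
  variation bounds the mass, and dominated convergence gives continuity at the empty set.\<close>

lemma product_vmeasure_exists:
  fixes \<sigma> :: "('a::second_countable_topology, 'h::{complex_normed_vector, banach}) vmeasure"
    and M :: "'b::second_countable_topology measure"
  assumes M: "finite_measure M" "sets M = sets borel" and B: "B \<in> sets borel"
  obtains \<nu> where "\<And>A C. A \<in> sets borel \<Longrightarrow> C \<in> sets borel \<Longrightarrow> vmeas \<nu> (A \<times> C) = measure M (B \<inter> C) *\<^sub>R vmeas \<sigma> A"
    "norm \<nu> \<le> norm \<sigma> * measure M B"
proof -
  interpret M: finite_measure M by fact
  interpret V: finite_measure "variation \<sigma>" by (rule finite_measure_variation)
  define f where "f E t = measure M (Pair t -` (E \<inter> UNIV \<times> B))" for E :: "('a \<times> 'b) set" and t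
  have UB: "(UNIV :: 'a set) \<times> B \<in> sets borel" 
    unfolding borel_prod[symmetric] using B by (intro pair_measureI) auto
  have sbM: "sets ((borel :: 'a measure) \<Otimes>\<^sub>M M) = sets borel"
    unfolding borel_prod[symmetric] by (rule sets_pair_measure_cong[OF refl M(2)])
  have sec: "Pair t -` (E \<inter> UNIV \<times> B) \<in> sets M" if "E \<in> sets borel" for E :: "('a \<times> 'b) set" and t
  proof (rule sets_Pair1)
    show "E \<inter> UNIV \<times> B \<in> sets ((borel :: 'a measure) \<Otimes>\<^sub>M M)"
      using that UB unfolding sbM by (rule sets.Int)
  qed
  have fm: "f E \<in> borel_measurable borel" if "E \<in> sets borel" for E
  proof -
    have "E \<inter> UNIV \<times> B \<in> sets ((borel :: 'a measure) \<Otimes>\<^sub>M M)"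
      using that UB unfolding sbM by (rule sets.Int)
    from M.measurable_emeasure_Pair[OF this] show ?thesis unfolding f_def measure_def by simp
  qed
  have f0: "0 \<le> f E t" "f E t \<le> measure M B" if "E \<in> sets borel" for E t
    using B M unfolding f_def by (auto intro!: M.finite_measure_mono)
  have fb: "(\<lambda>t. complex_of_real (f E t)) \<in> bdd_borel" if "E \<in> sets borel" for E
    using f0[OF that] fm[OF that] by (intro bdd_borelI[of _ "measure M B"]) auto
  have fadd: "f (E \<union> F) t = f E t + f F t" if "E \<in> sets borel" "F \<in> sets borel" "E \<inter> F = {}" for E F t
  proof -
    have "Pair t -` ((E \<union> F) \<inter> UNIV \<times> B) = Pair t -` (E \<inter> UNIV \<times> B) \<union> Pair t -` (F \<inter> UNIV \<times> B)" by auto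
    then show ?thesis using that sec unfolding f_def by (subst M.finite_measure_Union[symmetric]) auto
  qed
  have fint: "integrable (variation \<sigma>) (f E)" if "E \<in> sets borel" for E
    using f0[OF that] fm[OF that] by (intro V.integrable_const_bound[of _ "measure M B"]) auto
  have ivar: "norm (vintegral \<sigma> (\<lambda>t. complex_of_real (f E t))) \<le> (\<integral>t. f E t \<partial>variation \<sigma>)" if "E \<in> sets borel" for E
    using norm_vintegral_le_variation[OF fb[OF that], of \<sigma>] f0[OF that] by simp
  define n where "n E = (if E \<in> sets borel then vintegral \<sigma> (\<lambda>t. complex_of_real (f E t)) else 0)" for E
  have mass: "(\<Sum>k<m. norm (n (A k))) \<le> norm \<sigma> * measure M B"
    if A: "\<And>k. k < m \<Longrightarrow> A k \<in> sets borel" "disjoint_family_on A {..<m::nat}" for m A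
  proof -
    have "(\<Sum>k<m. norm (n (A k))) \<le> (\<Sum>k<m. \<integral>t. f (A k) t \<partial>variation \<sigma>)"
      using A by (intro sum_mono) (auto simp: n_def intro: ivar)
    also have "\<dots> = (\<integral>t. (\<Sum>k<m. f (A k) t) \<partial>variation \<sigma>)"
      using A by (intro Bochner_Integration.integral_sum[symmetric] fint) auto
    also have "\<dots> \<le> (\<integral>t. measure M B \<partial>variation \<sigma>)"
    proof (rule integral_mono)
      show "integrable (variation \<sigma>) (\<lambda>t. \<Sum>k<m. f (A k) t)" using A fint by (intro Bochner_Integration.integrable_sum) auto
      fix t
      have "(\<Sum>k<m. f (A k) t) = measure M (\<Union>k<m. Pair t -` (A k \<inter> UNIV \<times> B))"
        unfolding f_def using A sec
        by (intro M.finite_measure_finite_Union[symmetric]) (auto simp: disjoint_family_on_def)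
      also have "\<dots> \<le> measure M B" using B M by (intro M.finite_measure_mono) auto
      finally show "(\<Sum>k<m. f (A k) t) \<le> measure M B" .
    qed simp
    also have "\<dots> = norm \<sigma> * measure M B" by (simp add: measure_variation restrict_UNIV)
    finally show ?thesis .
  qed
  have "is_vmeasure n"
  proof (rule is_vmeasureI[OF _ _ _ mass])
    fix A B :: "('a \<times> 'b) set" assume "A \<in> sets borel" "B \<in> sets borel" "A \<inter> B = {}"
    then show "n (A \<union> B) = n A + n B" by (simp add: n_def fadd vintegral_add fb)
  next
    fix A :: "nat \<Rightarrow> ('a \<times> 'b) set" assume A: "range A \<subseteq> sets borel" "decseq A" "(\<Inter>n. A n) = {}"
    have Ab: "A i \<in> sets borel" for i using A by auto
    have "(\<lambda>i. \<integral>t. f (A i) t \<partial>variation \<sigma>) \<longlonglongrightarrow> (\<integral>t. 0 \<partial>variation \<sigma>)"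
    proof (rule integral_dominated_convergence[where w = "\<lambda>_. measure M B"])
      show "AE t in variation \<sigma>. (\<lambda>i. f (A i) t) \<longlonglongrightarrow> 0"
      proof (rule AE_I2)
        fix t
        have "(\<lambda>i. measure M (Pair t -` (A i \<inter> UNIV \<times> B))) \<longlonglongrightarrow> measure M (\<Inter>i. Pair t -` (A i \<inter> UNIV \<times> B))"
          using A(2) sec[OF Ab] by (intro M.finite_Lim_measure_decseq) (auto simp: decseq_def)
        moreover have "(\<Inter>i. Pair t -` (A i \<inter> UNIV \<times> B)) = {}" using A(3) by auto
        ultimately show "(\<lambda>i. f (A i) t) \<longlonglongrightarrow> 0" by (simp add: f_def)
      qed
    qed (use fm[OF Ab] f0[OF Ab] in auto)
    then have "(\<lambda>i. \<integral>t. f (A i) t \<partial>variation \<sigma>) \<longlonglongrightarrow> 0" by simp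
    then show "(\<lambda>i. n (A i)) \<longlonglongrightarrow> 0"
      by (rule Lim_null_comparison[rotated]) (auto simp: n_def Ab ivar)
  qed (auto simp: n_def)
  then have v: "vmeas (Abs_vmeasure n) = n" by (simp add: Abs_vmeasure_inverse)
  show ?thesis
  proof (rule that[of "Abs_vmeasure n"])
    fix A :: "'a set" and C :: "'b set" assume AC: "A \<in> sets borel" "C \<in> sets borel"
    have AC': "A \<times> C \<in> sets borel" 
      unfolding borel_prod[symmetric] by (rule pair_measureI[OF AC])
    have "Pair t -` (A \<times> C \<inter> UNIV \<times> B) = (if t \<in> A then B \<inter> C else {})" for t by auto
    then have "(\<lambda>t. complex_of_real (f (A \<times> C) t)) = (\<lambda>t. complex_of_real (measure M (B \<inter> C)) * indicator A t)"
      by (auto simp: f_def indicator_def fun_eq_iff)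
    then show "vmeas (Abs_vmeasure n) (A \<times> C) = measure M (B \<inter> C) *\<^sub>R vmeas \<sigma> A"
      using AC' vintegral_indicator[OF AC(1), of \<sigma>] by (simp add: v n_def scaleR_scaleC)
  next
    show "norm (Abs_vmeasure n) \<le> norm \<sigma> * measure M B"
      by (rule norm_vmeasure_leI) (simp add: v mass)
  qed
qed

text \<open>The characteristic property as a relation, since the definite description in
  \<open>tilde_vmeasure\<close> means something only after existence and uniqueness are
  known.\<close>

definition tilde_rel ::
  "('h::complex_hilbert_space \<Rightarrow> ('a::second_countable_topology, 'h) vmeasure) \<Rightarrow>
    ('b::second_countable_topology, 'h) vmeasure \<Rightarrow> ('a \<times> 'b, 'h) vmeasure \<Rightarrow> bool"
  where "tilde_rel k \<mu> \<nu> \<longleftrightarrow>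
    (\<forall>A\<in>sets borel. \<forall>B\<in>sets borel. vmeas \<nu> (A \<times> B) = vmeas (k (vmeas \<mu> B)) A)"

lemma tilde_rel_unique: "tilde_rel k \<mu> \<nu> \<Longrightarrow> tilde_rel k \<mu> \<nu>' \<Longrightarrow> \<nu> = \<nu>'"
  by (rule vmeasure_eq_rect) (simp add: tilde_rel_def)

lemma tilde_rel_diff:
  assumes "bounded_linear k" "tilde_rel k \<mu> \<nu>" "tilde_rel k \<mu>' \<nu>'"
  shows "tilde_rel k (\<mu> - \<mu>') (\<nu> - \<nu>')"
  using assms(2,3) linear_diff[OF bounded_linear.linear[OF assms(1)]]
  by (simp add: tilde_rel_def vmeas_diff)

text \<open>On the cell with label \<open>i\<close> the measure is \<open>c i\<close> times
  \<open>M\<close>, so linearity of \<open>k\<close> forces the product of \<open>k (c i)\<close>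
  with \<open>M\<close> on that cell. The constant is \<open>onorm k\<close> itself because the
  cells are disjoint and the norms of the values on them add up to at most the norm of the
  measure.\<close>

lemma tilde_step_exists:
  fixes k :: "'h::complex_hilbert_space \<Rightarrow> ('a::second_countable_topology, 'h) vmeasure"
    and M :: "'b::second_countable_topology measure"
  assumes k: "bounded_linear k" and M: "finite_measure M" "sets M = sets borel" and p: "borel_partition p"
  obtains \<nu> where "tilde_rel k (step_vmeasure M p c) \<nu>" "norm \<nu> \<le> onorm k * norm (step_vmeasure M p c)"
proof -
  have pb: "p -` {i} \<in> sets borel" for i using p by (auto simp: borel_partition_def)
  have fin: "finite (range p)" using p by (auto simp: borel_partition_def)
  have "\<forall>i. \<exists>\<nu>. (\<forall>A\<in>sets borel. \<forall>C\<in>sets borel. vmeas \<nu> (A \<times> C) = measure M (p -` {i} \<inter> C) *\<^sub>R vmeas (k (c i)) A) \<and>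
    norm \<nu> \<le> norm (k (c i)) * measure M (p -` {i})"
    using product_vmeasure_exists[OF M pb] by metis
  then obtain N where N: "\<And>i A C. A \<in> sets borel \<Longrightarrow> C \<in> sets borel \<Longrightarrow>
      vmeas (N i) (A \<times> C) = measure M (p -` {i} \<inter> C) *\<^sub>R vmeas (k (c i)) A"
    "\<And>i. norm (N i) \<le> norm (k (c i)) * measure M (p -` {i})" by metis
  let ?\<nu> = "\<Sum>i\<in>range p. N i" and ?s = "step_vmeasure M p c"
  have lin: "linear k" using k by (rule bounded_linear.linear)
  have "tilde_rel k ?s ?\<nu>"
    by (auto simp: tilde_rel_def vmeas_sum N vmeas_step[OF M p] linear_sum[OF lin] linear_scale[OF lin] vmeas_simps)
  moreover have "norm ?\<nu> \<le> onorm k * norm ?s"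
  proof -
    have "norm ?\<nu> \<le> (\<Sum>i\<in>range p. onorm k * norm (vmeas ?s (p -` {i})))"
    proof (rule sum_norm_le)
      fix i assume i: "i \<in> range p"
      have "vmeas ?s (p -` {i}) = (\<Sum>j\<in>range p. if j = i then measure M (p -` {i}) *\<^sub>R c i else 0)"
        unfolding vmeas_step[OF M p pb]
      proof (rule sum.cong)
        fix j
        have "p -` {j} \<inter> p -` {i} = (if j = i then p -` {i} else {})" by auto
        then show "measure M (p -` {j} \<inter> p -` {i}) *\<^sub>R c j = (if j = i then measure M (p -` {i}) *\<^sub>R c i else 0)"
          by simp
      qed simp
      then have "norm (vmeas ?s (p -` {i})) = measure M (p -` {i}) * norm (c i)" using i fin by simp
      moreover have "norm (k (c i)) * measure M (p -` {i}) \<le> (onorm k * norm (c i)) * measure M (p -` {i})"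
        by (intro mult_right_mono onorm[OF k]) simp
      ultimately show "norm (N i) \<le> onorm k * norm (vmeas ?s (p -` {i}))" using N(2)[of i] by (simp add: mult_ac)
    qed
    also have "\<dots> \<le> onorm k * norm ?s"
      unfolding sum_distrib_left[symmetric] using pb fin
      by (intro mult_left_mono sum_norm_vmeas_le onorm_pos_le[OF k]) (auto simp: disjoint_family_on_def)
    finally show ?thesis .
  qed
  ultimately show ?thesis using that by blast
qed

text \<open>Step measures converge to \<open>\<mu>\<close>, and the bound by \<open>onorm k\<close>,
  applied to differences, makes the corresponding measures on the product a Cauchy sequence. Both
  the defining relation and the bound pass to the limit.\<close>

lemma tilde_exists:
  fixes k :: "'h::complex_hilbert_space \<Rightarrow> ('a::second_countable_topology, 'h) vmeasure"
    and \<mu> :: "('b::second_countable_topology, 'h) vmeasure"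
  assumes k: "bounded_linear k"
  obtains \<nu> where "tilde_rel k \<mu> \<nu>" "norm \<nu> \<le> onorm k * norm \<mu>"
proof -
  note M = finite_measure_variation[of \<mu>] sets_variation[of \<mu>]
  have "\<forall>n. \<exists>p :: 'b \<Rightarrow> nat. \<exists>c. borel_partition p \<and> norm (\<mu> - step_vmeasure (variation \<mu>) p c) \<le> inverse (real (Suc n))"
    using step_approx[of "inverse (real (Suc _))" \<mu>] by (metis inverse_positive_iff_positive of_nat_0_less_iff zero_less_Suc)
  then obtain p :: "nat \<Rightarrow> 'b \<Rightarrow> nat" and c where p: "\<And>n. borel_partition (p n)"
    "\<And>n. norm (\<mu> - step_vmeasure (variation \<mu>) (p n) (c n)) \<le> inverse (real (Suc n))" by metis
  define s where "s n = step_vmeasure (variation \<mu>) (p n) (c n)" for n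
  have slim: "s \<longlonglongrightarrow> \<mu>"
  proof -
    have "norm (s n - \<mu>) \<le> inverse (real (Suc n))" for n
      using p(2)[of n] unfolding s_def by (subst norm_minus_commute)
    then have "\<forall>\<^sub>F n in sequentially. norm (s n - \<mu>) \<le> inverse (real (Suc n))" by (rule always_eventually[OF allI])
    from Lim_null_comparison[OF this LIMSEQ_inverse_real_of_nat] show ?thesis by (rule LIM_zero_cancel)
  qed
  have "\<exists>\<nu>. tilde_rel k (s n) \<nu> \<and> norm \<nu> \<le> onorm k * norm (s n)" for n
    unfolding s_def by (rule tilde_step_exists[OF k M p(1)]) blast
  then obtain N where N: "\<And>n. tilde_rel k (s n) (N n)" "\<And>n. norm (N n) \<le> onorm k * norm (s n)" by metis
  have diff: "norm (N m - N n) \<le> onorm k * norm (s m - s n)" for m n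
  proof -
    obtain \<nu> where \<nu>: "tilde_rel k (s m - s n) \<nu>" "norm \<nu> \<le> onorm k * norm (s m - s n)"
      unfolding s_def step_diff[OF M p(1) p(1)]
      by (rule tilde_step_exists[OF k M borel_partition_pair[OF p(1) p(1)]])
    from tilde_rel_unique[OF tilde_rel_diff[OF k N(1) N(1)] \<nu>(1)] \<nu>(2) show ?thesis by simp
  qed
  have "Cauchy N"
  proof (rule metric_CauchyI)
    fix e :: real assume e: "e > 0"
    define d where "d = e / (onorm k + 1)"
    have k0: "onorm k \<ge> 0" by (rule onorm_pos_le[OF k])
    have d: "d > 0" "onorm k * d < e"
      using e k0 by (auto simp: d_def field_simps add_nonneg_pos)
    obtain n0 where "\<And>m n. m \<ge> n0 \<Longrightarrow> n \<ge> n0 \<Longrightarrow> dist (s m) (s n) < d"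
      using metric_CauchyD[OF LIMSEQ_imp_Cauchy[OF slim] d(1)] by blast
    then have close: "norm (s m - s n) \<le> d" if "m \<ge> n0" "n \<ge> n0" for m n
      using that by (simp add: dist_norm less_imp_le)
    have "dist (N m) (N n) < e" if "m \<ge> n0" "n \<ge> n0" for m n
      using diff[of m n] mult_left_mono[OF close[OF that] k0] d by (simp add: dist_norm)
    then show "\<exists>n0. \<forall>m\<ge>n0. \<forall>n\<ge>n0. dist (N m) (N n) < e" by blast
  qed
  then obtain \<nu> where \<nu>: "N \<longlonglongrightarrow> \<nu>" using Cauchy_convergent convergent_def by blast
  show ?thesis
  proof
    show "tilde_rel k \<mu> \<nu>"
      unfolding tilde_rel_def
    proof (intro ballI)
      fix A :: "'a set" and B :: "'b set" assume "A \<in> sets borel" "B \<in> sets borel"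
      then have eq: "vmeas (N n) (A \<times> B) = vmeas (k (vmeas (s n) B)) A" for n using N(1) by (auto simp: tilde_rel_def)
      have "(\<lambda>n. vmeas (N n) (A \<times> B)) \<longlonglongrightarrow> vmeas \<nu> (A \<times> B)"
        by (rule bounded_linear.tendsto[OF bounded_linear_vmeas \<nu>])
      moreover have "(\<lambda>n. vmeas (k (vmeas (s n) B)) A) \<longlonglongrightarrow> vmeas (k (vmeas \<mu> B)) A"
        by (intro bounded_linear.tendsto[OF bounded_linear_vmeas] bounded_linear.tendsto[OF k] slim)
      ultimately show "vmeas \<nu> (A \<times> B) = vmeas (k (vmeas \<mu> B)) A" unfolding eq by (rule LIMSEQ_unique)
    qed
    show "norm \<nu> \<le> onorm k * norm \<mu>"
      by (rule LIMSEQ_le[OF tendsto_norm[OF \<nu>] tendsto_mult_left[OF tendsto_norm[OF slim]]]) (use N(2) in auto)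
  qed
qed

section \<open>Convolution and the Fourier transform\<close>

lemma norm_image_le:
  fixes g :: "'a::topological_space \<Rightarrow> 'b::topological_space"
  shows "norm (image_vmeasure g \<mu>) \<le> norm \<mu>"
proof (cases "g \<in> borel_measurable borel")
  case True
  show ?thesis
  proof (rule norm_vmeasure_leI)
    fix n :: nat and A :: "nat \<Rightarrow> 'b set"
    assume A: "\<And>k. k < n \<Longrightarrow> A k \<in> sets borel" "disjoint_family_on A {..<n}"
    have "(\<Sum>k<n. norm (vmeas (image_vmeasure g \<mu>) (A k))) = (\<Sum>k<n. norm (vmeas \<mu> (g -` A k)))"
      using A True by (intro sum.cong) (auto simp: vmeas_image)
    also have "\<dots> \<le> norm \<mu>"
      using A measurable_sets[OF True]
      by (intro sum_norm_vmeas_le) (auto simp: disjoint_family_on_def disjoint_iff)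
    finally show "(\<Sum>k<n. norm (vmeas (image_vmeasure g \<mu>) (A k))) \<le> norm \<mu>" .
  qed
next
  case False
  then have "image_vmeasure g \<mu> = 0" by transfer auto
  then show ?thesis by simp
qed

lemma image_add: "image_vmeasure g (\<mu> + \<nu>) = image_vmeasure g \<mu> + image_vmeasure g \<nu>"
  by transfer auto

lemma image_scaleR: "image_vmeasure g (r *\<^sub>R \<mu>) = r *\<^sub>R image_vmeasure g \<mu>"
  by transfer auto

lemma bounded_linear_image: "bounded_linear (image_vmeasure g)"
  by (rule bounded_linear_intro[of _ 1]) (simp_all add: image_add image_scaleR norm_image_le)

lemma bounded_linear_restrict: "bounded_linear (restrict_vmeasure E)"
  by (rule bounded_linear_intro[of _ 1]) (simp_all add: restrict_add restrict_scaleR norm_restrict_le)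

lemma tilde_vmeasure_rel:
  assumes "bounded_linear k"
  shows "tilde_rel k \<mu> (tilde_vmeasure k \<mu>)" "norm (tilde_vmeasure k \<mu>) \<le> onorm k * norm \<mu>"
proof -
  obtain \<nu> where \<nu>: "tilde_rel k \<mu> \<nu>" "norm \<nu> \<le> onorm k * norm \<mu>" using tilde_exists[OF assms] .
  have "tilde_vmeasure k \<mu> = \<nu>"
    unfolding tilde_vmeasure_def tilde_rel_def[symmetric] using \<nu>(1) by (blast intro: tilde_rel_unique)
  with \<nu> show "tilde_rel k \<mu> (tilde_vmeasure k \<mu>)" "norm (tilde_vmeasure k \<mu>) \<le> onorm k * norm \<mu>" by auto
qed

lemma norm_convolve_le:
  assumes "bounded_linear k"
  shows "norm (convolve k \<mu>) \<le> onorm k * norm \<mu>"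
  unfolding convolve_def using norm_image_le tilde_vmeasure_rel(2)[OF assms] order_trans by blast

lemma bounded_linear_convolve:
  assumes k: "bounded_linear k"
  shows "bounded_linear (convolve k)"
proof (rule bounded_linear_intro[of _ "onorm k"])
  note lin = linear_add[OF bounded_linear.linear[OF k]] linear_scale[OF bounded_linear.linear[OF k]]
  fix \<mu> \<nu> :: "(real, 'a) vmeasure" and r :: real
  have "tilde_rel k (\<mu> + \<nu>) (tilde_vmeasure k \<mu> + tilde_vmeasure k \<nu>)"
    using tilde_vmeasure_rel(1)[OF k, of \<mu>] tilde_vmeasure_rel(1)[OF k, of \<nu>]
    by (simp add: tilde_rel_def vmeas_simps lin)
  then show "convolve k (\<mu> + \<nu>) = convolve k \<mu> + convolve k \<nu>"
    unfolding convolve_def using tilde_rel_unique[OF tilde_vmeasure_rel(1)[OF k]] image_add by metis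
  have "tilde_rel k (r *\<^sub>R \<mu>) (r *\<^sub>R tilde_vmeasure k \<mu>)"
    using tilde_vmeasure_rel(1)[OF k, of \<mu>] by (simp add: tilde_rel_def vmeas_simps lin)
  then show "convolve k (r *\<^sub>R \<mu>) = r *\<^sub>R convolve k \<mu>"
    unfolding convolve_def using tilde_rel_unique[OF tilde_vmeasure_rel(1)[OF k]] image_scaleR by metis
  show "norm (convolve k \<mu>) \<le> norm \<mu> * onorm k" using norm_convolve_le[OF k, of \<mu>] by (simp add: mult.commute)
qed

text \<open>A Fubini rule. In \<open>g\<close> it suffices to test indicators of sets
  \<open>B\<close>: restricting the product measure to the strip over \<open>B\<close> and
  projecting to the first coordinate gives \<open>k (vmeas \<mu> B)\<close>.\<close>

lemma vintegral_tilde: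
  fixes k :: "'h::complex_hilbert_space \<Rightarrow> (real, 'h) vmeasure"
  assumes k: "bounded_clinear k" and f: "f \<in> bdd_borel" and g: "g \<in> bdd_borel"
  shows "vintegral (tilde_vmeasure k \<mu>) (\<lambda>p. f (fst p) * g (snd p)) = vintegral (k (vintegral \<mu> g)) f"
proof -
  have kl: "bounded_linear k" and kc: "\<And>c x. k (c *\<^sub>C x) = c *\<^sub>C k x" using k by (auto simp: bounded_clinear_def)
  let ?\<nu> = "tilde_vmeasure k \<mu>"
  obtain F where F: "F > 0" "\<And>x. cmod (f x) \<le> F" by (rule bdd_borelE[OF f]) blast
  have mf: "(fst :: real \<times> real \<Rightarrow> real) \<in> borel_measurable borel"
    and ms: "(snd :: real \<times> real \<Rightarrow> real) \<in> borel_measurable borel"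
    by (intro borel_measurable_continuous_onI continuous_intros)+
  have fst: "(\<lambda>p::real \<times> real. f (fst p)) \<in> bdd_borel" by (rule bdd_borel_compose[OF f mf])
  have snd: "(\<lambda>p::real \<times> real. u (snd p)) \<in> bdd_borel" if "u \<in> bdd_borel" for u :: "real \<Rightarrow> complex"
    by (rule bdd_borel_compose[OF that ms])
  have "vintegral ?\<nu> (\<lambda>p. f (fst p) * g (snd p)) - vintegral (k (vintegral \<mu> g)) f = 0"
  proof (rule bdd_borel_zero_principle[where f = g and \<Phi> = "\<lambda>g. vintegral ?\<nu> (\<lambda>p. f (fst p) * g (snd p)) - vintegral (k (vintegral \<mu> g)) f" and C = "F * norm ?\<nu> + F * (onorm k * norm \<mu>)"])
    fix u v :: "real \<Rightarrow> complex" assume uv: "u \<in> bdd_borel" "v \<in> bdd_borel"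
    show "vintegral ?\<nu> (\<lambda>p. f (fst p) * (u (snd p) + v (snd p))) - vintegral (k (vintegral \<mu> (\<lambda>x. u x + v x))) f =
      vintegral ?\<nu> (\<lambda>p. f (fst p) * u (snd p)) - vintegral (k (vintegral \<mu> u)) f +
      (vintegral ?\<nu> (\<lambda>p. f (fst p) * v (snd p)) - vintegral (k (vintegral \<mu> v)) f)"
      unfolding distrib_left
      by (subst vintegral_add)
        (simp_all add: uv f fst snd bdd_borel_mult vintegral_add linear_add[OF bounded_linear.linear[OF kl]]
          vintegral_add_measure)
  next
    fix u :: "real \<Rightarrow> complex" and B assume u: "u \<in> bdd_borel" "\<And>x. cmod (u x) \<le> B"
    have "norm (vintegral ?\<nu> (\<lambda>p. f (fst p) * u (snd p))) \<le> (F * B) * norm ?\<nu>"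
      using F u by (intro norm_vintegral_le bdd_borel_mult fst snd) (auto simp: norm_mult intro!: mult_mono)
    moreover have "norm (vintegral (k (vintegral \<mu> u)) f) \<le> F * (onorm k * (B * norm \<mu>))"
    proof -
      have "norm (vintegral (k (vintegral \<mu> u)) f) \<le> F * norm (k (vintegral \<mu> u))"
        by (rule norm_vintegral_le[OF f F(2)])
      also have "\<dots> \<le> F * (onorm k * norm (vintegral \<mu> u))"
        using F(1) by (intro mult_left_mono onorm[OF kl]) auto
      also have "\<dots> \<le> F * (onorm k * (B * norm \<mu>))"
        using F(1) norm_vintegral_le[OF u, of \<mu>] by (intro mult_left_mono onorm_pos_le[OF kl]) auto
      finally show ?thesis .
    qed
    ultimately show "norm (vintegral ?\<nu> (\<lambda>p. f (fst p) * u (snd p)) - vintegral (k (vintegral \<mu> u)) f) \<le>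
      (F * norm ?\<nu> + F * (onorm k * norm \<mu>)) * B"
      using norm_triangle_ineq4[of "vintegral ?\<nu> (\<lambda>p. f (fst p) * u (snd p))" "vintegral (k (vintegral \<mu> u)) f"]
      by (simp add: algebra_simps)
  next
    fix c and B :: "real set" assume B: "B \<in> sets borel"
    have UB: "(UNIV :: real set) \<times> B \<in> sets borel"
      unfolding borel_prod[symmetric] using B by (intro pair_measureI) auto
    have im: "image_vmeasure fst (restrict_vmeasure (UNIV \<times> B) ?\<nu>) = k (vmeas \<mu> B)"
    proof (rule vmeasure_eqI)
      fix A :: "real set" assume A: "A \<in> sets borel"
      have A': "fst -` A \<in> sets (borel :: (real \<times> real) measure)" using measurable_sets[OF mf A] by simp
      have "UNIV \<times> B \<inter> fst -` A = A \<times> B" by auto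
      then show "vmeas (image_vmeasure fst (restrict_vmeasure (UNIV \<times> B) ?\<nu>)) A = vmeas (k (vmeas \<mu> B)) A"
        using tilde_vmeasure_rel(1)[OF kl, of \<mu>] A B A' UB mf
        by (simp add: vmeas_image vmeas_restrict tilde_rel_def)
    qed
    have "vintegral ?\<nu> (\<lambda>p. f (fst p) * (c * indicator B (snd p))) =
      vintegral ?\<nu> (\<lambda>p. c * (indicator (UNIV \<times> B) p * f (fst p)))"
      by (intro arg_cong[where f = "vintegral ?\<nu>"]) (auto simp: indicator_def)
    also have "\<dots> = c *\<^sub>C vintegral (restrict_vmeasure (UNIV \<times> B) ?\<nu>) (\<lambda>p. f (fst p))"
      by (simp add: vintegral_cmult vintegral_restrict bdd_borel_mult bdd_borel_indicator UB fst)
    also have "\<dots> = c *\<^sub>C vintegral (k (vmeas \<mu> B)) f"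
      using vintegral_image[OF f mf, of "restrict_vmeasure (UNIV \<times> B) ?\<nu>"] by (simp add: im)
    also have "\<dots> = vintegral (k (vintegral \<mu> (\<lambda>x. c * indicator B x))) f"
      by (simp add: vintegral_indicator B kc vintegral_scaleC_measure f)
    finally show "vintegral ?\<nu> (\<lambda>p. f (fst p) * (c * indicator B (snd p))) -
      vintegral (k (vintegral \<mu> (\<lambda>x. c * indicator B x))) f = 0" by simp
  qed (rule g)
  then show ?thesis by simp
qed

definition echar :: "real \<Rightarrow> real \<Rightarrow> complex"
  where "echar y t = exp (- \<i> * of_real t * of_real y)"

definition ft :: "(real, 'h::complex_hilbert_space) vmeasure \<Rightarrow> real \<Rightarrow> 'h"
  where "ft \<mu> y = vintegral \<mu> (echar y)"

lemma fourier_eq_ft: "fourier k y h = ft (k h) y"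
  by (simp add: fourier_def ft_def echar_def[abs_def])

lemma norm_echar [simp]: "cmod (echar y t) = 1"
  by (simp add: echar_def norm_exp_eq_Re)

lemma bdd_borel_echar: "echar y \<in> bdd_borel"
  by (rule bdd_borelI[of _ 1], unfold echar_def[abs_def]) (auto simp: norm_exp_eq_Re)

lemma echar_add: "echar y (s + t) = echar y s * echar y t"
  by (simp add: echar_def exp_add[symmetric] algebra_simps)

lemma bounded_linear_ft: "bounded_linear (\<lambda>\<mu>. ft \<mu> y)"
  unfolding ft_def by (rule bounded_linear_vintegral[OF bdd_borel_echar])

lemmas ft_add = linear_add[OF bounded_linear.linear[OF bounded_linear_ft]]
  and ft_diff = linear_diff[OF bounded_linear.linear[OF bounded_linear_ft]]
  and ft_sum = linear_sum[OF bounded_linear.linear[OF bounded_linear_ft]]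

lemma ft_scaleC: "ft (c *\<^sub>C \<mu>) y = c *\<^sub>C ft \<mu> y"
  by (simp add: ft_def vintegral_scaleC_measure bdd_borel_echar)

lemma norm_ft_le: "norm (ft \<mu> y) \<le> norm \<mu>"
  using norm_vintegral_le[OF bdd_borel_echar, of y 1 \<mu>] by (simp add: ft_def)

lemma ft_image:
  assumes "g \<in> borel_measurable borel"
  shows "ft (image_vmeasure g \<mu>) y = vintegral \<mu> (\<lambda>t. echar y (g t))"
  unfolding ft_def by (rule vintegral_image[OF bdd_borel_echar assms])

text \<open>A character of \<open>t + s\<close> splits into a product, so this is the Fubini rule
  with the same character in each variable.\<close>

lemma ft_convolve:
  assumes k: "bounded_clinear k"
  shows "ft (convolve k \<mu>) y = fourier k y (ft \<mu> y)"
proof -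
  have "ft (convolve k \<mu>) y = vintegral (tilde_vmeasure k \<mu>) (\<lambda>p. echar y (fst p) * echar y (snd p))"
  proof -
    have "(\<lambda>(t, s). t + s :: real) \<in> borel_measurable borel"
      unfolding case_prod_beta' by (intro borel_measurable_continuous_onI continuous_intros)
    then show ?thesis unfolding convolve_def by (subst ft_image) (simp_all add: case_prod_beta' echar_add)
  qed
  also have "\<dots> = fourier k y (ft \<mu> y)"
    by (simp add: vintegral_tilde[OF k bdd_borel_echar bdd_borel_echar] fourier_eq_ft ft_def)
  finally show ?thesis .
qed

lemma bounded_clinear_fourier:
  assumes "bounded_clinear k"
  shows "bounded_clinear (fourier k y)"
proof -
  have "bounded_linear (\<lambda>h. ft (k h) y)"
    using assms by (intro bounded_linear_compose[OF bounded_linear_ft]) (simp add: bounded_clinear_def)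
  then show ?thesis using assms
    by (simp add: bounded_clinear_def fourier_eq_ft[abs_def] ft_scaleC)
qed

lemma vintegral_point_mass:
  assumes f: "f \<in> bdd_borel"
  shows "vintegral (point_mass x (h :: 'h::{complex_normed_vector, banach})) f = f x *\<^sub>C h"
proof (rule vintegral_eqI[where C = "norm h", OF _ _ _ f])
  fix f :: "'a \<Rightarrow> complex" and B assume "\<And>x. cmod (f x) \<le> B"
  then show "norm (f x *\<^sub>C h) \<le> norm h * B" 
    by (simp add: norm_scaleC mult.commute[of "norm h"] mult_right_mono)
next
  fix c and A :: "'a set" assume A: "A \<in> sets borel"
  have "indicator A x *\<^sub>R h = indicator A x *\<^sub>C h" by (simp add: scaleR_scaleC indicator_def)
  then show "(c * indicator A x) *\<^sub>C h = c *\<^sub>C vmeas (point_mass x h) A"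
    using A by (simp add: point_mass.rep_eq scaleC_scaleC)
qed (simp add: scaleC_add_left)

lemma scaleC_one [simp]: "1 *\<^sub>C x = (x :: 'a::complex_normed_vector)"
  using scaleR_scaleC[of 1 x] by simp

lemma ft_point_mass: "ft (point_mass x h) y = echar y x *\<^sub>C h"
  by (simp add: ft_def vintegral_point_mass bdd_borel_echar)

lemma fourier_unit: "fourier conv_unit y h = h"
  by (simp add: fourier_eq_ft conv_unit_def ft_point_mass echar_def)

lemma norm_point_mass_le: "norm (point_mass x h) \<le> norm h"
proof (rule norm_vmeasure_leI)
  fix n :: nat and A :: "nat \<Rightarrow> 'a set"
  assume A: "\<And>k. k < n \<Longrightarrow> A k \<in> sets borel" "disjoint_family_on A {..<n}"
  have "(\<Sum>k<n. norm (vmeas (point_mass x h) (A k))) = (\<Sum>k<n. norm (indicator (A k) x *\<^sub>R h))"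
    using A by (intro sum.cong) (auto simp: point_mass.rep_eq)
  also have "\<dots> \<le> norm h" by (rule norm_indicator_sum_le[OF A(2)])
  finally show "(\<Sum>k<n. norm (vmeas (point_mass x h) (A k))) \<le> norm h" .
qed

lemma bounded_clinear_point_mass:
  "bounded_clinear (point_mass x :: 'h::complex_normed_vector \<Rightarrow> ('a::topological_space, 'h) vmeasure)"
  unfolding bounded_clinear_def
proof (intro conjI allI)
  show "bounded_linear (point_mass x :: 'h \<Rightarrow> ('a, 'h) vmeasure)"
  proof (rule bounded_linear_intro[of _ 1])
    fix h h' :: 'h and r :: real
    show "point_mass x (h + h') = point_mass x h + (point_mass x h' :: ('a, 'h) vmeasure)"
      by (rule vmeasure_eqI) (simp add: point_mass.rep_eq vmeas_simps scaleR_add_right)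
    show "point_mass x (r *\<^sub>R h) = r *\<^sub>R (point_mass x h :: ('a, 'h) vmeasure)"
      by (rule vmeasure_eqI) (simp add: point_mass.rep_eq vmeas_simps)
  qed (simp add: norm_point_mass_le)
  show "point_mass x (c *\<^sub>C h) = c *\<^sub>C (point_mass x h :: ('a, 'h) vmeasure)" for c and h :: 'h
    by (rule vmeasure_eqI) (simp add: point_mass.rep_eq vmeas_simps indicator_def)
qed

subsection \<open>Uniqueness of the Fourier transform\<close>

lemma Re_cinner_le:
  assumes "norm v = 1" shows "\<bar>Re (cinner x v)\<bar> \<le> norm (x :: 'h::complex_hilbert_space)"
proof -
  have "0 \<le> (norm (x - Re (cinner x v) *\<^sub>R v))\<^sup>2" by simp
  then have "(Re (cinner x v))\<^sup>2 \<le> (norm x)\<^sup>2"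
    unfolding norm_diff_square using assms by (simp add: power2_eq_square)
  then show ?thesis by (simp add: abs_le_square_iff[symmetric])
qed

lemma bounded_linear_Re_cinner:
  assumes "norm v = 1" shows "bounded_linear (\<lambda>x. Re (cinner (x :: 'h::complex_hilbert_space) v))"
  using Re_cinner_le[OF assms]
  by (intro bounded_linear_intro[of _ 1]) (auto simp: cinner_add_left scaleR_scaleC cinner_scaleC_left)

text \<open>Perturbing the total variation by a functional of the vector measure keeps it positive, so
  that the uniqueness theorem for probability measures applies.\<close>

lemma perturbed_variation:
  fixes \<mu> :: "(real, 'h::complex_hilbert_space) vmeasure"
  assumes \<mu>: "norm \<mu> > 0" and \<phi>: "bounded_linear \<phi>" "\<And>x. \<bar>\<phi> x\<bar> \<le> norm x" and z: "\<And>y. ft \<mu> y = 0"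
  obtains N where "real_distribution N"
    "\<And>A. A \<in> sets borel \<Longrightarrow> measure N A = (measure (variation \<mu>) A + \<phi> (vmeas \<mu> A)) / norm \<mu>"
    "\<And>y. char N y = (\<integral>x. iexp (y * x) \<partial>variation \<mu>) / norm \<mu>"
proof -
  let ?V = "variation \<mu>"
  interpret V: finite_measure ?V by (rule finite_measure_variation)
  define n where "n A = (measure ?V A + \<phi> (vmeas \<mu> A)) / norm \<mu>" for A
  define N where "N = measure_of UNIV (sets borel) (\<lambda>A. ennreal (n A))"
  have n0: "n A \<ge> 0" if "A \<in> sets borel" for A
    using \<phi>(2)[of "vmeas \<mu> A"] norm_vmeas_le_variation[OF that, of \<mu>] by (auto simp: n_def)
  have sN [simp]: "sets N = sets borel"
    using sets.sets_measure_of_eq[of "borel :: real measure"] by (simp add: N_def)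
  have \<phi>0: "\<phi> 0 = 0" by (rule linear_0[OF bounded_linear.linear[OF \<phi>(1)]])
  have eN: "emeasure N A = ennreal (n A)" if A: "A \<in> sets borel" for A
  proof (rule emeasure_measure_of[OF N_def])
    show "positive (sets N) (\<lambda>A. ennreal (n A))" by (simp add: positive_def n_def \<phi>0)
    show "countably_additive (sets N) (\<lambda>A. ennreal (n A))"
    proof (rule countably_additiveI)
      fix A :: "nat \<Rightarrow> real set"
      assume A: "range A \<subseteq> sets N" "disjoint_family A" "(\<Union>i. A i) \<in> sets N"
      have "(\<lambda>i. measure ?V (A i)) sums measure ?V (\<Union>i. A i)"
        using A by (intro V.finite_measure_UNION) auto
      moreover have "(\<lambda>i. \<phi> (vmeas \<mu> (A i))) sums \<phi> (vmeas \<mu> (\<Union>i. A i))"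
        using A by (intro bounded_linear.sums[OF \<phi>(1)] vmeas_sums) auto
      ultimately have "(\<lambda>i. n (A i)) sums n (\<Union>i. A i)"
        unfolding n_def by (intro sums_divide sums_add)
      moreover have "0 \<le> n (A i)" for i using A by (intro n0) auto
      ultimately show "(\<Sum>i. ennreal (n (A i))) = ennreal (n (\<Union>i. A i))"
        by (subst suminf_ennreal2) (auto simp: sums_iff)
    qed
  qed (use A in auto)
  have mN: "measure N A = n A" if "A \<in> sets borel" for A
    using eN[OF that] n0[OF that] by (simp add: measure_def)
  have spN: "space N = UNIV" using sets_eq_imp_space_eq[OF sN] by simp
  \<comment> \<open>At frequency zero the transform is the total value of \<open>\<mu>\<close>; its
    vanishing makes the total mass of \<open>N\<close> equal to one.\<close>
  have "vmeas \<mu> UNIV = 0"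
  proof -
    have "echar 0 = (\<lambda>t. 1 * indicator UNIV t)" by (auto simp: echar_def)
    then show ?thesis using z[of 0] vintegral_indicator[of UNIV \<mu> 1] by (simp add: ft_def)
  qed
  then have "n UNIV = 1" using \<mu> by (simp add: n_def \<phi>0 measure_variation restrict_UNIV)
  then have "prob_space N" by (intro prob_spaceI) (simp add: spN eN)
  then interpret N: prob_space N .
  have rd: "real_distribution N" by standard simp
  have bint: "integrable M (\<lambda>x. Re (f x))" if "f \<in> bdd_borel" "finite_measure M" "sets M = sets borel" for f :: "real \<Rightarrow> complex" and M
  proof -
    interpret finite_measure M by fact
    obtain B where B: "\<And>x. cmod (f x) \<le> B" using \<open>f \<in> bdd_borel\<close> unfolding bdd_borel_def by blast
    have "f \<in> borel_measurable M" using that(1) by (simp add: bdd_borel_def measurable_cong_sets[OF that(3)])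
    then show ?thesis
      using order_trans[OF abs_Re_le_cmod B] by (intro integrable_const_bound[of _ B]) auto
  qed
  \<comment> \<open>Extends the formula for the measure of sets to integrals. Only real parts
    appear, because \<open>\<phi>\<close> is a real functional.\<close>
  have key: "(\<integral>x. Re (f x) \<partial>N) - ((\<integral>x. Re (f x) \<partial>?V) + \<phi> (vintegral \<mu> (\<lambda>x. complex_of_real (Re (f x))))) / norm \<mu> = 0"
    if f: "f \<in> bdd_borel" for f
  proof (rule bdd_borel_zero_principle[where \<Phi> = "\<lambda>f. (\<integral>x. Re (f x) \<partial>N) - ((\<integral>x. Re (f x) \<partial>?V) + \<phi> (vintegral \<mu> (\<lambda>x. complex_of_real (Re (f x))))) / norm \<mu>" and C = 3, OF _ _ _ f])
    fix f g :: "real \<Rightarrow> complex" assume fg: "f \<in> bdd_borel" "g \<in> bdd_borel"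
    have "vintegral \<mu> (\<lambda>x. complex_of_real (Re (f x + g x))) =
      vintegral \<mu> (\<lambda>x. complex_of_real (Re (f x))) + vintegral \<mu> (\<lambda>x. complex_of_real (Re (g x)))"
      using vintegral_add[OF bdd_borel_of_real_Re bdd_borel_of_real_Re] fg by simp
    moreover have "(\<integral>x. Re (f x + g x) \<partial>M) = (\<integral>x. Re (f x) \<partial>M) + (\<integral>x. Re (g x) \<partial>M)"
      if "finite_measure M" "sets M = sets borel" for M
      using Bochner_Integration.integral_add[OF bint[OF fg(1) that] bint[OF fg(2) that]] by simp
    ultimately show "(\<integral>x. Re (f x + g x) \<partial>N) - ((\<integral>x. Re (f x + g x) \<partial>?V) + \<phi> (vintegral \<mu> (\<lambda>x. complex_of_real (Re (f x + g x))))) / norm \<mu>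
      = (\<integral>x. Re (f x) \<partial>N) - ((\<integral>x. Re (f x) \<partial>?V) + \<phi> (vintegral \<mu> (\<lambda>x. complex_of_real (Re (f x))))) / norm \<mu>
      + ((\<integral>x. Re (g x) \<partial>N) - ((\<integral>x. Re (g x) \<partial>?V) + \<phi> (vintegral \<mu> (\<lambda>x. complex_of_real (Re (g x))))) / norm \<mu>)"
      using N.finite_measure_axioms V.finite_measure_axioms
      by (simp add: linear_add[OF bounded_linear.linear[OF \<phi>(1)]] add_divide_distrib)
  next
    fix f :: "real \<Rightarrow> complex" and B assume f: "f \<in> bdd_borel" "\<And>x. cmod (f x) \<le> B"
    have b: "\<bar>\<integral>x. Re (f x) \<partial>M\<bar> \<le> B * measure M UNIV"
      if "finite_measure M" "sets M = sets borel" for M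
    proof -
      interpret finite_measure M by fact
      have "\<bar>\<integral>x. Re (f x) \<partial>M\<bar> \<le> (\<integral>x. \<bar>Re (f x)\<bar> \<partial>M)" by (rule integral_abs_bound)
      also have "\<dots> \<le> (\<integral>x. B \<partial>M)"
        using order_trans[OF abs_Re_le_cmod f(2)] bint[OF f(1) that]
        by (intro integral_mono) auto
      finally show ?thesis using sets_eq_imp_space_eq[OF that(2)] by (simp add: mult.commute)
    qed
    have "\<bar>\<phi> (vintegral \<mu> (\<lambda>x. complex_of_real (Re (f x))))\<bar> \<le> B * norm \<mu>"
      by (rule order_trans[OF \<phi>(2)], rule norm_vintegral_le[OF bdd_borel_of_real_Re[OF f(1)]])
        (use order_trans[OF abs_Re_le_cmod f(2)] in auto)
    with b[OF V.finite_measure_axioms]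
    have "\<bar>(\<integral>x. Re (f x) \<partial>?V) + \<phi> (vintegral \<mu> (\<lambda>x. complex_of_real (Re (f x))))\<bar> \<le> 2 * B * norm \<mu>"
      by (simp add: measure_variation restrict_UNIV)
    then have "\<bar>((\<integral>x. Re (f x) \<partial>?V) + \<phi> (vintegral \<mu> (\<lambda>x. complex_of_real (Re (f x))))) / norm \<mu>\<bar> \<le> 2 * B"
      using \<mu> by (simp add: abs_divide pos_divide_le_eq)
    with b[OF N.finite_measure_axioms]
    show "norm ((\<integral>x. Re (f x) \<partial>N) - ((\<integral>x. Re (f x) \<partial>?V) + \<phi> (vintegral \<mu> (\<lambda>x. complex_of_real (Re (f x))))) / norm \<mu>) \<le> 3 * B"
      using mN[of UNIV] \<open>n UNIV = 1\<close> abs_triangle_ineq4[of "\<integral>x. Re (f x) \<partial>N"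
        "((\<integral>x. Re (f x) \<partial>?V) + \<phi> (vintegral \<mu> (\<lambda>x. complex_of_real (Re (f x))))) / norm \<mu>"] by simp
  next
    fix c and A :: "real set" assume A: "A \<in> sets borel"
    have "Re (c * indicator A x) = Re c * indicator A x" for x by (simp add: indicator_def)
    moreover have "vintegral \<mu> (\<lambda>x. complex_of_real (Re c * indicator A x)) = Re c *\<^sub>R vmeas \<mu> A"
      using vintegral_indicator[OF A, of \<mu> "complex_of_real (Re c)"]
      by (simp add: scaleR_scaleC of_real_indicator)
    ultimately show "(\<integral>x. Re (c * indicator A x) \<partial>N) - ((\<integral>x. Re (c * indicator A x) \<partial>?V) +
      \<phi> (vintegral \<mu> (\<lambda>x. complex_of_real (Re (c * indicator A x))))) / norm \<mu> = 0"
      using A by (simp add: mN n_def linear_scale[OF bounded_linear.linear[OF \<phi>(1)]] spN distrib_left)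
  qed
  \<comment> \<open>Cosine and sine at frequency \<open>y\<close> are combinations of the characters
    at \<open>y\<close> and \<open>- y\<close>, so the perturbation contributes nothing to the
    characteristic function.\<close>
  have z2: "vintegral \<mu> (\<lambda>x. complex_of_real (cos (y * x))) = 0" "vintegral \<mu> (\<lambda>x. complex_of_real (sin (y * x))) = 0" for y
  proof -
    have "complex_of_real (cos (y * x)) = (1/2) * echar (- y) x + (1/2) * echar y x"
      "complex_of_real (sin (y * x)) = (- \<i>/2) * echar (- y) x + (\<i>/2) * echar y x" for x
      by (auto simp: echar_def complex_eq_iff Re_exp Im_exp mult.commute)
    then have "(\<lambda>x. complex_of_real (cos (y * x))) = (\<lambda>x. (1/2) * echar (- y) x + (1/2) * echar y x)"
      "(\<lambda>x. complex_of_real (sin (y * x))) = (\<lambda>x. (- \<i>/2) * echar (- y) x + (\<i>/2) * echar y x)" by blast+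
    moreover have "vintegral \<mu> (\<lambda>x. a * echar (- y) x + b * echar y x) = 0" for a b
      using z[of y] z[of "- y"]
      by (simp add: vintegral_add vintegral_cmult bdd_borel_cmult bdd_borel_echar ft_def)
    ultimately show "vintegral \<mu> (\<lambda>x. complex_of_real (cos (y * x))) = 0" "vintegral \<mu> (\<lambda>x. complex_of_real (sin (y * x))) = 0"
      by metis+
  qed
  have chr: "char N y = (\<integral>x. iexp (y * x) \<partial>?V) / norm \<mu>" for y
  proof (rule complex_eqI)
    have fb: "iexp \<circ> (*) y \<in> bdd_borel" by (rule bdd_borelI[of _ 1]) auto
    \<comment> \<open>The real part of this function is the sine, so the formula for real parts also
      yields the imaginary part of the characteristic function.\<close>
    have fb2: "(\<lambda>x. - \<i> * (iexp \<circ> (*) y) x) \<in> bdd_borel" by (rule bdd_borel_cmult[OF fb])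
    have ci: "complex_integrable M (\<lambda>x. iexp (y * x))" if "finite_measure M" "sets M = sets borel" for M
    proof -
      interpret finite_measure M by fact
      have "(\<lambda>x. iexp (y * x)) \<in> borel_measurable M" unfolding measurable_cong_sets[OF that(2) refl] by simp
      then show ?thesis by (intro integrable_const_bound[of _ 1]) auto
    qed
    have re: "Re (\<integral>x. iexp (y * x) \<partial>M) = (\<integral>x. cos (y * x) \<partial>M)" "Im (\<integral>x. iexp (y * x) \<partial>M) = (\<integral>x. sin (y * x) \<partial>M)"
      if "finite_measure M" "sets M = sets borel" for M
      using integral_bounded_linear[OF bounded_linear_Re ci[OF that]] integral_bounded_linear[OF bounded_linear_Im ci[OF that]]
      by (simp_all add: Re_exp Im_exp)
    show "Re (char N y) = Re ((\<integral>x. iexp (y * x) \<partial>?V) / norm \<mu>)"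
      using key[OF fb] re[OF N.finite_measure_axioms sN] re[OF V.finite_measure_axioms]
      by (simp add: char_def Re_exp z2 \<phi>0 Re_divide_of_real)
    show "Im (char N y) = Im ((\<integral>x. iexp (y * x) \<partial>?V) / norm \<mu>)"
      using key[OF fb2] re[OF N.finite_measure_axioms sN] re[OF V.finite_measure_axioms]
      by (simp add: char_def Im_exp z2 \<phi>0 Im_divide_of_real)
  qed
  show ?thesis using rd mN chr by (intro that[of N]) (auto simp: n_def)
qed

text \<open>If \<open>\<mu>\<close> had a nonzero value at \<open>A\<close>, let \<open>v\<close> be
  its direction. The variation perturbed by the inner product with \<open>v\<close> and the
  variation perturbed by zero have the same characteristic function, hence coincide by Levy's
  theorem. At \<open>A\<close> they differ by a positive multiple of the norm of that value.\<close>

lemma ft_zero_imp_zero: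
  fixes \<mu> :: "(real, 'h::complex_hilbert_space) vmeasure"
  assumes z: "\<And>y. ft \<mu> y = 0"
  shows "\<mu> = 0"
proof (rule ccontr)
  assume "\<mu> \<noteq> 0"
  then have pos: "norm \<mu> > 0" by simp
  have "\<exists>A\<in>sets borel. vmeas \<mu> A \<noteq> 0"
    using \<open>\<mu> \<noteq> 0\<close> vmeasure_eqI[of \<mu> 0] by (auto simp: vmeas_simps)
  then obtain A where A: "A \<in> sets borel" "vmeas \<mu> A \<noteq> 0" by blast
  define v where "v = (1 / norm (vmeas \<mu> A)) *\<^sub>R vmeas \<mu> A"
  have v: "norm v = 1" using A by (simp add: v_def)
  obtain N where N: "real_distribution N"
    "\<And>A. A \<in> sets borel \<Longrightarrow> measure N A = (measure (variation \<mu>) A + Re (cinner (vmeas \<mu> A) v)) / norm \<mu>"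
    "\<And>y. char N y = (\<integral>x. iexp (y * x) \<partial>variation \<mu>) / norm \<mu>"
    using perturbed_variation[OF pos bounded_linear_Re_cinner[OF v] Re_cinner_le[OF v] z] by blast
  obtain N' where N': "real_distribution N'"
    "\<And>A. A \<in> sets borel \<Longrightarrow> measure N' A = (measure (variation \<mu>) A + (\<lambda>_. 0) (vmeas \<mu> A)) / norm \<mu>"
    "\<And>y. char N' y = (\<integral>x. iexp (y * x) \<partial>variation \<mu>) / norm \<mu>"
    using perturbed_variation[OF pos bounded_linear_zero _ z] by (metis abs_zero norm_ge_zero)
  have "N = N'" by (rule Levy_uniqueness[OF N(1) N'(1)]) (simp add: fun_eq_iff N(3) N'(3))
  then have "Re (cinner (vmeas \<mu> A) v) = 0" using N(2)[OF A(1)] N'(2)[OF A(1)] pos by simp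
  moreover have "cinner (vmeas \<mu> A) v = complex_of_real (norm (vmeas \<mu> A))"
  proof -
    have "vmeas \<mu> A = complex_of_real (norm (vmeas \<mu> A)) *\<^sub>C v"
      using A by (simp add: v_def scaleR_scaleC[symmetric])
    then have "cinner (vmeas \<mu> A) v = complex_of_real (norm (vmeas \<mu> A)) * cinner v v"
      by (metis cinner_scaleC_left)
    then show ?thesis by (simp add: cinner_same v)
  qed
  ultimately show False using A by simp
qed

text \<open>From here on, identities between measures, and between operators on them, are mostly
  checked one frequency at a time.\<close>

lemma ft_inject:
  assumes "\<And>y. ft \<mu> y = ft \<nu> y"
  shows "\<mu> = \<nu>"
  using ft_zero_imp_zero[of "\<mu> - \<nu>"] assms by (simp add: ft_diff)

subsection \<open>Densities\<close>

text \<open>Over disjoint pieces the integrals of \<open>g\<close> are integrals against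
  restrictions of \<open>\<mu>\<close>, whose norms add up to at most \<open>norm \<mu>\<close>.
  This yields both existence and the norm bound.\<close>

lemma density_vmeasure:
  fixes \<mu> :: "('a::topological_space, 'h::{complex_normed_vector, banach}) vmeasure"
  assumes g: "g \<in> bdd_borel"
  shows vmeas_density:
      "A \<in> sets borel \<Longrightarrow> vmeas (density_vmeasure g \<mu>) A = vintegral \<mu> (\<lambda>t. indicator A t * g t)"
    and norm_density_le: "(\<And>x. cmod (g x) \<le> B) \<Longrightarrow> norm (density_vmeasure g \<mu>) \<le> B * norm \<mu>"
proof -
  define n where "n A = (if A \<in> sets borel then vintegral \<mu> (\<lambda>t. indicator A t * g t) else 0)" for A
  have nr: "n A = vintegral (restrict_vmeasure A \<mu>) g" if "A \<in> sets borel" for A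
    using vintegral_restrict[OF g that, of \<mu>] that by (simp add: n_def)
  have mass: "(\<Sum>k<m. norm (n (A k))) \<le> B * norm \<mu>"
    if B: "\<And>x. cmod (g x) \<le> B" and A: "\<And>k. k < m \<Longrightarrow> A k \<in> sets borel" "disjoint_family_on A {..<m::nat}" for m A B
  proof -
    have "(\<Sum>k<m. norm (n (A k))) \<le> (\<Sum>k<m. B * norm (restrict_vmeasure (A k) \<mu>))"
      using A by (intro sum_mono) (auto simp: nr intro: norm_vintegral_le[OF g B])
    also have "\<dots> \<le> B * norm \<mu>" unfolding sum_distrib_left[symmetric]
      using A order_trans[OF norm_ge_zero B] by (intro mult_left_mono sum_norm_restrict_le) auto
    finally show ?thesis .
  qed
  obtain B0 where B0: "\<And>x. cmod (g x) \<le> B0" using g unfolding bdd_borel_def by blast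
  have "is_vmeasure n"
  proof (rule is_vmeasureI[OF _ _ _ mass[OF B0]])
    fix A B :: "'a set" assume AB: "A \<in> sets borel" "B \<in> sets borel" "A \<inter> B = {}"
    have "(\<lambda>t. indicator (A \<union> B) t * g t) = (\<lambda>t. indicator A t * g t + indicator B t * g t)"
    proof
      fix t show "indicator (A \<union> B) t * g t = indicator A t * g t + indicator B t * g t"
        using AB(3) by (cases "t \<in> A"; cases "t \<in> B") auto
    qed
    then show "n (A \<union> B) = n A + n B" using AB
      by (simp add: n_def vintegral_add bdd_borel_mult bdd_borel_indicator g)
  next
    fix A :: "nat \<Rightarrow> 'a set" assume A: "range A \<subseteq> sets borel" "decseq A" "(\<Inter>n. A n) = {}"
    have Ab: "A i \<in> sets borel" for i using A by auto
    interpret V: finite_measure "variation \<mu>" by (rule finite_measure_variation)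
    have "(\<lambda>i. measure (variation \<mu>) (A i)) \<longlonglongrightarrow> measure (variation \<mu>) (\<Inter>i. A i)"
      using A by (intro V.finite_Lim_measure_decseq) auto
    then have "(\<lambda>i. B0 * measure (variation \<mu>) (A i)) \<longlonglongrightarrow> B0 * 0" using A(3) by (intro tendsto_intros) simp
    then have lim: "(\<lambda>i. B0 * norm (restrict_vmeasure (A i) \<mu>)) \<longlonglongrightarrow> 0" by (simp add: measure_variation Ab)
    have "norm (n (A i)) \<le> B0 * norm (restrict_vmeasure (A i) \<mu>)" for i
      unfolding nr[OF Ab] by (rule norm_vintegral_le[OF g B0])
    then show "(\<lambda>i. n (A i)) \<longlonglongrightarrow> 0" by (intro Lim_null_comparison[OF always_eventually lim]) auto
  qed (auto simp: n_def)
  then have v: "vmeas (Abs_vmeasure n) = n" by (simp add: Abs_vmeasure_inverse)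
  have "density_vmeasure g \<mu> = Abs_vmeasure n"
    unfolding density_vmeasure_def
    by (rule the_equality) (auto simp: v n_def intro!: vmeasure_eqI)
  then have d: "vmeas (density_vmeasure g \<mu>) = n" by (simp add: v)
  show "vmeas (density_vmeasure g \<mu>) A = vintegral \<mu> (\<lambda>t. indicator A t * g t)" if "A \<in> sets borel"
    using that by (simp add: d n_def)
  show "norm (density_vmeasure g \<mu>) \<le> B * norm \<mu>" if "\<And>x. cmod (g x) \<le> B"
    by (rule norm_vmeasure_leI) (simp add: d mass[OF that])
qed

lemma bounded_linear_density:
  fixes g :: "'a::topological_space \<Rightarrow> complex"
  assumes g: "g \<in> bdd_borel"
  shows "bounded_linear (density_vmeasure g :: ('a, 'h::{complex_normed_vector, banach}) vmeasure \<Rightarrow> _)"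
proof -
  obtain B where B: "\<And>x. cmod (g x) \<le> B" using g unfolding bdd_borel_def by blast
  show ?thesis
  proof (rule bounded_linear_intro[of _ B])
    fix \<mu> \<nu> :: "('a, 'h) vmeasure" and r :: real
    show "density_vmeasure g (\<mu> + \<nu>) = density_vmeasure g \<mu> + density_vmeasure g \<nu>"
      by (rule vmeasure_eqI) (simp add: vmeas_density g vmeas_simps vintegral_add_measure bdd_borel_mult bdd_borel_indicator)
    show "density_vmeasure g (r *\<^sub>R \<mu>) = r *\<^sub>R density_vmeasure g \<mu>"
      by (rule vmeasure_eqI)
        (simp add: vmeas_density g vmeas_simps scaleR_scaleC vintegral_scaleC_measure bdd_borel_mult bdd_borel_indicator)
    show "norm (density_vmeasure g \<mu>) \<le> norm \<mu> * B" using norm_density_le[OF g B] by (simp add: mult.commute)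
  qed
qed

section \<open>The convolution algebra\<close>

lemma bounded_clinearD:
  assumes "bounded_clinear k"
  shows bounded_clinear_bounded_linear: "bounded_linear k"
    and bounded_clinear_scaleC: "k (c *\<^sub>C x) = c *\<^sub>C k x"
  using assms by (auto simp: bounded_clinear_def)

lemma bounded_clinear_compose:
  "bounded_clinear f \<Longrightarrow> bounded_clinear g \<Longrightarrow> bounded_clinear (\<lambda>x. f (g x))"
  by (auto simp: bounded_clinear_def intro: bounded_linear_compose)

lemma bounded_clinear_add:
  "bounded_clinear f \<Longrightarrow> bounded_clinear g \<Longrightarrow> bounded_clinear (\<lambda>x. f x + g x)"
  by (auto simp: bounded_clinear_def scaleC_add_right intro: bounded_linear_add)

lemma scaleC_diff_right: "c *\<^sub>C (x - y) = c *\<^sub>C x - c *\<^sub>C (y :: 'a::complex_normed_vector)"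
  by (rule linear_diff[OF bounded_linear.linear[OF bounded_linear_scaleC]])

lemma bounded_clinear_diff:
  "bounded_clinear f \<Longrightarrow> bounded_clinear g \<Longrightarrow> bounded_clinear (\<lambda>x. f x - g x)"
  by (auto simp: bounded_clinear_def scaleC_diff_right intro: bounded_linear_sub)

lemma bounded_clinear_sum:
  "(\<And>i. i \<in> I \<Longrightarrow> bounded_clinear (f i)) \<Longrightarrow> bounded_clinear (\<lambda>x. \<Sum>i\<in>I. f i x)"
  by (auto simp: bounded_clinear_def scaleC_sum_right intro: bounded_linear_sum)

lemma bounded_clinear_convolve:
  assumes "bounded_clinear k" shows "bounded_clinear (convolve k)"
  unfolding bounded_clinear_def
proof (intro conjI allI)
  show "bounded_linear (convolve k)"
    using assms by (intro bounded_linear_convolve bounded_clinear_bounded_linear)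
  fix c \<mu>
  show "convolve k (c *\<^sub>C \<mu>) = c *\<^sub>C convolve k \<mu>"
    by (rule ft_inject)
      (simp add: ft_convolve[OF assms] ft_scaleC bounded_clinear_scaleC[OF bounded_clinear_fourier[OF assms]])
qed

lemma bounded_clinear_conv_mult:
  "bounded_clinear k \<Longrightarrow> bounded_clinear l \<Longrightarrow> bounded_clinear (conv_mult k l)"
  unfolding conv_mult_def by (rule bounded_clinear_compose[OF bounded_clinear_convolve])

lemma fourier_conv_mult:
  "bounded_clinear k \<Longrightarrow> fourier (conv_mult k l) y h = fourier k y (fourier l y h)"
  by (simp only: fourier_eq_ft conv_mult_def ft_convolve)

text \<open>Associativity is read off on the Fourier side, where both sides apply the same two
  operators in turn; no measure on a product of three lines enters.\<close>

lemma convolve_convolve: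
  assumes "bounded_clinear k" "bounded_clinear l"
  shows "convolve k (convolve l \<mu>) = convolve (conv_mult k l) \<mu>"
  by (rule ft_inject) (simp add: ft_convolve assms bounded_clinear_conv_mult fourier_conv_mult)

lemma bounded_clinear_unit: "bounded_clinear conv_unit"
  unfolding conv_unit_def by (rule bounded_clinear_point_mass)

lemma convolve_unit: "convolve conv_unit \<mu> = \<mu>"
  by (rule ft_inject) (simp add: ft_convolve bounded_clinear_unit fourier_unit)

lemma fourier_add: "fourier (\<lambda>h. k h + l h) y h = fourier k y h + fourier l y h"
  by (simp add: fourier_eq_ft ft_add)

lemma convolve_add:
  assumes "bounded_clinear k" "bounded_clinear l"
  shows "convolve (\<lambda>h. k h + l h) \<mu> = convolve k \<mu> + convolve l \<mu>"
  by (rule ft_inject) (simp add: ft_convolve assms bounded_clinear_add fourier_add ft_add)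

lemma convolve_unit_right:
  assumes "bounded_clinear k" shows "convolve k (conv_unit h) = k h"
  by (rule ft_inject) (simp add: ft_convolve assms conv_unit_def ft_point_mass fourier_eq_ft echar_def)

section \<open>Translations and discretized convolution\<close>

definition shift :: "real \<Rightarrow> (real, 'h::complex_hilbert_space) vmeasure \<Rightarrow> (real, 'h) vmeasure"
  where "shift a = image_vmeasure (\<lambda>t. t + a)"

lemma ft_shift: "ft (shift a \<mu>) y = echar y a *\<^sub>C ft \<mu> y"
proof -
  have "ft (shift a \<mu>) y = vintegral \<mu> (\<lambda>t. echar y a * echar y t)"
    unfolding shift_def by (subst ft_image) (simp_all add: echar_add mult.commute)
  then show ?thesis by (simp add: vintegral_cmult bdd_borel_echar ft_def)
qed

lemma norm_shift_le: "norm (shift a \<mu>) \<le> norm \<mu>"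
  unfolding shift_def by (rule norm_image_le)

lemma bounded_linear_shift: "bounded_linear (shift a)"
  unfolding shift_def by (rule bounded_linear_image)

lemmas shift_diff = linear_diff[OF bounded_linear.linear[OF bounded_linear_shift]]

lemma shift_shift: "shift a (shift b \<mu>) = shift (a + b) \<mu>"
  by (rule ft_inject) (simp add: ft_shift scaleC_scaleC echar_add)

lemma convolve_point_mass:
  assumes "bounded_clinear k" shows "convolve k (point_mass x h) = shift x (k h)"
  by (rule ft_inject)
    (simp add: ft_convolve assms ft_point_mass ft_shift bounded_clinear_scaleC[OF bounded_clinear_fourier],
      simp add: fourier_eq_ft)

text \<open>A function with finitely many values pushes a measure forward to a finite sum of point
  masses. The partition \<open>r\<close> may be finer than the fibres of the function, so two
  discretizations can be written over one index set.\<close>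

lemma image_simple_refine:
  fixes \<mu> :: "(real, 'h::complex_hilbert_space) vmeasure"
  assumes r: "borel_partition r" and m: "(\<lambda>t. g (r t)) \<in> borel_measurable borel"
  shows "image_vmeasure (\<lambda>t. g (r t)) \<mu> = (\<Sum>j\<in>range r. point_mass (g j :: real) (vmeas \<mu> (r -` {j})))"
proof (rule ft_inject)
  fix y
  have fin: "finite (range r)" "\<And>j. r -` {j} \<in> sets borel" using r by (auto simp: borel_partition_def)
  let ?s = "\<lambda>t. echar y (g (r t))"
  have "?s \<in> bdd_borel" by (rule bdd_borel_compose[OF bdd_borel_echar m])
  moreover have "finite (range ?s)"
    by (rule finite_subset[of _ "(\<lambda>j. echar y (g j)) ` range r"]) (use fin in auto)
  ultimately have s: "simple_function borel ?s"
    by (intro simple_function_borel_measurable) (auto dest: bdd_borel_measurable)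
  have "ft (image_vmeasure (\<lambda>t. g (r t)) \<mu>) y = simple_vintegral \<mu> ?s"
    by (simp add: ft_image[OF m] vintegral_simple[OF s])
  also have "\<dots> = (\<Sum>j\<in>range r. echar y (g j) *\<^sub>C vmeas \<mu> (r -` {j}))"
    using simple_vintegral_refine[OF fin, of \<mu> "\<lambda>j. echar y (g j)"] by simp
  finally show "ft (image_vmeasure (\<lambda>t. g (r t)) \<mu>) y = ft (\<Sum>j\<in>range r. point_mass (g j) (vmeas \<mu> (r -` {j}))) y"
    by (simp add: ft_sum ft_point_mass)
qed

lemma simple_function_borel_partition: "simple_function borel d \<Longrightarrow> borel_partition d"
  using simple_function_range[of d] simple_function_fibre[of d] by (simp add: borel_partition_def)

text \<open>Convolving \<open>L\<close> with a point mass translates a value of \<open>L\<close>.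
  Passing from \<open>d\<close> to \<open>d'\<close> moves the value carried by each common cell by
  at most \<open>a\<close>, so the modulus \<open>c\<close> applies cell by cell, and the norms of
  the values on the cells add up to at most \<open>norm \<mu>\<close>.\<close>

lemma convolve_image_simple_close:
  fixes d d' :: "real \<Rightarrow> real" and L :: "'h::complex_hilbert_space \<Rightarrow> (real, 'h) vmeasure"
  assumes L: "bounded_clinear L" and d: "simple_function borel d" "simple_function borel d'"
    and a: "\<And>t. \<bar>d t - d' t\<bar> \<le> a"
    and c: "\<And>t h. \<bar>t\<bar> \<le> a \<Longrightarrow> norm (shift t (L h) - L h) \<le> c * norm h"
  shows "norm (convolve L (image_vmeasure d \<mu>) - convolve L (image_vmeasure d' \<mu>)) \<le> c * norm \<mu>"
proof -
  let ?r = "\<lambda>t. (d t, d' t)"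
  have r: "borel_partition ?r" by (intro borel_partition_pair simple_function_borel_partition d)
  have fin: "finite (range ?r)" and rb: "?r -` {j} \<in> sets borel" for j
    using r unfolding borel_partition_def by blast+
  note lin = bounded_linear.linear[OF bounded_linear_convolve[OF bounded_clinear_bounded_linear[OF L]]]
  \<comment> \<open>The sign of \<open>c\<close> follows from the hypothesis at \<open>t = 0\<close>
    as soon as H contains a nonzero vector; in the zero space both sides of the claim
    vanish.\<close>
  have c0: "c \<ge> 0 \<or> (\<forall>h::'h. h = 0)"
  proof (cases "\<exists>h::'h. h \<noteq> 0")
    case True
    then obtain h :: 'h where h: "h \<noteq> 0" by blast
    have "0 \<le> a" using a[of 0] by linarith
    then have "0 \<le> c * norm h" using c[of 0 h] order_trans[OF norm_ge_zero] by force
    then show ?thesis using h by (simp add: zero_le_mult_iff)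
  qed simp
  have eq: "convolve L (image_vmeasure d \<mu>) - convolve L (image_vmeasure d' \<mu>) =
    (\<Sum>j\<in>range ?r. shift (fst j) (L (vmeas \<mu> (?r -` {j}))) - shift (snd j) (L (vmeas \<mu> (?r -` {j}))))"
    using image_simple_refine[OF r, of fst \<mu>] image_simple_refine[OF r, of snd \<mu>]
      borel_measurable_simple_function[OF d(1)] borel_measurable_simple_function[OF d(2)]
    by (simp add: linear_sum[OF lin] convolve_point_mass L sum_subtractf)
  have "norm (convolve L (image_vmeasure d \<mu>) - convolve L (image_vmeasure d' \<mu>)) \<le> (\<Sum>j\<in>range ?r. c * norm (vmeas \<mu> (?r -` {j})))"
    unfolding eq
  proof (rule sum_norm_le)
    fix j assume j: "j \<in> range ?r"
    let ?h = "vmeas \<mu> (?r -` {j})"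
    have "shift (fst j) (L ?h) - shift (snd j) (L ?h) = shift (snd j) (shift (fst j - snd j) (L ?h) - L ?h)"
      by (simp add: shift_diff shift_shift)
    also have "norm \<dots> \<le> norm (shift (fst j - snd j) (L ?h) - L ?h)" by (rule norm_shift_le)
    also have "\<dots> \<le> c * norm ?h" using j a by (intro c) auto
    finally show "norm (shift (fst j) (L ?h) - shift (snd j) (L ?h)) \<le> c * norm ?h" .
  qed
  also have "\<dots> \<le> c * norm \<mu>"
  proof (cases "c \<ge> 0")
    case True
    then show ?thesis unfolding sum_distrib_left[symmetric] using fin rb
      by (intro mult_left_mono sum_norm_vmeas_le) (auto simp: disjoint_family_on_def)
  next
    case False
    then have h0: "h = 0" for h :: 'h using c0 by blast
    have "\<mu> = 0" by (rule vmeasure_eqI) (rule trans[OF h0 h0[symmetric]])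
    then show ?thesis by (simp add: vmeas_simps)
  qed
  finally show ?thesis .
qed

lemma uniform_simple_approx_real:
  fixes g :: "real \<Rightarrow> real"
  assumes "g \<in> borel_measurable borel" "\<And>t. \<bar>g t\<bar> \<le> G" "e > 0"
  obtains d where "simple_function borel d" "\<And>t. \<bar>d t - g t\<bar> \<le> e"
proof -
  have "(\<lambda>t. complex_of_real (g t)) \<in> bdd_borel"
    using assms by (intro bdd_borelI[of _ G]) auto
  then obtain s where s: "simple_function borel s" "\<And>t. cmod (s t - complex_of_real (g t)) \<le> e"
    using uniform_simple_approx[OF _ assms(3)] by blast
  have "simple_function borel (\<lambda>t. Re (s t))" using s(1) by (rule simple_function_compose1)
  moreover have "\<bar>Re (s t) - g t\<bar> \<le> e" for t
    using s(2)[of t] abs_Re_le_cmod[of "s t - complex_of_real (g t)"] by simp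
  ultimately show ?thesis using that by blast
qed

lemma echar_diff_le: "cmod (echar y s - echar y t) \<le> \<bar>y\<bar> * \<bar>s - t\<bar>"
proof -
  have "echar y s - echar y t = echar y t * (iexp (- (y * (s - t))) - 1)"
    by (simp add: echar_def exp_add[symmetric] algebra_simps)
  then have "cmod (echar y s - echar y t) = cmod (iexp (- (y * (s - t))) - 1)" by (simp add: norm_mult)
  also have "\<dots> \<le> \<bar>- (y * (s - t))\<bar>"
    using iexp_approx1[of "- (y * (s - t))" 0] by simp
  finally show ?thesis by (simp add: abs_mult)
qed

definition translation_continuous :: "('h::complex_hilbert_space \<Rightarrow> (real, 'h) vmeasure) \<Rightarrow> bool"
  where "translation_continuous L \<longleftrightarrow>
    (\<forall>e>0. \<exists>a>0. \<forall>t h. \<bar>t\<bar> \<le> a \<longrightarrow> norm (shift t (L h) - L h) \<le> e * norm h)"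

text \<open>Truncation is sharp here, so that truncated measures are restrictions;
  \<open>tightI\<close> passes to it from the continuous cutoff.\<close>

definition tight :: "('h::complex_hilbert_space \<Rightarrow> (real, 'h) vmeasure) \<Rightarrow> bool"
  where "tight L \<longleftrightarrow> (\<forall>e>0. \<exists>R>0. \<forall>h. norm (L h - restrict_vmeasure {-R..R} (L h)) \<le> e * norm h)"

lemma norm_ft_image_diff:
  fixes d g :: "real \<Rightarrow> real"
  assumes "g \<in> borel_measurable borel" "d \<in> borel_measurable borel" "\<And>t. \<bar>d t - g t\<bar> \<le> e"
  shows "norm (ft (image_vmeasure d \<mu>) y - ft (image_vmeasure g \<mu>) y) \<le> \<bar>y\<bar> * e * norm \<mu>"
proof -
  have b: "(\<lambda>t. echar y (f t)) \<in> bdd_borel" if "f \<in> borel_measurable borel" for f :: "real \<Rightarrow> real"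
    by (rule bdd_borel_compose[OF bdd_borel_echar that])
  have "vintegral \<mu> (\<lambda>t. echar y (d t)) = vintegral \<mu> (\<lambda>t. echar y (d t) - echar y (g t)) + vintegral \<mu> (\<lambda>t. echar y (g t))"
    using vintegral_add[OF bdd_borel_diff[OF b[OF assms(2)] b[OF assms(1)]] b[OF assms(1)], of \<mu>] by simp
  then have "ft (image_vmeasure d \<mu>) y - ft (image_vmeasure g \<mu>) y = vintegral \<mu> (\<lambda>t. echar y (d t) - echar y (g t))"
    by (simp add: ft_image assms)
  also have "norm \<dots> \<le> \<bar>y\<bar> * e * norm \<mu>"
    using order_trans[OF echar_diff_le mult_left_mono[OF assms(3)]]
    by (intro norm_vintegral_le bdd_borel_diff b assms) auto
  finally show ?thesis .
qed

text \<open>The estimate for simple functions makes the convolutions with finer and finer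
  discretizations a Cauchy sequence; its limit is identified by its Fourier transform.\<close>

lemma convolve_image_close:
  fixes d g :: "real \<Rightarrow> real" and L :: "'h::complex_hilbert_space \<Rightarrow> (real, 'h) vmeasure"
  assumes L: "bounded_clinear L" and tc: "translation_continuous L"
    and g: "g \<in> borel_measurable borel" "\<And>t. \<bar>g t\<bar> \<le> G"
    and d: "simple_function borel d" "\<And>t. \<bar>d t - g t\<bar> \<le> a" and "a > 0"
    and c: "\<And>t h. \<bar>t\<bar> \<le> 2 * a \<Longrightarrow> norm (shift t (L h) - L h) \<le> c * norm h"
  shows "norm (convolve L (image_vmeasure g \<mu>) - convolve L (image_vmeasure d \<mu>)) \<le> c * norm \<mu>"
proof -
  \<comment> \<open>The errors are at most \<open>a\<close> from the start, so each
    \<open>s n\<close> stays within \<open>2 * a\<close> of \<open>d\<close>, the range in which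
    \<open>c\<close> is valid.\<close>
  have "\<forall>n. \<exists>s. simple_function borel s \<and> (\<forall>t. \<bar>s t - g t\<bar> \<le> a * inverse (real (Suc n)))"
    using uniform_simple_approx_real[OF g, of "a * inverse (real (Suc _))"] \<open>a > 0\<close>
    by (metis inverse_positive_iff_positive mult_pos_pos of_nat_0_less_iff zero_less_Suc)
  then obtain s where s: "\<And>n. simple_function borel (s n)"
    "\<And>n t. \<bar>s n t - g t\<bar> \<le> a * inverse (real (Suc n))" by metis
  define N where "N n = convolve L (image_vmeasure (s n) \<mu>)" for n
  have lim0: "(\<lambda>n. a * inverse (real (Suc n))) \<longlonglongrightarrow> 0"
    using tendsto_mult_left[OF LIMSEQ_inverse_real_of_nat, of a] by simp
  have "Cauchy N"
  proof (rule metric_CauchyI)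
    fix e :: real assume e: "e > 0"
    define e' where "e' = e / (norm \<mu> + 1)"
    have n: "norm \<mu> + 1 > 0" by (simp add: add_nonneg_pos)
    then have e': "e' > 0" using e by (simp add: e'_def)
    have "e' * norm \<mu> < e' * (norm \<mu> + 1)" using e' by simp
    also have "\<dots> = e" using n by (simp add: e'_def)
    finally have e'\<mu>: "e' * norm \<mu> < e" .
    obtain b where b: "b > 0" "\<And>t h. \<bar>t\<bar> \<le> b \<Longrightarrow> norm (shift t (L h) - L h) \<le> e' * norm h"
      using tc e' unfolding translation_continuous_def by blast
    have "\<forall>\<^sub>F n in sequentially. a * inverse (real (Suc n)) < b/2"
      using order_tendstoD(2)[OF lim0, of "b/2"] b(1) by simp
    then obtain n0 where n0: "\<And>n. n \<ge> n0 \<Longrightarrow> a * inverse (real (Suc n)) < b/2"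
      by (auto simp: eventually_sequentially)
    have "dist (N m) (N n) < e" if "m \<ge> n0" "n \<ge> n0" for m n
    proof -
      have "\<bar>s m t - s n t\<bar> \<le> b" for t
        using s(2)[of m t] s(2)[of n t] n0[OF that(1)] n0[OF that(2)] by linarith
      from convolve_image_simple_close[OF L s(1) s(1) this b(2)]
      have "norm (N m - N n) \<le> e' * norm \<mu>" by (simp add: N_def)
      then show ?thesis using e'\<mu> by (simp add: dist_norm)
    qed
    then show "\<exists>n0. \<forall>m\<ge>n0. \<forall>n\<ge>n0. dist (N m) (N n) < e" by blast
  qed
  then obtain \<nu> where \<nu>: "N \<longlonglongrightarrow> \<nu>" using Cauchy_convergent convergent_def by blast
  \<comment> \<open>The image measures themselves need not converge in norm; only their transforms
    converge, at each frequency.\<close>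
  have "\<nu> = convolve L (image_vmeasure g \<mu>)"
  proof (rule ft_inject)
    fix y
    have "(\<lambda>n. ft (image_vmeasure (s n) \<mu>) y - ft (image_vmeasure g \<mu>) y) \<longlonglongrightarrow> 0"
    proof (rule Lim_null_comparison)
      show "\<forall>\<^sub>F n in sequentially. norm (ft (image_vmeasure (s n) \<mu>) y - ft (image_vmeasure g \<mu>) y) \<le>
        \<bar>y\<bar> * (a * inverse (real (Suc n))) * norm \<mu>"
        using s by (intro always_eventually allI norm_ft_image_diff g) (auto intro: borel_measurable_simple_function)
      show "(\<lambda>n. \<bar>y\<bar> * (a * inverse (real (Suc n))) * norm \<mu>) \<longlonglongrightarrow> 0"
        using tendsto_mult_right[OF tendsto_mult_left[OF lim0, of "\<bar>y\<bar>"], of "norm \<mu>"] by simp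
    qed
    then have "(\<lambda>n. ft (image_vmeasure (s n) \<mu>) y) \<longlonglongrightarrow> ft (image_vmeasure g \<mu>) y" by (rule LIM_zero_cancel)
    then have "(\<lambda>n. fourier L y (ft (image_vmeasure (s n) \<mu>) y)) \<longlonglongrightarrow> fourier L y (ft (image_vmeasure g \<mu>) y)"
      by (rule bounded_linear.tendsto[OF bounded_clinear_bounded_linear[OF bounded_clinear_fourier[OF L]]])
    then have "(\<lambda>n. ft (N n) y) \<longlonglongrightarrow> ft (convolve L (image_vmeasure g \<mu>)) y"
      by (simp add: N_def ft_convolve L)
    moreover have "(\<lambda>n. ft (N n) y) \<longlonglongrightarrow> ft \<nu> y" by (rule bounded_linear.tendsto[OF bounded_linear_ft \<nu>])
    ultimately show "ft \<nu> y = ft (convolve L (image_vmeasure g \<mu>)) y" using LIMSEQ_unique by blast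
  qed
  with \<nu> have lim: "(\<lambda>n. norm (N n - convolve L (image_vmeasure d \<mu>))) \<longlonglongrightarrow> norm (convolve L (image_vmeasure g \<mu>) - convolve L (image_vmeasure d \<mu>))"
    by (intro tendsto_intros) simp
  have "norm (N n - convolve L (image_vmeasure d \<mu>)) \<le> c * norm \<mu>" for n
  proof -
    have "inverse (real (Suc n)) \<le> 1" by (simp add: inverse_le_1_iff)
    then have "a * inverse (real (Suc n)) \<le> a" using \<open>a > 0\<close> by (simp add: mult_left_le)
    then have "\<bar>s n t - d t\<bar> \<le> 2 * a" for t using s(2)[of n t] d(2)[of t] by linarith
    from convolve_image_simple_close[OF L s(1) d(1) this c] show ?thesis by (simp add: N_def)
  qed
  then show ?thesis by (intro LIMSEQ_le_const2[OF lim]) auto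
qed

text \<open>Tightness reduces the question to \<open>{-R..R}\<close>, where two characters differ by
  at most \<open>R * \<bar>y - y'\<bar>\<close>. The two truncation errors and the main term are
  allotted \<open>e/4\<close>, \<open>e/4\<close> and \<open>e/2\<close>.\<close>

lemma fourier_uniformly_continuous:
  fixes L :: "'h::complex_hilbert_space \<Rightarrow> (real, 'h) vmeasure"
  assumes L: "bounded_clinear L" and "tight L" "e > 0"
  obtains \<delta> where "\<delta> > 0"
    "\<And>y y' h. \<bar>y - y'\<bar> \<le> \<delta> \<Longrightarrow> norm (fourier L y h - fourier L y' h) \<le> e * norm h"
proof -
  have bl: "bounded_linear L" using L by (rule bounded_clinear_bounded_linear)
  obtain R where R: "R > 0" "\<And>h. norm (L h - restrict_vmeasure {-R..R} (L h)) \<le> e/4 * norm h"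
    using assms(2,3) unfolding tight_def by (metis divide_pos_pos zero_less_numeral)
  define \<delta> where "\<delta> = e / 2 / (R * (onorm L + 1))"
  have o: "onorm L \<ge> 0" by (rule onorm_pos_le[OF bl])
  have \<delta>: "\<delta> > 0" "\<delta> * R * (onorm L + 1) = e/2" 
  proof -
    have "R * (onorm L + 1) > 0" using R(1) o by simp
    then show "\<delta> > 0" "\<delta> * R * (onorm L + 1) = e/2"
      using assms(3) unfolding mult.assoc by (auto simp: \<delta>_def simp del: divide_divide_eq_left)
  qed
  have "norm (fourier L y h - fourier L y' h) \<le> e * norm h" if y: "\<bar>y - y'\<bar> \<le> \<delta>" for y y' h
  proof -
    let ?E = "{-R..R}" and ?\<mu> = "restrict_vmeasure {-R..R} (L h)"
    have "norm (ft ?\<mu> y - ft ?\<mu> y') \<le> (\<delta> * R) * norm ?\<mu>"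
    proof -
      have "ft ?\<mu> y = vintegral ?\<mu> (\<lambda>t. echar y t - echar y' t) + ft ?\<mu> y'"
        using vintegral_add[OF bdd_borel_diff[OF bdd_borel_echar[of y] bdd_borel_echar[of y']] bdd_borel_echar[of y'], of ?\<mu>]
        by (simp add: ft_def)
      then have "ft ?\<mu> y - ft ?\<mu> y' = vintegral ?\<mu> (\<lambda>t. echar y t - echar y' t)" by simp
      also have "norm \<dots> \<le> (\<delta> * R) * norm ?\<mu>"
      proof (rule norm_vintegral_restrict_le)
        fix t assume t: "t \<in> ?E"
        have "cmod (echar y t - echar y' t) = cmod (echar t y - echar t y')" by (simp add: echar_def mult_ac)
        also have "\<dots> \<le> \<bar>t\<bar> * \<bar>y - y'\<bar>" by (rule echar_diff_le)
        also have "\<dots> \<le> R * \<delta>" using t y R(1) by (intro mult_mono) auto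
        finally show "cmod (echar y t - echar y' t) \<le> \<delta> * R" by (simp add: mult.commute)
      qed (use \<delta> R in \<open>auto intro: bdd_borel_diff bdd_borel_echar\<close>)
      finally show ?thesis .
    qed
    also have "\<dots> \<le> (\<delta> * R) * ((onorm L + 1) * norm h)"
    proof (intro mult_left_mono)
      have "norm ?\<mu> \<le> norm (L h)" by (rule norm_restrict_le)
      also have "\<dots> \<le> onorm L * norm h" by (rule onorm[OF bl])
      finally show "norm ?\<mu> \<le> (onorm L + 1) * norm h" by (simp add: distrib_right add_increasing2)
    qed (use \<delta> R in auto)
    also have "\<dots> = e/2 * norm h" unfolding mult.assoc[symmetric] \<delta>(2) ..
    finally have 1: "norm (ft ?\<mu> y - ft ?\<mu> y') \<le> e/2 * norm h" .
    have 2: "norm (ft (L h) z - ft ?\<mu> z) \<le> e/4 * norm h" for z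
      using norm_ft_le[of "L h - ?\<mu>" z] R(2)[of h] by (simp add: ft_diff)
    have "fourier L y h - fourier L y' h = (ft (L h) y - ft ?\<mu> y) + (ft ?\<mu> y - ft ?\<mu> y') - (ft (L h) y' - ft ?\<mu> y')"
      by (simp add: fourier_eq_ft)
    also have "norm \<dots> \<le> (e/4 * norm h + e/2 * norm h) + e/4 * norm h"
      using 1 2 by (meson add_mono norm_triangle_le norm_triangle_le_diff)
    finally show ?thesis by (simp add: algebra_simps)
  qed
  with \<delta>(1) show ?thesis using that by blast
qed

text \<open>The measure \<open>L h\<close> is truncated to \<open>{-R..R}\<close> and its positions
  are rounded down to multiples of \<open>b\<close>. Rounding need not change \<open>L h\<close> by
  little in norm, but its effect is small after one more convolution with \<open>L\<close>, and on
  the Fourier side at bounded frequencies. Both kinds of closeness are needed at the same time, for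
  the same discretization.\<close>

lemma lattice_approx:
  fixes L :: "'h::complex_hilbert_space \<Rightarrow> (real, 'h) vmeasure"
  assumes L: "bounded_clinear L" and tc: "translation_continuous L" and "tight L" "e > 0"
  obtains b0 where "b0 > 0"
    "\<And>b. 0 < b \<Longrightarrow> b \<le> b0 \<Longrightarrow> \<exists>D T. finite D \<and> (\<forall>x\<in>D. \<exists>n::int. x = of_int n * b) \<and>
      (\<forall>x. bounded_clinear (T x)) \<and>
      (\<forall>h. norm (convolve L (L h - (\<Sum>x\<in>D. point_mass x (T x h)))) \<le> e * norm h) \<and>
      (\<forall>y h. \<bar>y\<bar> \<le> Y \<longrightarrow> norm (fourier L y h - fourier (\<lambda>h. \<Sum>x\<in>D. point_mass x (T x h)) y h) \<le> e * norm h)"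
proof -
  have bl: "bounded_linear L" using L by (rule bounded_clinear_bounded_linear)
  define M where "M = onorm L + 1"
  have M: "M \<ge> 1" "onorm L \<le> M" using onorm_pos_le[OF bl] by (auto simp: M_def)
  have LM: "norm (L h) \<le> M * norm h" for h
    using onorm[OF bl, of h] mult_right_mono[OF M(2), of "norm h"] by simp
  \<comment> \<open>Truncation and rounding each cost \<open>M * e1\<close>, that is
    \<open>e/2\<close>, after the convolution with \<open>L\<close>.\<close>
  define e1 where "e1 = e / (2 * M)"
  have e1: "e1 > 0" "M * e1 = e/2" "e1 \<le> e/2" using M assms(4) by (auto simp: e1_def field_simps)
  obtain R where R: "R > 0" "\<And>h. norm (L h - restrict_vmeasure {-R..R} (L h)) \<le> e1 * norm h"
    using assms(3) e1 unfolding tight_def by blast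
  obtain a where a: "a > 0" "\<And>t h. \<bar>t\<bar> \<le> a \<Longrightarrow> norm (shift t (L h) - L h) \<le> e1 * norm h"
    using tc e1 unfolding translation_continuous_def by blast
  \<comment> \<open>The first bound keeps translations by up to \<open>2 * b\<close> within the
    modulus of continuity \<open>a\<close>; the second keeps the change
    \<open>\<bar>y\<bar> * b\<close> of a character below \<open>e1\<close> for frequencies up to
    \<open>Y\<close>.\<close>
  define b0 where "b0 = min (a/2) (e1 / (\<bar>Y\<bar> + 1))"
  have b0: "b0 > 0" using a e1 by (simp add: b0_def)
  show ?thesis
  proof (rule that[OF b0])
    fix b :: real assume b: "0 < b" "b \<le> b0"
    have ba: "2 * b \<le> a" and bY: "(\<bar>Y\<bar> + 1) * b \<le> e1"
      using b by (auto simp: b0_def pos_le_divide_eq add_nonneg_pos mult.commute)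
    let ?E = "{-R..R}"
    \<comment> \<open>The identity on the interval and zero outside: bounded, hence fit for
      discretization, and without effect on measures restricted to the interval.\<close>
    define g where "g t = t * indicator ?E t" for t :: real
    define d where "d t = b * of_int \<lfloor>g t / b\<rfloor>" for t
    have [measurable]: "g \<in> borel_measurable borel" unfolding g_def[abs_def] by simp
    have dm: "d \<in> borel_measurable borel" unfolding d_def[abs_def] by simp
    have gR: "\<bar>g t\<bar> \<le> R" for t using R(1) by (auto simp: g_def indicator_def)
    have dg: "\<bar>d t - g t\<bar> \<le> b" for t
    proof -
      have "\<bar>of_int \<lfloor>g t / b\<rfloor> - g t / b\<bar> \<le> 1" by linarith
      then have "b * \<bar>of_int \<lfloor>g t / b\<rfloor> - g t / b\<bar> \<le> b" using b by (simp add: mult_left_le)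
      also have "b * \<bar>of_int \<lfloor>g t / b\<rfloor> - g t / b\<bar> = \<bar>b * (of_int \<lfloor>g t / b\<rfloor> - g t / b)\<bar>" using b by (simp add: abs_mult)
      finally show ?thesis using b by (simp add: d_def right_diff_distrib)
    qed
    define N where "N = \<lceil>R / b\<rceil> + 1"
    have "range d \<subseteq> (\<lambda>n. b * of_int n) ` {-N..N}"
    proof
      fix x assume "x \<in> range d"
      then obtain t where t: "x = d t" by blast
      have "\<bar>g t / b\<bar> \<le> R / b" using gR[of t] b by (simp add: divide_right_mono)
      then have "\<lfloor>g t / b\<rfloor> \<in> {-N..N}" unfolding N_def atLeastAtMost_iff by linarith
      then show "x \<in> (\<lambda>n. b * of_int n) ` {-N..N}" by (auto simp: t d_def)
    qed
    then have fin: "finite (range d)" by (rule finite_subset) simp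
    then have sd: "simple_function borel d" using dm by (intro simple_function_borel_measurable) auto
    have pd: "borel_partition d" by (rule simple_function_borel_partition[OF sd])
    define T where "T x h = vmeas (restrict_vmeasure ?E (L h)) (d -` {x})" for x h
    have T: "bounded_clinear (T x)" for x
      unfolding bounded_clinear_def T_def
    proof (intro conjI allI)
      show "bounded_linear (\<lambda>h. vmeas (restrict_vmeasure ?E (L h)) (d -` {x}))"
        by (intro bounded_linear_compose[OF bounded_linear_vmeas]
            bounded_linear_compose[OF bounded_linear_restrict] bl)
    qed (simp add: bounded_clinear_scaleC[OF L] restrict_scaleC vmeas_simps)
    define l where "l h = (\<Sum>x\<in>range d. point_mass x (T x h))" for h
    have l: "l h = image_vmeasure d (restrict_vmeasure ?E (L h))" for h
      using image_simple_refine[OF pd, of "\<lambda>x. x" "restrict_vmeasure ?E (L h)"] dm by (simp add: l_def T_def)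
    have gid: "image_vmeasure g (restrict_vmeasure ?E \<mu>) = restrict_vmeasure ?E \<mu>" for \<mu> :: "(real, 'h) vmeasure"
    proof (rule vmeasure_eqI)
      fix A :: "real set" assume A: "A \<in> sets borel"
      have "g -` A \<in> sets borel" using measurable_sets[OF \<open>g \<in> borel_measurable borel\<close> A] by simp
      moreover have "?E \<inter> g -` A = ?E \<inter> A" by (auto simp: g_def)
      ultimately show "vmeas (image_vmeasure g (restrict_vmeasure ?E \<mu>)) A = vmeas (restrict_vmeasure ?E \<mu>) A"
        using A by (simp add: vmeas_image vmeas_restrict)
    qed
    have rM: "norm (restrict_vmeasure ?E (L h)) \<le> M * norm h" for h
      using norm_restrict_le LM order_trans by blast
    have lin: "linear (convolve L)" by (intro bounded_linear.linear bounded_linear_convolve bl)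
    have 1: "norm (convolve L (L h - l h)) \<le> e * norm h" for h
    proof -
      let ?\<mu> = "restrict_vmeasure ?E (L h)"
      have "norm (convolve L (L h - ?\<mu>)) \<le> onorm L * norm (L h - ?\<mu>)" by (rule norm_convolve_le[OF bl])
      also have "\<dots> \<le> M * (e1 * norm h)" using M R(2) by (intro mult_mono) auto
      finally have 1: "norm (convolve L (L h - ?\<mu>)) \<le> M * e1 * norm h" by simp
      have "norm (convolve L (image_vmeasure g ?\<mu>) - convolve L (image_vmeasure d ?\<mu>)) \<le> e1 * norm ?\<mu>"
        using a(2) ba by (intro convolve_image_close[OF L tc _ gR sd dg b(1)]) auto
      also have "\<dots> \<le> e1 * (M * norm h)" using e1 rM by (intro mult_left_mono) auto
      finally have 2: "norm (convolve L ?\<mu> - convolve L (l h)) \<le> M * e1 * norm h" by (simp add: gid l mult_ac)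
      have "convolve L (L h - l h) = convolve L (L h - ?\<mu>) + (convolve L ?\<mu> - convolve L (l h))"
        by (simp add: linear_diff[OF lin])
      also have "norm \<dots> \<le> M * e1 * norm h + M * e1 * norm h" using 1 2 by (rule norm_triangle_mono)
      finally show ?thesis unfolding e1(2) by (simp add: algebra_simps)
    qed
    have 2: "norm (fourier L y h - fourier l y h) \<le> e * norm h" if y: "\<bar>y\<bar> \<le> Y" for y h
    proof -
      let ?\<mu> = "restrict_vmeasure ?E (L h)"
      have "norm (ft (L h) y - ft ?\<mu> y) \<le> e1 * norm h"
        using norm_ft_le[of "L h - ?\<mu>" y] R(2)[of h] by (simp add: ft_diff)
      also have "\<dots> \<le> e/2 * norm h" using e1 by (intro mult_right_mono) auto
      finally have 1: "norm (ft (L h) y - ft ?\<mu> y) \<le> e/2 * norm h" .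
      have "norm (ft (image_vmeasure d ?\<mu>) y - ft (image_vmeasure g ?\<mu>) y) \<le> \<bar>y\<bar> * b * norm ?\<mu>"
        by (rule norm_ft_image_diff[OF _ dm dg]) simp
      also have "\<dots> \<le> e1 * (M * norm h)"
      proof (intro mult_mono rM)
        have "\<bar>y\<bar> * b \<le> (\<bar>Y\<bar> + 1) * b" using y b by (intro mult_right_mono) auto
        with bY show "\<bar>y\<bar> * b \<le> e1" by simp
      qed (use e1 in auto)
      finally have 2: "norm (ft ?\<mu> y - ft (l h) y) \<le> e/2 * norm h"
        using e1(2) by (simp add: gid l norm_minus_commute mult.assoc[symmetric] mult.commute)
      have "fourier L y h - fourier l y h = (ft (L h) y - ft ?\<mu> y) + (ft ?\<mu> y - ft (l h) y)"
        by (simp add: fourier_eq_ft)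
      also have "norm \<dots> \<le> e/2 * norm h + e/2 * norm h" using 1 2 by (rule norm_triangle_mono)
      finally show ?thesis by simp
    qed
    have "\<exists>n::int. x = of_int n * b" if "x \<in> range d" for x using that by (auto simp: d_def mult.commute)
    with fin T 1 2 show "\<exists>D T. finite D \<and> (\<forall>x\<in>D. \<exists>n::int. x = of_int n * b) \<and>
      (\<forall>x. bounded_clinear (T x)) \<and>
      (\<forall>h. norm (convolve L (L h - (\<Sum>x\<in>D. point_mass x (T x h)))) \<le> e * norm h) \<and>
      (\<forall>y h. \<bar>y\<bar> \<le> Y \<longrightarrow> norm (fourier L y h - fourier (\<lambda>h. \<Sum>x\<in>D. point_mass x (T x h)) y h) \<le> e * norm h)"
      unfolding l_def[abs_def] by (intro exI[of _ "range d"] exI[of _ T] conjI) blast+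
  qed
qed

section \<open>Right inverses modulo a translation action\<close>

notation blinfun_compose (infixl \<open>\<odot>\<close> 78)

lemma blinfun_compose_bilinear:
  "A \<odot> (B + C) = A \<odot> B + A \<odot> C" "(A + B) \<odot> C = A \<odot> C + B \<odot> C"
  "A \<odot> (B - C) = A \<odot> B - A \<odot> C" "(A - B) \<odot> C = A \<odot> C - B \<odot> C"
  "A \<odot> (- B) = - (A \<odot> B)" "(- A) \<odot> B = - (A \<odot> B)"
  "A \<odot> (r *\<^sub>R B) = r *\<^sub>R (A \<odot> B)" "(r *\<^sub>R A) \<odot> B = r *\<^sub>R (A \<odot> B)"
  "A \<odot> (B \<odot> C) = (A \<odot> B) \<odot> C" "A \<odot> id_blinfun = A" "id_blinfun \<odot> A = A"
  by (auto intro!: blinfun_eqI simp: blinfun.bilinear_simps)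

lemma blinfun_compose_sum_left: "(\<Sum>i\<in>I. A i) \<odot> B = (\<Sum>i\<in>I. A i \<odot> B)"
  by (rule blinfun_eqI) (simp add: blinfun.sum_left)

lemma blinfun_compose_sum_right: "A \<odot> (\<Sum>i\<in>I. B i) = (\<Sum>i\<in>I. A \<odot> B i)"
  by (rule blinfun_eqI) (simp add: blinfun.sum_left blinfun.sum_right)

lemma right_inverse_near_id:
  fixes A :: "'x::banach \<Rightarrow>\<^sub>L 'x"
  assumes "norm (id_blinfun - A) < 1"
  obtains B where "A \<odot> B = id_blinfun"
proof -
  define E where "E = id_blinfun - A"
  define e where "e n = ((\<odot>) E ^^ n) id_blinfun" for n
  have e_Suc: "e (Suc n) = E \<odot> e n" for n by (simp add: e_def)
  have ne: "norm (e n) \<le> norm E ^ n" for n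
  proof (induction n)
    case 0
    then show ?case by (simp add: e_def norm_blinfun_id_le)
  next
    case (Suc n)
    have "norm (e (Suc n)) \<le> norm E * norm (e n)" unfolding e_Suc by (rule norm_blinfun_compose)
    also have "\<dots> \<le> norm E * norm E ^ n" using Suc by (rule mult_left_mono) simp
    finally show ?case by simp
  qed
  have s: "summable e"
    by (rule summable_comparison_test'[OF summable_geometric[of "norm E"] ne]) (use assms in \<open>simp add: E_def\<close>)
  have "E \<odot> suminf e = (\<Sum>n. E \<odot> e n)"
    by (rule bounded_linear.suminf[OF bounded_bilinear.bounded_linear_right[OF bounded_bilinear_blinfun_compose] s, of E])
  also have "\<dots> = suminf e - e 0" unfolding e_Suc[symmetric] using suminf_split_head[OF s] by simp
  finally have "A \<odot> suminf e = id_blinfun"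
    by (simp add: E_def e_def blinfun_compose_bilinear algebra_simps)
  then show ?thesis using that by blast
qed

text \<open>\<open>quot_norm F G\<close> is the norm of \<open>G\<close> modulo the right ideal generated by \<open>F\<close>.\<close>

definition quot_norm :: "('x::real_normed_vector \<Rightarrow>\<^sub>L 'x) \<Rightarrow> ('x \<Rightarrow>\<^sub>L 'x) \<Rightarrow> real"
  where "quot_norm F G = Inf (range (\<lambda>Y :: 'x \<Rightarrow>\<^sub>L 'x. norm (G - F \<odot> Y)))"

text \<open>The norm of the map \<open>G \<mapsto> Q \<odot> G\<close> into the quotient. Estimates
  are proved by testing one \<open>G\<close> at a time, which allows \<open>G\<close> to be
  rewritten before \<open>Q\<close> is applied.\<close>

definition quot_onorm :: "('x::real_normed_vector \<Rightarrow>\<^sub>L 'x) \<Rightarrow> ('x \<Rightarrow>\<^sub>L 'x) \<Rightarrow> real"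
  where "quot_onorm F Q = (SUP G\<in>cball 0 1. quot_norm F (Q \<odot> G))"

lemma bdd_below_quot: "bdd_below (range (\<lambda>Y. norm (G - F \<odot> Y)))"
  by (rule bdd_belowI[of _ 0]) auto

lemma quot_norm_le: "quot_norm F G \<le> norm (G - F \<odot> Y)"
  unfolding quot_norm_def by (rule cINF_lower[OF bdd_below_quot]) simp

lemma quot_norm_lessD: "quot_norm F G < e \<Longrightarrow> \<exists>Y. norm (G - F \<odot> Y) < e"
  unfolding quot_norm_def by (subst (asm) cINF_less_iff[OF _ bdd_below_quot]) auto

lemma quot_norm_le_norm: "quot_norm F G \<le> norm G"
  using quot_norm_le[of F G 0] by simp

lemma quot_norm_nonneg: "0 \<le> quot_norm F G"
  unfolding quot_norm_def by (rule cINF_greatest) auto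

lemma quot_norm_leI: "(\<And>e. e > 0 \<Longrightarrow> \<exists>Y. norm (G - F \<odot> Y) < b + e) \<Longrightarrow> quot_norm F G \<le> b"
  by (rule field_le_epsilon) (meson less_imp_le order_trans quot_norm_le)

lemma quot_norm_add: "quot_norm F (G + H) \<le> quot_norm F G + quot_norm F H"
proof (rule quot_norm_leI)
  fix e :: real assume e: "e > 0"
  obtain Y where Y: "norm (G - F \<odot> Y) < quot_norm F G + e/2"
    using quot_norm_lessD[of F G "quot_norm F G + e/2"] e by auto
  obtain Z where Z: "norm (H - F \<odot> Z) < quot_norm F H + e/2"
    using quot_norm_lessD[of F H "quot_norm F H + e/2"] e by auto
  have "G + H - F \<odot> (Y + Z) = (G - F \<odot> Y) + (H - F \<odot> Z)" by (simp add: blinfun_compose_bilinear)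
  then have "norm (G + H - F \<odot> (Y + Z)) \<le> norm (G - F \<odot> Y) + norm (H - F \<odot> Z)"
    using norm_triangle_ineq[of "G - F \<odot> Y" "H - F \<odot> Z"] by metis
  then have "norm (G + H - F \<odot> (Y + Z)) < quot_norm F G + quot_norm F H + e" using Y Z by linarith
  then show "\<exists>Y. norm (G + H - F \<odot> Y) < quot_norm F G + quot_norm F H + e" by blast
qed

text \<open>With \<open>F = id_blinfun + L\<close>, \<open>Z = X\<close> and
  \<open>G = - (L \<odot> X)\<close> this is the rule by which \<open>X\<close> is traded for
  \<open>- (L \<odot> X)\<close>.\<close>

lemma quot_norm_ideal: "quot_norm F (F \<odot> Z + G) \<le> quot_norm F G"
proof (rule quot_norm_leI)
  fix e :: real assume e: "e > 0"
  obtain Y where Y: "norm (G - F \<odot> Y) < quot_norm F G + e"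
    using quot_norm_lessD[of F G "quot_norm F G + e"] e by auto
  have "F \<odot> Z + G - F \<odot> (Z + Y) = G - F \<odot> Y" by (simp add: blinfun_compose_bilinear)
  with Y show "\<exists>Y. norm (F \<odot> Z + G - F \<odot> Y) < quot_norm F G + e" by metis
qed

lemma quot_norm_scaleR: "quot_norm F (r *\<^sub>R G) \<le> \<bar>r\<bar> * quot_norm F G"
proof (rule quot_norm_leI)
  fix e :: real assume e: "e > 0"
  define d where "d = e / (\<bar>r\<bar> + 1)"
  have d: "d > 0" "(\<bar>r\<bar> + 1) * d = e" using e by (auto simp: d_def add_nonneg_pos less_imp_neq[symmetric])
  obtain Y where Y: "norm (G - F \<odot> Y) < quot_norm F G + d"
    using quot_norm_lessD[of F G "quot_norm F G + d"] d by auto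
  have "r *\<^sub>R G - F \<odot> (r *\<^sub>R Y) = r *\<^sub>R (G - F \<odot> Y)"
    by (simp add: blinfun_compose_bilinear scaleR_diff_right)
  then have "norm (r *\<^sub>R G - F \<odot> (r *\<^sub>R Y)) \<le> \<bar>r\<bar> * (quot_norm F G + d)"
    using Y by (simp add: mult_left_mono)
  also have "\<dots> < \<bar>r\<bar> * quot_norm F G + e" using d by (simp add: algebra_simps)
  finally show "\<exists>Y. norm (r *\<^sub>R G - F \<odot> Y) < \<bar>r\<bar> * quot_norm F G + e" by blast
qed

lemma quot_onorm_bdd:
  fixes Q :: "'a::real_normed_vector \<Rightarrow>\<^sub>L 'a"
  shows "bdd_above ((\<lambda>G. quot_norm F (Q \<odot> G)) ` cball 0 1)"
proof (rule bdd_aboveI2)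
  fix G assume "G \<in> cball (0 :: 'a \<Rightarrow>\<^sub>L 'a) 1"
  then show "quot_norm F (Q \<odot> G) \<le> norm Q"
    using order_trans[OF quot_norm_le_norm norm_blinfun_compose, of F Q G] mult_left_le[of "norm G" "norm Q"]
    by simp
qed

lemma quot_onorm_leI:
  assumes "\<And>G. norm G \<le> 1 \<Longrightarrow> quot_norm F (Q \<odot> G) \<le> c"
  shows "quot_onorm F Q \<le> c"
  unfolding quot_onorm_def by (rule cSUP_least) (use assms in auto)

lemma quot_norm_le_onorm: "quot_norm F (Q \<odot> G) \<le> quot_onorm F Q * norm G"
proof (cases "G = 0")
  case True
  then show ?thesis using quot_norm_le_norm[of F 0] by simp
next
  case False
  let ?G = "(1 / norm G) *\<^sub>R G"
  have "quot_norm F (Q \<odot> ?G) \<le> quot_onorm F Q"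
    unfolding quot_onorm_def by (rule cSUP_upper[OF _ quot_onorm_bdd]) (use False in auto)
  then have "norm G * quot_norm F (Q \<odot> ?G) \<le> norm G * quot_onorm F Q" by (rule mult_left_mono) simp
  moreover have "Q \<odot> G = norm G *\<^sub>R (Q \<odot> ?G)" using False by (simp add: blinfun_compose_bilinear)
  ultimately show ?thesis
    using quot_norm_scaleR[of F "norm G" "Q \<odot> ?G"] by (simp add: mult.commute)
qed

lemma quot_onorm_nonneg: "0 \<le> quot_onorm F Q"
proof -
  have "quot_norm F (Q \<odot> 0) \<le> quot_onorm F Q"
    unfolding quot_onorm_def by (rule cSUP_upper[OF _ quot_onorm_bdd]) simp
  then show ?thesis using quot_norm_nonneg[of F "Q \<odot> 0"] by linarith
qed

lemma quot_onorm_le_norm: "quot_onorm F Q \<le> norm Q"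
proof (rule quot_onorm_leI)
  fix G :: "'a \<Rightarrow>\<^sub>L 'a" assume "norm G \<le> 1"
  then show "quot_norm F (Q \<odot> G) \<le> norm Q"
    using order_trans[OF quot_norm_le_norm norm_blinfun_compose, of F Q G] mult_left_le[of "norm G" "norm Q"]
    by simp
qed

lemma quot_onorm_add: "quot_onorm F (P + Q) \<le> quot_onorm F P + quot_onorm F Q"
proof (rule quot_onorm_leI)
  fix G :: "'a \<Rightarrow>\<^sub>L 'a" assume G: "norm G \<le> 1"
  have le: "quot_norm F (R \<odot> G) \<le> quot_onorm F R" for R
    using quot_norm_le_onorm[of F R G] mult_left_le[OF G quot_onorm_nonneg[of F R]] by simp
  show "quot_norm F ((P + Q) \<odot> G) \<le> quot_onorm F P + quot_onorm F Q"
    unfolding blinfun_compose_bilinear using quot_norm_add[of F "P \<odot> G" "Q \<odot> G"] le[of P] le[of Q] by linarith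
qed

lemma quot_onorm_sum: "quot_onorm F (\<Sum>i\<in>I. Q i) \<le> (\<Sum>i\<in>I. quot_onorm F (Q i))"
proof (induction I rule: infinite_finite_induct)
  case (insert i I)
  then show ?case using quot_onorm_add[of F "Q i" "\<Sum>i\<in>I. Q i"] by simp
qed (use quot_onorm_le_norm[of F 0] in auto)

text \<open>Factors on the right come out with their norm. A factor on the left would have to
  respect the right ideal, which is why the later estimates keep \<open>Q\<close> in front.\<close>

lemma quot_onorm_compose: "quot_onorm F (P \<odot> Q) \<le> quot_onorm F P * norm Q"
proof (rule quot_onorm_leI)
  fix G :: "'a \<Rightarrow>\<^sub>L 'a" assume G: "norm G \<le> 1"
  have "quot_norm F (P \<odot> (Q \<odot> G)) \<le> quot_onorm F P * norm (Q \<odot> G)" by (rule quot_norm_le_onorm)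
  also have "\<dots> \<le> quot_onorm F P * norm Q"
    using order_trans[OF norm_blinfun_compose mult_left_le[OF G norm_ge_zero], of Q]
    by (intro mult_left_mono quot_onorm_nonneg) auto
  finally show "quot_norm F (P \<odot> Q \<odot> G) \<le> quot_onorm F P * norm Q" by (simp add: blinfun_compose_bilinear)
qed

lemma quot_onorm_compose_le: "norm Q \<le> 1 \<Longrightarrow> quot_onorm F (P \<odot> Q) \<le> quot_onorm F P"
  using order_trans[OF quot_onorm_compose mult_left_le[OF _ quot_onorm_nonneg]] .

lemma quot_onorm_uminus: "quot_onorm F (- Q) \<le> quot_onorm F Q"
  using quot_onorm_compose_le[of "- id_blinfun" F Q] norm_blinfun_id_le by (simp add: blinfun_compose_bilinear)

lemma quot_onorm_scaleR: "quot_onorm F (r *\<^sub>R Q) \<le> \<bar>r\<bar> * quot_onorm F Q"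
proof -
  have "quot_onorm F (Q \<odot> (r *\<^sub>R id_blinfun)) \<le> quot_onorm F Q * norm (r *\<^sub>R id_blinfun :: 'a \<Rightarrow>\<^sub>L 'a)"
    by (rule quot_onorm_compose)
  also have "\<dots> \<le> quot_onorm F Q * (\<bar>r\<bar> * 1)"
    unfolding norm_scaleR by (intro mult_left_mono quot_onorm_nonneg norm_blinfun_id_le) auto
  finally show ?thesis by (simp add: blinfun_compose_bilinear mult.commute)
qed

section \<open>Complex scalars and a lattice of translations as operators\<close>

lemma scaleC_zero_left [simp]: "0 *\<^sub>C x = (0 :: 'a::complex_normed_vector)"
  using scaleR_scaleC[of 0 x] by simp

lemma scaleC_diff_left: "(c - d) *\<^sub>C x = c *\<^sub>C x - d *\<^sub>C (x :: 'a::complex_normed_vector)"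
proof -
  have "(- d) *\<^sub>C x = - (d *\<^sub>C x)" using scaleC_scaleC[of "- 1" d x] by (simp add: scaleC_minus_one)
  then show ?thesis using scaleC_add_left[of c "- d" x] by simp
qed

definition scal :: "complex \<Rightarrow> 'x::complex_normed_vector \<Rightarrow>\<^sub>L 'x"
  where "scal c = Blinfun (\<lambda>x. c *\<^sub>C x)"

lemma scal_apply [simp]: "blinfun_apply (scal c) x = c *\<^sub>C x"
  by (simp add: scal_def bounded_linear_Blinfun_apply bounded_linear_scaleC)

lemma norm_scal_le: "norm (scal c) \<le> cmod c"
  by (rule norm_blinfun_bound) (simp_all add: norm_scaleC)

lemma scal_scal: "scal c \<odot> scal d = scal (c * d)"
  by (rule blinfun_eqI) (simp add: scaleC_scaleC)

lemma scal_one: "scal 1 = id_blinfun"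
  by (rule blinfun_eqI) simp

lemma scal_sum: "scal (\<Sum>i\<in>I. c i) = (\<Sum>i\<in>I. scal (c i) :: 'x::complex_normed_vector \<Rightarrow>\<^sub>L 'x)"
proof (induction I rule: infinite_finite_induct)
  case (insert i I)
  have "scal (c i + sum c I) = scal (c i) + (scal (sum c I) :: 'x \<Rightarrow>\<^sub>L 'x)"
    by (rule blinfun_eqI) (simp add: scaleC_add_left blinfun.add_left)
  with insert show ?case by simp
qed (auto intro!: blinfun_eqI)

text \<open>\<open>L\<close> models a convolution and \<open>T n\<close> the translation by
  \<open>n\<close> lattice steps, an isometry because \<open>T (- n)\<close> inverts it. Operators
  are only real-linear by type, so complex scalars enter as operators \<open>scal c\<close> whose
  commutation with \<open>T\<close> and \<open>L\<close> is required.\<close>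

locale lattice_action =
  fixes L :: "'x::{complex_normed_vector, banach} \<Rightarrow>\<^sub>L 'x" and T :: "int \<Rightarrow> 'x \<Rightarrow>\<^sub>L 'x"
  assumes T_0: "T 0 = id_blinfun"
    and T_add: "T (m + n) = T m \<odot> T n"
    and norm_T: "norm (T n) \<le> 1"
    and T_L: "T n \<odot> L = L \<odot> T n"
    and scal_T: "scal c \<odot> T n = T n \<odot> scal c"
    and scal_L: "scal c \<odot> L = L \<odot> scal c"
begin

abbreviation "F \<equiv> id_blinfun + L"
abbreviation "N \<equiv> quot_onorm F"

text \<open>The \<open>n\<close>-th power of \<open>z\<close> times the translation
  \<open>T 1\<close>. On the Fourier side \<open>W z 1 - id_blinfun\<close> vanishes exactly where
  \<open>T 1\<close> acts as \<open>1 / z\<close>.\<close>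

definition W :: "complex \<Rightarrow> int \<Rightarrow> 'x \<Rightarrow>\<^sub>L 'x"
  where "W z n = scal (z powi n) \<odot> T n"

lemma W_0: "W z 0 = id_blinfun"
  by (simp add: W_def T_0 scal_one blinfun_compose_bilinear)

lemma W_add:
  assumes "z \<noteq> 0" shows "W z (m + n) = W z m \<odot> W z n"
proof -
  have "W z m \<odot> W z n = scal (z powi m) \<odot> (T m \<odot> scal (z powi n)) \<odot> T n"
    by (simp add: W_def blinfun_compose_bilinear)
  also have "\<dots> = (scal (z powi m) \<odot> scal (z powi n)) \<odot> (T m \<odot> T n)"
    unfolding scal_T[symmetric] by (simp add: blinfun_compose_bilinear)
  finally show ?thesis using assms by (simp add: W_def scal_scal T_add power_int_add)
qed

lemma norm_W:
  assumes "cmod z = 1" shows "norm (W z n) \<le> 1"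
proof -
  have "norm (W z n) \<le> norm (scal (z powi n) :: 'x \<Rightarrow>\<^sub>L 'x) * norm (T n)"
    unfolding W_def by (rule norm_blinfun_compose)
  also have "\<dots> \<le> 1 * 1"
    using norm_scal_le[of "z powi n"] norm_T assms by (intro mult_mono) (auto simp: norm_power_int)
  finally show ?thesis by simp
qed

lemma W_L: "W z n \<odot> L = L \<odot> W z n"
proof -
  have "W z n \<odot> L = scal (z powi n) \<odot> (T n \<odot> L)" by (simp add: W_def blinfun_compose_bilinear)
  also have "\<dots> = scal (z powi n) \<odot> L \<odot> T n" by (simp add: T_L blinfun_compose_bilinear)
  finally show ?thesis by (simp add: scal_L W_def blinfun_compose_bilinear)
qed

lemma W_commute: "z \<noteq> 0 \<Longrightarrow> W z m \<odot> W z n = W z n \<odot> W z m"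
  by (simp add: W_add[symmetric] add.commute)

text \<open>Telescoping along powers, each of norm at most one. A negative exponent is reduced to a
  positive one by pulling \<open>W z n\<close> out on the right.\<close>

lemma N_W_diff:
  assumes z: "cmod z = 1"
  shows "N (Q \<odot> (W z n - id_blinfun)) \<le> \<bar>real_of_int n\<bar> * N (Q \<odot> (W z 1 - id_blinfun))"
proof -
  have z0: "z \<noteq> 0" using z by auto
  have nat: "N (Q \<odot> (W z (int m) - id_blinfun)) \<le> real m * N (Q \<odot> (W z 1 - id_blinfun))" for m
  proof (induction m)
    case 0
    then show ?case using quot_onorm_le_norm[of F 0] by (simp add: W_0)
  next
    case (Suc m)
    have "Q \<odot> (W z (int (Suc m)) - id_blinfun) =
      (Q \<odot> (W z (int m) - id_blinfun)) \<odot> W z 1 + Q \<odot> (W z 1 - id_blinfun)"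
      using W_add[OF z0, of "int m" 1] by (simp add: blinfun_compose_bilinear add.commute)
    then have "N (Q \<odot> (W z (int (Suc m)) - id_blinfun)) \<le>
      N (Q \<odot> (W z (int m) - id_blinfun)) + N (Q \<odot> (W z 1 - id_blinfun))"
      using quot_onorm_add[of F "(Q \<odot> (W z (int m) - id_blinfun)) \<odot> W z 1" "Q \<odot> (W z 1 - id_blinfun)"]
        quot_onorm_compose_le[OF norm_W[OF z], of F "Q \<odot> (W z (int m) - id_blinfun)" 1] by simp
    with Suc show ?case by (simp add: algebra_simps)
  qed
  show ?thesis
  proof (cases "n \<ge> 0")
    case True
    then show ?thesis using nat[of "nat n"] by simp
  next
    case False
    have "Q \<odot> (W z n - id_blinfun) = - ((Q \<odot> (W z (- n) - id_blinfun)) \<odot> W z n)"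
    proof -
      have "Q \<odot> W z (- n) \<odot> W z n = Q"
        using W_add[OF z0, of "- n" n] by (simp add: W_0 blinfun_compose_bilinear(9)[symmetric] blinfun_compose_bilinear(10))
      then show ?thesis by (simp add: blinfun_compose_bilinear)
    qed
    then have "N (Q \<odot> (W z n - id_blinfun)) \<le> N (Q \<odot> (W z (- n) - id_blinfun))"
      using quot_onorm_uminus[of F "(Q \<odot> (W z (- n) - id_blinfun)) \<odot> W z n"]
        quot_onorm_compose_le[OF norm_W[OF z], of F "Q \<odot> (W z (- n) - id_blinfun)" n] by simp
    also have "\<dots> \<le> \<bar>real_of_int n\<bar> * N (Q \<odot> (W z 1 - id_blinfun))" using nat[of "nat (- n)"] False by simp
    finally show ?thesis .
  qed
qed

text \<open>The Fejer kernel \<open>P\<close>, built from the geometric sums \<open>S\<close> and \<open>S'\<close>, is annihilated to second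
  order by \<open>W z 1 - 1\<close> up to \<open>O(1/n)\<close>, while its average over the roots of unity is the identity.\<close>

lemma fejer_bound:
  assumes z: "cmod z = 1" and n: "n > 0"
    and C: "\<And>Q. Q \<odot> L = L \<odot> Q \<Longrightarrow> N Q \<le> C * N (Q \<odot> (W z 1 - id_blinfun))" and "C \<ge> 0"
  shows "N ((1 / real n) *\<^sub>R (\<Sum>k<n. \<Sum>l<n. W z (int k - int l))) \<le> 4 * C\<^sup>2 / real n"
proof -
  have z0: "z \<noteq> 0" using z by auto
  define v where "v = W z 1 - id_blinfun"
  define S where "S = (\<Sum>k<n. W z (int k))"
  define S' where "S' = (\<Sum>l<n. W z (- int l))"
  define P where "P = (1 / real n) *\<^sub>R (S \<odot> S')"
  have P: "P = (1 / real n) *\<^sub>R (\<Sum>k<n. \<Sum>l<n. W z (int k - int l))"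
    unfolding P_def S_def S'_def blinfun_compose_sum_left blinfun_compose_sum_right W_add[OF z0, symmetric]
    by (subst sum.swap) simp
  have Wv: "W z m \<odot> v = W z (m + 1) - W z m" for m
    by (simp add: v_def W_add[OF z0] blinfun_compose_bilinear)
  have Sv: "S \<odot> v = W z (int n) - id_blinfun"
  proof -
    have "(\<Sum>k<m. W z (int k)) \<odot> v = W z (int m) - id_blinfun" for m
      by (induction m) (simp_all add: W_0 blinfun_compose_bilinear Wv add.commute)
    then show ?thesis by (simp add: S_def)
  qed
  have S'v: "S' \<odot> v = W z 1 - W z (1 - int n)"
  proof -
    have "(\<Sum>k<m. W z (- int k)) \<odot> v = W z 1 - W z (1 - int m)" for m
      by (induction m) (simp_all add: blinfun_compose_bilinear Wv)
    then show ?thesis by (simp add: S'_def)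
  qed
  have n2: "norm (W z i - W z j) \<le> 2" for i j
    using norm_triangle_ineq4[of "W z i" "W z j"] norm_W[OF z, of i] norm_W[OF z, of j] by linarith
  have Wc: "Q \<odot> L = L \<odot> Q" if "Q = A \<odot> B" "A \<odot> L = L \<odot> A" "B \<odot> L = L \<odot> B" for Q A B
    using that by (metis blinfun_compose_bilinear(9))
  have sumc: "(\<Sum>k\<in>K. W z (f k)) \<odot> L = L \<odot> (\<Sum>k\<in>K. W z (f k))" for K :: "nat set" and f
    by (simp add: blinfun_compose_sum_left blinfun_compose_sum_right W_L)
  have vc: "v \<odot> L = L \<odot> v" by (simp add: v_def blinfun_compose_bilinear W_L)
  have Pc: "P \<odot> L = L \<odot> P"
    using Wc[OF refl sumc sumc] by (simp add: P_def S_def S'_def blinfun_compose_bilinear(7,8))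
  \<comment> \<open>The hypothesis is used twice, for \<open>P\<close> and for
    \<open>P \<odot> v\<close>, both of which commute with \<open>L\<close>.\<close>
  have "N P \<le> C * N (P \<odot> v)" using C[OF Pc] by (simp add: v_def)
  also have "\<dots> \<le> C * (C * N (P \<odot> v \<odot> v))"
    using C[OF Wc[OF refl Pc vc]] \<open>C \<ge> 0\<close> by (intro mult_left_mono) (simp_all add: v_def)
  also have "\<dots> \<le> C * (C * (4 / real n))"
  proof (intro mult_left_mono \<open>C \<ge> 0\<close>)
    \<comment> \<open>Commutation hands one factor \<open>v\<close> to each geometric sum, where it
      telescopes to a difference of norm at most \<open>2\<close>; this is the origin of the
      \<open>4\<close>.\<close>
    have "S' \<odot> v \<odot> v = v \<odot> (S' \<odot> v)"
      unfolding S'v by (simp add: v_def blinfun_compose_bilinear W_commute[OF z0])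
    then have "P \<odot> v \<odot> v = (1 / real n) *\<^sub>R ((S \<odot> v) \<odot> (S' \<odot> v))"
      unfolding P_def blinfun_compose_bilinear(8) by (metis blinfun_compose_bilinear(9))
    also have "norm \<dots> \<le> (1 / real n) * (2 * 2)"
      unfolding norm_scaleR
    proof (intro mult_mono)
      have "norm ((S \<odot> v) \<odot> (S' \<odot> v)) \<le> norm (S \<odot> v) * norm (S' \<odot> v)" by (rule norm_blinfun_compose)
      also have "\<dots> \<le> 2 * 2"
        using n2[of "int n" 0] n2 by (intro mult_mono) (auto simp: Sv S'v W_0)
      finally show "norm ((S \<odot> v) \<odot> (S' \<odot> v)) \<le> 2 * 2" .
    qed (use n in auto)
    finally show "N (P \<odot> v \<odot> v) \<le> 4 / real n" using quot_onorm_le_norm[of F "P \<odot> v \<odot> v"] by simp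
  qed
  finally show ?thesis unfolding P by (simp add: power2_eq_square mult_ac)
qed

text \<open>Since \<open>\<bar>k - l\<bar> < n\<close>, the sum of this power over the
  \<open>n\<close>-th roots of unity vanishes unless \<open>k = l\<close>. Only the \<open>n\<close>
  diagonal terms survive, each contributing \<open>n\<close> times the identity.\<close>

lemma roots_average:
  assumes "n > 0"
  defines "\<zeta> \<equiv> \<lambda>j. cis (2 * pi * real j / real n)"
  shows "(\<Sum>j<n. \<Sum>k<n. \<Sum>l<n. W (\<zeta> j) (int k - int l)) = (real n)\<^sup>2 *\<^sub>R id_blinfun"
proof -
  have root: "(\<Sum>j<n. \<zeta> j powi (int k - int l)) = (if k = l then of_nat n else 0)" if kl: "k < n" "l < n" for k l
  proof (cases "k = l")
    case False
    define w where "w = cis (2 * pi * real_of_int (int k - int l) / real n)"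
    have p: "\<zeta> j powi (int k - int l) = w ^ j" for j
      unfolding \<zeta>_def w_def cis_power_int Complex.DeMoivre
      by (rule arg_cong[of _ _ cis]) (simp add: mult_ac)
    have "w ^ n = 1"
    proof -
      have "w ^ n = cis (2 * pi * real_of_int (int k - int l))"
        using assms(1) unfolding w_def Complex.DeMoivre by (intro arg_cong[of _ _ cis]) simp
      then show ?thesis using cis_multiple_2pi[OF Ints_of_int] by metis
    qed
    moreover have "w \<noteq> 1"
    proof
      assume "w = 1"
      then have "cos (2 * pi * real_of_int (int k - int l) / real n) = 1" by (simp add: w_def complex_eq_iff)
      then obtain m :: int where "2 * pi * real_of_int (int k - int l) / real n = of_int m * 2 * pi"
        unfolding cos_one_2pi_int by blast
      then have "(2 * pi) * real_of_int (int k - int l) = (2 * pi) * (real_of_int m * real n)"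
        using assms(1) by (simp add: divide_eq_eq mult_ac)
      then have "real_of_int (int k - int l) = real_of_int m * real n" by (subst (asm) mult_cancel_left) simp
      then have "real_of_int (int k - int l) = real_of_int (m * int n)" by simp
      then have "int k - int l = m * int n" by linarith
      moreover have "\<bar>int k - int l\<bar> < int n" using kl by linarith
      moreover have "int k - int l \<noteq> 0" using False by simp
      ultimately show False
        by (metis abs_mult abs_of_nat dvd_imp_le_int dvd_triv_right leD)
    qed
    ultimately have "(\<Sum>j<n. w ^ j) = 0" using geometric_sum[of w n] by simp
    then show ?thesis using False by (simp add: p)
  qed simp
  have "(\<Sum>j<n. \<Sum>k<n. \<Sum>l<n. W (\<zeta> j) (int k - int l)) = (\<Sum>k<n. \<Sum>l<n. \<Sum>j<n. W (\<zeta> j) (int k - int l))"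
    by (subst sum.swap, rule sum.cong[OF refl], rule sum.swap)
  also have "\<dots> = (\<Sum>k<n. \<Sum>l<n. scal (if k = l then of_nat n else 0) \<odot> T (int k - int l))"
    by (intro sum.cong refl) (simp add: W_def root blinfun_compose_sum_left[symmetric] scal_sum[symmetric])
  also have "\<dots> = (\<Sum>k<n. \<Sum>l<n. if k = l then real n *\<^sub>R id_blinfun else 0)"
  proof (intro sum.cong refl)
    fix k l
    have "scal (of_nat n) = real n *\<^sub>R (id_blinfun :: 'x \<Rightarrow>\<^sub>L 'x)"
      by (rule blinfun_eqI) (simp add: blinfun.scaleR_left scaleR_scaleC)
    moreover have "scal 0 = (0 :: 'x \<Rightarrow>\<^sub>L 'x)"
      using scal_sum[of "\<lambda>_. 0" "{}"] by simp
    ultimately show "scal (if k = l then of_nat n else 0) \<odot> T (int k - int l) = (if k = l then real n *\<^sub>R id_blinfun else 0)"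
      by (simp add: T_0 blinfun_compose_bilinear)
  qed
  also have "\<dots> = (real n)\<^sup>2 *\<^sub>R id_blinfun" by (simp add: power2_eq_square scaleR_sum_left[symmetric] sum_constant_scaleR)
  finally show ?thesis .
qed

text \<open>The identity inherits the bound \<open>4 * D\<^sup>2 / n\<close> from the Fejer sums.
  Once \<open>n\<close> exceeds \<open>4 * D\<^sup>2\<close>, its distance to the ideal is below
  one, and a Neumann series turns the nearby multiple of \<open>F\<close> into a right
  inverse.\<close>

lemma right_inverse:
  assumes C: "\<And>z Q. cmod z = 1 \<Longrightarrow> Q \<odot> L = L \<odot> Q \<Longrightarrow> N Q \<le> C * N (Q \<odot> (W z 1 - id_blinfun))"
  obtains B where "F \<odot> B = id_blinfun"
proof -
  define D where "D = max C 0"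
  have DC: "N Q \<le> D * N (Q \<odot> (W z 1 - id_blinfun))" if "cmod z = 1" "Q \<odot> L = L \<odot> Q" for z Q
    using order_trans[OF C[OF that] mult_right_mono[of C D]] quot_onorm_nonneg by (auto simp: D_def)
  have D: "D \<ge> 0" by (simp add: D_def)
  obtain n :: nat where n: "real n > 4 * D\<^sup>2" using reals_Archimedean2 by blast
  then have n0: "n > 0" using zero_le_power2[of D] by (cases n) auto
  define \<zeta> where "\<zeta> j = cis (2 * pi * real j / real n)" for j
  define P where "P j = (1 / real n) *\<^sub>R (\<Sum>k<n. \<Sum>l<n. W (\<zeta> j) (int k - int l))" for j
  have "id_blinfun = (1 / real n) *\<^sub>R (\<Sum>j<n. P j)"
    using roots_average[OF n0] n0 unfolding P_def \<zeta>_def scaleR_sum_right[symmetric] by (simp add: power2_eq_square)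
  then have "N id_blinfun \<le> (1 / real n) * N (\<Sum>j<n. P j)"
    using quot_onorm_scaleR[of F "1 / real n" "\<Sum>j<n. P j"] by simp
  also have "\<dots> \<le> (1 / real n) * (\<Sum>j<n. 4 * D\<^sup>2 / real n)"
    using n0 D DC unfolding P_def
    by (intro mult_left_mono order_trans[OF quot_onorm_sum] sum_mono fejer_bound) (auto simp: \<zeta>_def)
  also have "\<dots> < 1" using n n0 by simp
  finally have "quot_norm F id_blinfun < 1"
    using quot_norm_le_onorm[of F id_blinfun id_blinfun] mult_left_le[OF norm_blinfun_id_le[where 'a='x] quot_onorm_nonneg[of F id_blinfun]]
    unfolding blinfun_compose_bilinear(10) by linarith
  then obtain Y where "norm (id_blinfun - F \<odot> Y) < 1" using quot_norm_lessD by blast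
  then obtain B where "F \<odot> Y \<odot> B = id_blinfun" by (rule right_inverse_near_id)
  then show ?thesis using that[of "Y \<odot> B"] by (simp only: blinfun_compose_bilinear(9))
qed

text \<open>Here \<open>z ^ j\<close> is far from one although \<open>j\<close> lattice steps hardly
  move \<open>L\<close>. Modulo the ideal \<open>Q \<odot> (T (int j) - id_blinfun)\<close> is
  small, as it may be traded for its product with \<open>- L\<close>. So \<open>Q\<close> times
  \<open>z ^ j - 1\<close> is nearly \<open>Q\<close> times \<open>W z (int j) - id_blinfun\<close>,
  which telescopes into \<open>j\<close> basic differences. Absorbing a quarter of
  \<open>N Q\<close> gives the factor \<open>4/3\<close>.\<close>

lemma high_frequency:
  assumes z: "cmod z = 1" and Q: "Q \<odot> L = L \<odot> Q"
    and j: "norm (T (int j) \<odot> L - L) \<le> 1/4" "cmod (z ^ j - 1) \<ge> 1"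
  shows "N Q \<le> (4/3) * (real j * N (Q \<odot> (W z 1 - id_blinfun)))"
proof -
  let ?c = "z ^ j - 1" and ?V = "T (int j) - id_blinfun"
  have QV: "N (Q \<odot> ?V) \<le> N Q * (1/4)"
  proof (rule quot_onorm_leI)
    fix G :: "'x \<Rightarrow>\<^sub>L 'x" assume G: "norm G \<le> 1"
    have QVL: "L \<odot> (Q \<odot> ?V \<odot> G) = Q \<odot> (T (int j) \<odot> L - L) \<odot> G"
    proof -
      have "L \<odot> (Q \<odot> ?V \<odot> G) = (L \<odot> Q) \<odot> ?V \<odot> G" by (simp only: blinfun_compose_bilinear(9))
      also have "\<dots> = Q \<odot> (L \<odot> ?V) \<odot> G" by (simp only: Q[symmetric] blinfun_compose_bilinear(9))
      finally show ?thesis by (simp only: blinfun_compose_bilinear(3,10) T_L)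
    qed
    have "Q \<odot> ?V \<odot> G = F \<odot> (Q \<odot> ?V \<odot> G) + - (L \<odot> (Q \<odot> ?V \<odot> G))"
      by (simp add: blinfun_compose_bilinear(2,11))
    then have "quot_norm F (Q \<odot> ?V \<odot> G) \<le> quot_norm F (- (L \<odot> (Q \<odot> ?V \<odot> G)))"
      by (metis quot_norm_ideal)
    also have "- (L \<odot> (Q \<odot> ?V \<odot> G)) = Q \<odot> (- ((T (int j) \<odot> L - L) \<odot> G))"
      unfolding QVL by (simp only: blinfun_compose_bilinear(5,9))
    also have "quot_norm F \<dots> \<le> N Q * norm (- ((T (int j) \<odot> L - L) \<odot> G))" by (rule quot_norm_le_onorm)
    also have "\<dots> \<le> N Q * (1/4)"
    proof (intro mult_left_mono quot_onorm_nonneg)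
      have "norm ((T (int j) \<odot> L - L) \<odot> G) \<le> norm (T (int j) \<odot> L - L) * norm G" by (rule norm_blinfun_compose)
      also have "\<dots> \<le> 1/4 * 1" using j(1) G by (intro mult_mono) auto
      finally show "norm (- ((T (int j) \<odot> L - L) \<odot> G)) \<le> 1/4" by simp
    qed
    finally show "quot_norm F (Q \<odot> ?V \<odot> G) \<le> N Q * (1/4)" .
  qed
  have eq: "Q \<odot> scal ?c = Q \<odot> (W z (int j) - id_blinfun) + - (Q \<odot> ?V \<odot> scal (z ^ j))"
  proof -
    have "scal ?c = scal (z ^ j) - (id_blinfun :: 'x \<Rightarrow>\<^sub>L 'x)"
      by (intro blinfun_eqI) (simp add: blinfun.diff_left scaleC_diff_left)
    moreover have "W z (int j) = T (int j) \<odot> scal (z ^ j)" by (simp add: W_def scal_T)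
    ultimately show ?thesis by (simp add: blinfun_compose_bilinear)
  qed
  have zj: "norm (scal (z ^ j) :: 'x \<Rightarrow>\<^sub>L 'x) \<le> 1" using norm_scal_le[of "z ^ j"] z by (simp add: norm_power)
  have c0: "?c \<noteq> 0" using j(2) by auto
  \<comment> \<open>Dividing by \<open>z ^ j - 1\<close> costs nothing, as its modulus is at least
    one.\<close>
  have "N Q = N (Q \<odot> scal ?c \<odot> scal (1 / ?c))"
    using c0 by (simp only: blinfun_compose_bilinear(9)[symmetric] scal_scal) (simp add: scal_one blinfun_compose_bilinear)
  also have "\<dots> \<le> N (Q \<odot> scal ?c)"
  proof (rule quot_onorm_compose_le)
    show "norm (scal (1 / ?c) :: 'x \<Rightarrow>\<^sub>L 'x) \<le> 1"
    proof -
      have "cmod (1 / ?c) \<le> 1" using j(2) by (simp add: norm_divide divide_le_eq)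
      then show ?thesis using norm_scal_le order_trans by blast
    qed
  qed
  also have "\<dots> \<le> N (Q \<odot> (W z (int j) - id_blinfun)) + N (- (Q \<odot> ?V \<odot> scal (z ^ j)))"
    unfolding eq by (rule quot_onorm_add)
  also have "\<dots> \<le> real j * N (Q \<odot> (W z 1 - id_blinfun)) + N Q * (1/4)"
    using N_W_diff[OF z, of Q "int j"] quot_onorm_uminus[of F "Q \<odot> ?V \<odot> scal (z ^ j)"]
      quot_onorm_compose_le[OF zj, of F "Q \<odot> ?V"] QV by (intro add_mono) auto
  finally show ?thesis by (simp add: algebra_simps)
qed

text \<open>\<open>Lh\<close> stands for the Fourier transform of \<open>L\<close> at one frequency,
  acting on values; \<open>R\<close> for the inverse of \<open>1 + Lh\<close>; \<open>Lsh\<close>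
  for the discretization of \<open>L\<close>; \<open>Ly\<close> for \<open>Lsh\<close> with each
  \<open>T n\<close> replaced by the scalar by which it acts at this frequency. With
  \<open>H = R \<odot> G\<close> one has \<open>G = (1 + Lh) H\<close>. Exchanging \<open>Lh\<close>
  for \<open>Ly\<close> costs \<open>e\<close>, exchanging \<open>Ly\<close> for \<open>Lsh\<close>
  costs multiples of \<open>N (Q \<odot> (W z 1 - id_blinfun))\<close>, and what remains,
  \<open>Q (1 + Lsh) H\<close>, is small modulo the ideal.\<close>

lemma low_frequency:
  assumes z: "cmod z = 1" and Q: "Q \<odot> L = L \<odot> Q"
    and D: "finite D" and Lsh: "Lsh = (\<Sum>n\<in>D. T n \<odot> \<Lambda> n)" and Ly: "Ly = (\<Sum>n\<in>D. scal (z powi (- n)) \<odot> \<Lambda> n)"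
    and inv: "(id_blinfun + Lh) \<odot> R = id_blinfun" "norm R \<le> M"
    and e: "norm (L \<odot> (L - Lsh)) \<le> e" "norm (Lh - Ly) \<le> e" "M * e \<le> 1/4"
  shows "N Q \<le> (2 * M * (\<Sum>n\<in>D. \<bar>real_of_int n\<bar> * norm (\<Lambda> n))) * N (Q \<odot> (W z 1 - id_blinfun))"
proof -
  let ?v = "W z 1 - id_blinfun" and ?K = "\<Sum>n\<in>D. \<bar>real_of_int n\<bar> * norm (\<Lambda> n)"
  have z0: "z \<noteq> 0" using z by auto
  have M0: "M \<ge> 0" using inv(2) norm_ge_zero order_trans by blast
  have K0: "?K \<ge> 0" by (intro sum_nonneg) auto
  have e0: "e \<ge> 0" using e(1) norm_ge_zero order_trans by blast
  have "N Q \<le> M * (N Q * e + ?K * N (Q \<odot> ?v) + N Q * e)"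
  proof (rule quot_onorm_leI)
    fix G :: "'x \<Rightarrow>\<^sub>L 'x" assume G: "norm G \<le> 1"
    define H where "H = R \<odot> G"
    have H: "norm H \<le> M"
    proof -
      have "norm H \<le> norm R * norm G" unfolding H_def by (rule norm_blinfun_compose)
      also have "\<dots> \<le> M * 1" using inv(2) G M0 by (intro mult_mono) auto
      finally show ?thesis by simp
    qed
    have GH: "G = H + Lh \<odot> H"
    proof -
      have "G = (id_blinfun + Lh) \<odot> R \<odot> G" unfolding inv(1) by (simp add: blinfun_compose_bilinear)
      then show ?thesis by (simp add: H_def blinfun_compose_bilinear)
    qed
    have LQ: "L \<odot> (Q \<odot> A) = Q \<odot> (L \<odot> A)" for A :: "'x \<Rightarrow>\<^sub>L 'x" by (simp only: blinfun_compose_bilinear(9) Q)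
    have 1: "quot_norm F (Q \<odot> H + Q \<odot> (Lsh \<odot> H)) \<le> N Q * e * M"
    proof -
      \<comment> \<open>Modulo the ideal \<open>Q \<odot> H\<close> is
        \<open>- (Q \<odot> (L \<odot> H))\<close>, so the left side becomes
        \<open>- Q (L - Lsh) H\<close>. Trading once more produces the factor \<open>L\<close> that
        makes \<open>L - Lsh\<close> small.\<close>
      have "Q \<odot> H + Q \<odot> (Lsh \<odot> H) =
        F \<odot> (Q \<odot> H - Q \<odot> (L \<odot> H) + Q \<odot> (Lsh \<odot> H)) + Q \<odot> (L \<odot> (L - Lsh) \<odot> H)"
      proof -
        have "F \<odot> A = A + L \<odot> A" for A :: "'x \<Rightarrow>\<^sub>L 'x" by (simp add: blinfun_compose_bilinear)
        moreover have "L \<odot> (Q \<odot> H - Q \<odot> (L \<odot> H) + Q \<odot> (Lsh \<odot> H)) =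
          Q \<odot> (L \<odot> H) - Q \<odot> (L \<odot> (L \<odot> H)) + Q \<odot> (L \<odot> (Lsh \<odot> H))"
          by (simp only: blinfun_compose_bilinear(1,3) LQ)
        moreover have "Q \<odot> (L \<odot> (L - Lsh) \<odot> H) = Q \<odot> (L \<odot> (L \<odot> H)) - Q \<odot> (L \<odot> (Lsh \<odot> H))"
          by (simp add: blinfun_compose_bilinear)
        ultimately show ?thesis by simp
      qed
      then have "quot_norm F (Q \<odot> H + Q \<odot> (Lsh \<odot> H)) \<le> quot_norm F (Q \<odot> (L \<odot> (L - Lsh) \<odot> H))"
        by (metis quot_norm_ideal)
      also have "\<dots> \<le> N Q * norm (L \<odot> (L - Lsh) \<odot> H)" by (rule quot_norm_le_onorm)
      also have "\<dots> \<le> N Q * (e * M)"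
      proof (intro mult_left_mono quot_onorm_nonneg)
        have "norm (L \<odot> (L - Lsh) \<odot> H) \<le> norm (L \<odot> (L - Lsh)) * norm H" by (rule norm_blinfun_compose)
        also have "\<dots> \<le> e * M" using e(1) H e0 by (intro mult_mono) auto
        finally show "norm (L \<odot> (L - Lsh) \<odot> H) \<le> e * M" .
      qed
      finally show ?thesis by (simp add: mult_ac)
    qed
    have 2: "quot_norm F (Q \<odot> ((Ly - Lsh) \<odot> H)) \<le> ?K * N (Q \<odot> ?v) * M"
    proof -
      \<comment> \<open>Each \<open>T n\<close> equals \<open>W z n\<close> times the scalar that
        replaces it in \<open>Ly\<close>, so every term of the difference contains
        \<open>W z n - id_blinfun\<close>.\<close>
      have "Q \<odot> (Ly - Lsh) = (\<Sum>n\<in>D. - (Q \<odot> (W z n - id_blinfun) \<odot> (scal (z powi (- n)) \<odot> \<Lambda> n)))"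
      proof -
        have T: "T n = W z n \<odot> scal (z powi (- n))" for n
        proof -
          have "W z n \<odot> scal (z powi (- n)) = T n \<odot> (scal (z powi n) \<odot> scal (z powi (- n)))"
            by (simp only: W_def scal_T blinfun_compose_bilinear(9))
          then show ?thesis using z0 by (simp add: scal_scal scal_one power_int_minus blinfun_compose_bilinear)
        qed
        have "Ly - Lsh = (\<Sum>n\<in>D. - ((W z n - id_blinfun) \<odot> (scal (z powi (- n)) \<odot> \<Lambda> n)))"
          unfolding Ly Lsh sum_subtractf[symmetric]
        proof (rule sum.cong)
          fix n
          have "T n \<odot> \<Lambda> n = W z n \<odot> (scal (z powi (- n)) \<odot> \<Lambda> n)"
            by (subst T) (simp only: blinfun_compose_bilinear(9))
          then show "scal (z powi (- n)) \<odot> \<Lambda> n - T n \<odot> \<Lambda> n = - ((W z n - id_blinfun) \<odot> (scal (z powi (- n)) \<odot> \<Lambda> n))"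
            by (simp add: blinfun_compose_bilinear(4,11))
        qed simp
        then show ?thesis by (simp only: blinfun_compose_sum_right blinfun_compose_bilinear(5,9))
      qed
      then have "N (Q \<odot> (Ly - Lsh)) \<le> (\<Sum>n\<in>D. N (- (Q \<odot> (W z n - id_blinfun) \<odot> (scal (z powi (- n)) \<odot> \<Lambda> n))))"
        by (simp only: quot_onorm_sum)
      also have "\<dots> \<le> (\<Sum>n\<in>D. (\<bar>real_of_int n\<bar> * norm (\<Lambda> n)) * N (Q \<odot> ?v))"
      proof (rule sum_mono)
        fix n
        let ?A = "scal (z powi (- n)) \<odot> \<Lambda> n"
        have nA: "norm ?A \<le> norm (\<Lambda> n)"
        proof -
          have "norm ?A \<le> norm (scal (z powi (- n)) :: 'x \<Rightarrow>\<^sub>L 'x) * norm (\<Lambda> n)" by (rule norm_blinfun_compose)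
          also have "\<dots> \<le> 1 * norm (\<Lambda> n)"
            using norm_scal_le[of "z powi (- n)"] z by (intro mult_right_mono) (auto simp: norm_power_int)
          finally show ?thesis by simp
        qed
        have "N (- (Q \<odot> (W z n - id_blinfun) \<odot> ?A)) \<le> N (Q \<odot> (W z n - id_blinfun) \<odot> ?A)" by (rule quot_onorm_uminus)
        also have "\<dots> \<le> N (Q \<odot> (W z n - id_blinfun)) * norm ?A" by (rule quot_onorm_compose)
        also have "\<dots> \<le> (\<bar>real_of_int n\<bar> * N (Q \<odot> ?v)) * norm (\<Lambda> n)"
          using N_W_diff[OF z] nA by (intro mult_mono mult_nonneg_nonneg quot_onorm_nonneg) auto
        finally show "N (- (Q \<odot> (W z n - id_blinfun) \<odot> ?A)) \<le> (\<bar>real_of_int n\<bar> * norm (\<Lambda> n)) * N (Q \<odot> ?v)"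
          by (simp add: mult_ac)
      qed
      finally have b: "N (Q \<odot> (Ly - Lsh)) \<le> ?K * N (Q \<odot> ?v)" by (simp add: sum_distrib_right)
      have "quot_norm F (Q \<odot> (Ly - Lsh) \<odot> H) \<le> N (Q \<odot> (Ly - Lsh)) * norm H" by (rule quot_norm_le_onorm)
      also have "\<dots> \<le> ?K * N (Q \<odot> ?v) * M"
        using b H K0 by (intro mult_mono mult_nonneg_nonneg quot_onorm_nonneg) auto
      finally show ?thesis by (simp only: blinfun_compose_bilinear(9))
    qed
    have 3: "quot_norm F (Q \<odot> ((Lh - Ly) \<odot> H)) \<le> N Q * e * M"
    proof -
      have "quot_norm F (Q \<odot> ((Lh - Ly) \<odot> H)) \<le> N Q * norm ((Lh - Ly) \<odot> H)" by (rule quot_norm_le_onorm)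
      also have "\<dots> \<le> N Q * (e * M)"
        using e(2) H e0 by (intro mult_left_mono quot_onorm_nonneg order_trans[OF norm_blinfun_compose] mult_mono) auto
      finally show ?thesis by (simp add: mult_ac)
    qed
    have "Q \<odot> G = (Q \<odot> H + Q \<odot> (Lsh \<odot> H)) + Q \<odot> ((Ly - Lsh) \<odot> H) + Q \<odot> ((Lh - Ly) \<odot> H)"
      by (subst GH) (simp add: blinfun_compose_bilinear)
    then have "quot_norm F (Q \<odot> G) \<le> N Q * e * M + ?K * N (Q \<odot> ?v) * M + N Q * e * M"
      using order_trans[OF quot_norm_add add_mono[OF order_trans[OF quot_norm_add add_mono[OF 1 2]] 3]] by simp
    then show "quot_norm F (Q \<odot> G) \<le> M * (N Q * e + ?K * N (Q \<odot> ?v) + N Q * e)" by (simp add: algebra_simps)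
  qed
  also have "\<dots> = (2 * (M * e)) * N Q + M * ?K * N (Q \<odot> ?v)" by (simp add: algebra_simps)
  \<comment> \<open>The two error terms take at most half of \<open>N Q\<close> because
    \<open>M * e \<le> 1/4\<close>; absorbing them doubles the constant.\<close>
  also have "\<dots> \<le> (1/2) * N Q + M * ?K * N (Q \<odot> ?v)"
    using e(3) quot_onorm_nonneg[of F Q] by (intro add_right_mono mult_right_mono) auto
  finally show ?thesis by (simp add: algebra_simps)
qed

end

section \<open>Invertibility in the convolution algebra\<close>

lemma conv_invertible_imp_fourier:
  assumes "conv_invertible A"
  shows "invertible_op (fourier A \<omega>)"
proof -
  obtain l where l: "bounded_clinear A" "bounded_clinear l" "conv_mult A l = conv_unit" "conv_mult l A = conv_unit"
    using assms by (auto simp: conv_invertible_def conv_alg_def)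
  have "fourier A \<omega> (fourier l \<omega> h) = h" "fourier l \<omega> (fourier A \<omega> h) = h" for h
    using fourier_conv_mult[OF l(1), of l \<omega> h] fourier_conv_mult[OF l(2), of A \<omega> h]
    by (simp_all add: l(3,4) fourier_unit)
  then show ?thesis
    unfolding invertible_op_def using l
    by (intro conjI exI[of _ "fourier l \<omega>"] bounded_clinear_fourier) auto
qed

lemma shift_0: "shift 0 \<mu> = \<mu>"
  by (rule ft_inject) (simp add: ft_shift echar_def)

lemma translation_continuousI:
  fixes L :: "'h::complex_hilbert_space \<Rightarrow> (real, 'h) vmeasure"
  assumes L: "bounded_clinear L"
    and lim: "((\<lambda>\<epsilon>. onorm (\<lambda>h. translate \<epsilon> L h - L h)) \<longlongrightarrow> 0) (at 0)"
  shows "translation_continuous L"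
  unfolding translation_continuous_def
proof (intro allI impI)
  fix e :: real assume e: "e > 0"
  have bl: "bounded_linear L" using L by (rule bounded_clinear_bounded_linear)
  have "\<forall>\<^sub>F \<epsilon> in at 0. onorm (\<lambda>h. translate \<epsilon> L h - L h) < e" by (rule order_tendstoD(2)[OF lim e])
  then obtain d where d: "d > 0" "\<And>\<epsilon>. \<epsilon> \<noteq> 0 \<Longrightarrow> \<bar>\<epsilon>\<bar> < d \<Longrightarrow> onorm (\<lambda>h. translate \<epsilon> L h - L h) < e"
    by (auto simp: eventually_at dist_real_def)
  have "norm (shift t (L h) - L h) \<le> e * norm h" if t: "\<bar>t\<bar> \<le> d/2" for t h
  proof (cases "t = 0")
    case True
    then show ?thesis using e by (simp add: shift_0)
  next
    case False
    have tr: "translate (- t) L h = shift t (L h)" for h by (simp add: translate_def shift_def)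
    have "bounded_linear (\<lambda>h. shift t (L h) - L h)"
      by (intro bounded_linear_sub bounded_linear_compose[OF bounded_linear_shift] bl)
    from onorm[OF this, of h] have "norm (shift t (L h) - L h) \<le> onorm (\<lambda>h. shift t (L h) - L h) * norm h" .
    also have "\<dots> \<le> e * norm h"
      using d(2)[of "- t"] False t d(1) by (intro mult_right_mono) (auto simp: tr)
    finally show ?thesis .
  qed
  then show "\<exists>a>0. \<forall>t h. \<bar>t\<bar> \<le> a \<longrightarrow> norm (shift t (L h) - L h) \<le> e * norm h"
    using d(1) by (intro exI[of _ "d/2"]) auto
qed

text \<open>Beyond \<open>C * R\<close>, where \<open>C\<close> bounds the support of
  \<open>chi\<close>, the function \<open>1 - chi (t / R)\<close> equals one. The part of
  \<open>L h\<close> cut off by the sharp truncation is therefore a restriction of the measure in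
  the hypothesis, and restricting does not increase the norm.\<close>

lemma tightI:
  fixes L :: "'h::complex_hilbert_space \<Rightarrow> (real, 'h) vmeasure" and chi :: "real \<Rightarrow> complex"
  assumes L: "bounded_clinear L" and chi: "continuous_on UNIV chi" "compact (closure {t. chi t \<noteq> 0})"
    and lim: "((\<lambda>R. onorm (mult_fun (\<lambda>t. 1 - chi (t / R)) L)) \<longlongrightarrow> 0) at_top"
  shows "tight L"
  unfolding tight_def
proof (intro allI impI)
  fix e :: real assume e: "e > 0"
  have bl: "bounded_linear L" using L by (rule bounded_clinear_bounded_linear)
  have "bounded {t. chi t \<noteq> 0}"
    using compact_imp_bounded[OF chi(2)] bounded_subset closure_subset by blast
  then obtain C where C: "C > 0" "\<And>t. chi t \<noteq> 0 \<Longrightarrow> \<bar>t\<bar> \<le> C"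
    unfolding bounded_pos real_norm_def by blast
  obtain K where K: "\<And>t. cmod (chi t) \<le> K"
  proof -
    have "bounded (chi ` closure {t. chi t \<noteq> 0})"
      by (intro compact_imp_bounded compact_continuous_image chi continuous_on_subset[OF chi(1)]) auto
    then obtain K where K: "K > 0" "\<And>t. t \<in> closure {t. chi t \<noteq> 0} \<Longrightarrow> cmod (chi t) \<le> K"
      unfolding bounded_pos by blast
    have "cmod (chi t) \<le> K" for t
    proof (cases "chi t = 0")
      case False
      then have "t \<in> closure {t. chi t \<noteq> 0}" using subsetD[OF closure_subset, of t "{t. chi t \<noteq> 0}"] by simp
      then show ?thesis by (rule K(2))
    qed (use K(1) in simp)
    then show ?thesis using that by blast
  qed
  have "\<forall>\<^sub>F R in at_top. onorm (mult_fun (\<lambda>t. 1 - chi (t / R)) L) < e" by (rule order_tendstoD(2)[OF lim e])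
  then have "\<forall>\<^sub>F R in at_top. onorm (mult_fun (\<lambda>t. 1 - chi (t / R)) L) < e \<and> R > (0::real)"
    using eventually_gt_at_top[of "0::real"] by eventually_elim auto
  then obtain R where R: "onorm (mult_fun (\<lambda>t. 1 - chi (t / R)) L) < e" "R > 0"
    using eventually_happens'[OF trivial_limit_at_top_linorder] by blast
  define g where "g t = 1 - chi (t / R)" for t
  have "chi \<in> borel_measurable borel" using chi(1) by (rule borel_measurable_continuous_onI)
  then have "(\<lambda>t. chi (t / R)) \<in> bdd_borel"
    using K by (intro bdd_borel_compose[OF bdd_borelI[of chi K]]) auto
  then have g: "g \<in> bdd_borel" unfolding g_def[abs_def] by (intro bdd_borel_diff bdd_borel_const)
  let ?E = "{- (C * R)..C * R}"
  have "norm (L h - restrict_vmeasure ?E (L h)) \<le> e * norm h" for h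
  proof -
    have g1: "g t = 1" if "t \<in> - ?E" for t
    proof -
      have "\<bar>t\<bar> > C * R" using that by auto
      then have "\<bar>t / R\<bar> > C" using R(2) by (simp add: abs_divide pos_less_divide_eq)
      then show ?thesis using C(2)[of "t / R"] by (auto simp: g_def)
    qed
    have cE: "- ?E \<in> sets borel" by simp
    have "L h - restrict_vmeasure ?E (L h) = restrict_vmeasure (- ?E) (density_vmeasure g (L h))"
    proof (rule vmeasure_eqI)
      fix A :: "real set" assume A: "A \<in> sets borel"
      have "vmeas (L h) A = vmeas (L h) (?E \<inter> A \<union> - ?E \<inter> A)" by (rule arg_cong[where f = "vmeas (L h)"]) auto
      also have "\<dots> = vmeas (L h) (?E \<inter> A) + vmeas (L h) (- ?E \<inter> A)"
        using A cE by (intro vmeas_Un) auto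
      finally have "vmeas (L h - restrict_vmeasure ?E (L h)) A = vmeas (L h) (- ?E \<inter> A)"
        using A by (simp add: vmeas_diff vmeas_restrict)
      also have "\<dots> = vintegral (L h) (\<lambda>t. 1 * indicator (- ?E \<inter> A) t)"
        using vintegral_indicator[of "- ?E \<inter> A" "L h" 1] A cE by simp
      also have "(\<lambda>t. 1 * indicator (- ?E \<inter> A) t) = (\<lambda>t. indicator (- ?E \<inter> A) t * g t)"
      proof
        fix t
        show "1 * indicator (- ?E \<inter> A) t = indicator (- ?E \<inter> A) t * g t"
        proof (cases "t \<in> - ?E")
          case True
          then have "g t = 1" by (rule g1)
          then show ?thesis by simp
        next
          case False
          then have "t \<notin> - ?E \<inter> A" by blast
          then have "indicator (- ?E \<inter> A) t = (0 :: complex)" by (rule indicator_simps(2))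
          then show ?thesis by (simp only: mult_zero_left mult_zero_right)
        qed
      qed
      also have "vintegral (L h) \<dots> = vmeas (restrict_vmeasure (- ?E) (density_vmeasure g (L h))) A"
        using A cE by (simp add: vmeas_restrict vmeas_density[OF g])
      finally show "vmeas (L h - restrict_vmeasure ?E (L h)) A =
        vmeas (restrict_vmeasure (- ?E) (density_vmeasure g (L h))) A" .
    qed
    then have "norm (L h - restrict_vmeasure ?E (L h)) \<le> norm (density_vmeasure g (L h))"
      by (simp only: norm_restrict_le)
    also have "\<dots> \<le> onorm (\<lambda>h. density_vmeasure g (L h)) * norm h"
      by (rule onorm[OF bounded_linear_compose[OF bounded_linear_density[OF g] bl]])
    also have "\<dots> \<le> e * norm h"
      using R(1) by (intro mult_right_mono) (auto simp: mult_fun_def g_def[abs_def])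
    finally show ?thesis .
  qed
  then show "\<exists>R>0. \<forall>h. norm (L h - restrict_vmeasure {- R..R} (L h)) \<le> e * norm h"
    using C(1) R(2) by (intro exI[of _ "C * R"]) auto
qed

text \<open>Near each frequency the inverse survives a perturbation that absorbs half of the norm,
  which doubles its bound; compactness of \<open>{-Y..Y}\<close> makes the bound uniform. The
  conclusion is a lower bound for \<open>1 + fourier L y\<close>, so it applies to any right inverse
  by inserting its values.\<close>

lemma fourier_inverse_bound:
  fixes L :: "'h::complex_hilbert_space \<Rightarrow> (real, 'h) vmeasure"
  assumes L: "bounded_clinear L" and "tight L"
    and inv: "\<And>y. invertible_op (\<lambda>h. h + fourier L y h)"
  obtains M where "M > 0" "\<And>y h. \<bar>y\<bar> \<le> Y \<Longrightarrow> norm h \<le> M * norm (h + fourier L y h)"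
proof -
  have loc: "\<exists>\<delta> M. \<delta> > 0 \<and> M > 0 \<and> (\<forall>y h. \<bar>y - y0\<bar> < \<delta> \<longrightarrow> norm h \<le> M * norm (h + fourier L y h))" for y0
  proof -
    obtain S where S: "bounded_clinear S" "S \<circ> (\<lambda>h. h + fourier L y0 h) = id"
      using inv[of y0] by (auto simp: invertible_op_def)
    define m where "m = onorm S + 1"
    have blS: "bounded_linear S" using S(1) by (rule bounded_clinear_bounded_linear)
    have m: "m > 0" using onorm_pos_le[OF blS] by (simp add: m_def)
    obtain \<delta> where \<delta>: "\<delta> > 0" "\<And>y y' h. \<bar>y - y'\<bar> \<le> \<delta> \<Longrightarrow> norm (fourier L y h - fourier L y' h) \<le> (1 / (2 * m)) * norm h"
      using fourier_uniformly_continuous[OF assms(1,2), of "1 / (2 * m)"] m by auto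
    have "norm h \<le> (2 * m) * norm (h + fourier L y h)" if y: "\<bar>y - y0\<bar> < \<delta>" for y h
    proof -
      have "S (h + fourier L y0 h) = h" using fun_cong[OF S(2), of h] by simp
      then have "norm h \<le> onorm S * norm (h + fourier L y0 h)" using onorm[OF blS, of "h + fourier L y0 h"] by simp
      also have "\<dots> \<le> m * norm (h + fourier L y0 h)" by (intro mult_right_mono) (auto simp: m_def)
      also have "\<dots> \<le> m * (norm (h + fourier L y h) + (1 / (2 * m)) * norm h)"
      proof (intro mult_left_mono)
        have "h + fourier L y0 h = (h + fourier L y h) - (fourier L y h - fourier L y0 h)" by simp
        then have "norm (h + fourier L y0 h) \<le> norm (h + fourier L y h) + norm (fourier L y h - fourier L y0 h)"
          by (metis norm_triangle_ineq4)
        with \<delta>(2)[of y y0 h] y show "norm (h + fourier L y0 h) \<le> norm (h + fourier L y h) + (1 / (2 * m)) * norm h"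
          by simp
      qed (use m in auto)
      also have "\<dots> = m * norm (h + fourier L y h) + norm h / 2" using m by (simp add: distrib_left)
      finally show ?thesis by simp
    qed
    then show ?thesis using \<delta>(1) m by (intro exI[of _ \<delta>] exI[of _ "2 * m"]) auto
  qed
  then obtain \<delta> m where \<delta>: "\<And>y0. \<delta> y0 > 0" "\<And>y0. m y0 > 0"
    "\<And>y0 y h. \<bar>y - y0\<bar> < \<delta> y0 \<Longrightarrow> norm h \<le> m y0 * norm (h + fourier L y h)" by metis
  have "{-Y..Y} \<subseteq> (\<Union>y0\<in>{-Y..Y}. ball y0 (\<delta> y0))" using \<delta>(1) by force
  then obtain C where C: "C \<subseteq> {-Y..Y}" "finite C" "{-Y..Y} \<subseteq> (\<Union>y0\<in>C. ball y0 (\<delta> y0))"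
    using compactE_image[OF compact_Icc, of "{-Y..Y}" "\<lambda>y0. ball y0 (\<delta> y0)"] by (metis open_ball)
  \<comment> \<open>The sum dominates each of the finitely many local constants; adding one keeps
    \<open>M\<close> positive when the interval is empty.\<close>
  define M where "M = (\<Sum>y0\<in>C. m y0) + 1"
  have "norm h \<le> M * norm (h + fourier L y h)" if y: "\<bar>y\<bar> \<le> Y" for y h
  proof -
    have "y \<in> {-Y..Y}" using y by auto
    then have "y \<in> (\<Union>y0\<in>C. ball y0 (\<delta> y0))" using C(3) by (rule subsetD[rotated])
    then obtain y0 where y0: "y0 \<in> C" "\<bar>y - y0\<bar> < \<delta> y0"
      by (auto simp: dist_real_def abs_minus_commute)
    have "m y0 \<le> (\<Sum>y0\<in>C. m y0)" using C(2) y0(1) \<delta>(2) by (intro member_le_sum) (auto intro: less_imp_le)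
    then have "m y0 \<le> M" by (simp add: M_def)
    then show ?thesis using \<delta>(3)[OF y0(2), of h] mult_right_mono[of "m y0" M "norm (h + fourier L y h)"] by simp
  qed
  moreover have "M > 0" unfolding M_def using \<delta>(2) by (intro add_nonneg_pos sum_nonneg) (auto intro: less_imp_le)
  ultimately show ?thesis using that by blast
qed

section \<open>Convolutions as bounded operators on measures\<close>

definition conv_op :: "('h::complex_hilbert_space \<Rightarrow> (real, 'h) vmeasure) \<Rightarrow> (real, 'h) vmeasure \<Rightarrow>\<^sub>L (real, 'h) vmeasure"
  where "conv_op k = Blinfun (convolve k)"

lemma conv_op_apply:
  "bounded_clinear k \<Longrightarrow> blinfun_apply (conv_op k) \<mu> = convolve k \<mu>"
  by (simp add: conv_op_def bounded_linear_Blinfun_apply bounded_linear_convolve bounded_clinear_bounded_linear)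

lemma ft_conv_op: "bounded_clinear k \<Longrightarrow> ft (blinfun_apply (conv_op k) \<mu>) y = fourier k y (ft \<mu> y)"
  by (simp add: conv_op_apply ft_convolve)

lemma norm_conv_op_le:
  assumes k: "bounded_clinear k" and c: "\<And>h. norm (k h) \<le> c * norm h" "c \<ge> 0"
  shows "norm (conv_op k) \<le> c"
proof (rule norm_blinfun_bound[OF c(2)])
  fix \<mu>
  have "norm (convolve k \<mu>) \<le> onorm k * norm \<mu>"
    using k by (intro norm_convolve_le bounded_clinear_bounded_linear)
  also have "\<dots> \<le> c * norm \<mu>" by (intro mult_right_mono onorm_bound c) auto
  finally show "norm (blinfun_apply (conv_op k) \<mu>) \<le> c * norm \<mu>" by (simp add: conv_op_apply k)
qed

text \<open>Applies \<open>S\<close> to the values of a measure. As a convolution it has the Fourier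
  transform that is constantly \<open>S\<close>, which is how an operator at one frequency acts on
  measures.\<close>

definition ptw :: "('h::complex_hilbert_space \<Rightarrow> 'h) \<Rightarrow> (real, 'h) vmeasure \<Rightarrow>\<^sub>L (real, 'h) vmeasure"
  where "ptw S = conv_op (\<lambda>h. point_mass 0 (S h))"

lemma bounded_clinear_point_mass_comp: "bounded_clinear S \<Longrightarrow> bounded_clinear (\<lambda>h. point_mass x (S h))"
  by (rule bounded_clinear_compose[OF bounded_clinear_point_mass])

lemma ft_ptw: "bounded_clinear S \<Longrightarrow> ft (blinfun_apply (ptw S) \<mu>) y = S (ft \<mu> y)"
  by (simp add: ptw_def ft_conv_op bounded_clinear_point_mass_comp)
    (simp add: fourier_eq_ft ft_point_mass echar_def)

lemma norm_ptw_le: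
  assumes "bounded_clinear S" "\<And>h. norm (S h) \<le> c * norm h" "c \<ge> 0"
  shows "norm (ptw S) \<le> c"
  unfolding ptw_def using assms order_trans[OF norm_point_mass_le]
  by (intro norm_conv_op_le bounded_clinear_point_mass_comp) blast+

lemma cos_le_half:
  assumes "pi / 3 \<le> x" "x \<le> 4 * pi / 3" shows "cos x \<le> 1/2"
proof (cases "x \<le> pi")
  case True
  then show ?thesis using cos_monotone_0_pi_le[of "pi/3" x] assms pi_gt_zero by (simp add: cos_60)
next
  case False
  have "cos (2 * pi - x) \<le> cos (pi/3)"
    using False assms pi_gt_zero by (intro cos_monotone_0_pi_le) auto
  then show ?thesis by (simp add: cos_60 cos_diff)
qed

text \<open>\<open>j\<close> is the least number of rotations by \<open>\<theta>\<close> that reach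
  the angle \<open>pi / 3\<close>. As \<open>\<bar>\<theta>\<bar> \<le> pi\<close>, the overshoot
  ends before \<open>4 * pi / 3\<close>, and on this arc the cosine is at most \<open>1/2\<close>,
  so the chord to one, of squared length \<open>2 - 2 * cos\<close>, is at least one.\<close>

lemma cis_power_far:
  fixes \<theta> :: real
  assumes "\<theta> \<noteq> 0" "\<bar>\<theta>\<bar> \<le> pi"
  obtains j :: nat where "cmod (cis \<theta> ^ j - 1) \<ge> 1" "real j * \<bar>\<theta>\<bar> \<le> pi / 3 + \<bar>\<theta>\<bar>"
proof -
  define j where "j = nat \<lceil>pi / (3 * \<bar>\<theta>\<bar>)\<rceil>"
  have q: "pi / (3 * \<bar>\<theta>\<bar>) \<ge> 0" by simp
  have j: "real j \<ge> pi / (3 * \<bar>\<theta>\<bar>)" "real j \<le> pi / (3 * \<bar>\<theta>\<bar>) + 1"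
    using q unfolding j_def by linarith+
  have t: "\<bar>\<theta>\<bar> > 0" using assms by simp
  have 1: "real j * \<bar>\<theta>\<bar> \<ge> pi / 3" using mult_right_mono[OF j(1), of "\<bar>\<theta>\<bar>"] t by simp
  have 2: "real j * \<bar>\<theta>\<bar> \<le> pi / 3 + \<bar>\<theta>\<bar>" using mult_right_mono[OF j(2), of "\<bar>\<theta>\<bar>"] t by (simp add: distrib_right)
  have "cos (real j * \<theta>) = cos (real j * \<bar>\<theta>\<bar>)" by (simp add: abs_if)
  also have "\<dots> \<le> 1/2" using 1 2 assms by (intro cos_le_half) auto
  finally have c: "cos (real j * \<theta>) \<le> 1/2" .
  have "(cmod (cis \<theta> ^ j - 1))\<^sup>2 = (cos (real j * \<theta>) - 1)\<^sup>2 + (sin (real j * \<theta>))\<^sup>2"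
    by (simp add: Complex.DeMoivre cmod_power2)
  also have "\<dots> = 2 - 2 * cos (real j * \<theta>)"
    using sin_cos_squared_add[of "real j * \<theta>"] by (simp add: power2_eq_square algebra_simps)
  finally have "1\<^sup>2 \<le> (cmod (cis \<theta> ^ j - 1))\<^sup>2" using c by simp
  then have "1 \<le> cmod (cis \<theta> ^ j - 1)" by (rule power2_le_imp_le) simp
  with 2 show ?thesis using that by blast
qed

lemma echar_power_int: "cis (b * y) powi (- n) = echar y (of_int n * b)"
proof -
  have "echar y t = cis (- (t * y))" for t unfolding echar_def cis_conv_exp by (simp add: mult.assoc)
  then show ?thesis by (simp add: cis_power_int mult.assoc)
qed

text \<open>The constants are fixed in the order \<open>a\<close>, \<open>Y\<close>,
  \<open>M\<close>, \<open>e\<close>, \<open>b\<close>, \<open>D\<close>, \<open>C\<close>, each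
  depending only on earlier ones and on \<open>L\<close>. The lattice cannot tell apart frequencies
  that differ by a multiple of \<open>2 * pi / b\<close>; each \<open>z\<close> is represented by
  one with \<open>\<bar>b * y\<bar> \<le> pi\<close>, which is then either low or high compared with
  \<open>Y\<close>.\<close>

lemma convolve_right_inverse:
  fixes L :: "'h::complex_hilbert_space \<Rightarrow> (real, 'h) vmeasure"
  assumes L: "bounded_clinear L" and tc: "translation_continuous L" and tight: "tight L"
    and inv: "\<And>y. invertible_op (\<lambda>h. h + fourier L y h)"
  obtains B where "(id_blinfun + conv_op L) \<odot> B = id_blinfun"
proof -
  obtain a where a: "a > 0" "\<And>t h. \<bar>t\<bar> \<le> a \<Longrightarrow> norm (shift t (L h) - L h) \<le> 1/4 * norm h"
    using tc unfolding translation_continuous_def by (meson divide_pos_pos zero_less_numeral zero_less_one)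
  \<comment> \<open>Chosen so that \<open>pi / 3 = a/2 * Y\<close>: beyond \<open>Y\<close>, a
    rotation by \<open>pi / 3\<close> needs a translation of length at most \<open>a/2\<close>. The
    other half of \<open>a\<close> pays for rounding up to a lattice point, as
    \<open>b \<le> a/2\<close>.\<close>
  define Y where "Y = 2 * pi / (3 * a)"
  obtain M where M: "M > 0" "\<And>y h. \<bar>y\<bar> \<le> Y \<Longrightarrow> norm h \<le> M * norm (h + fourier L y h)"
    using fourier_inverse_bound[OF L tight inv] by blast
  define e where "e = 1 / (4 * M)"
  have e: "e > 0" "M * e = 1/4" using M by (auto simp: e_def)
  obtain b0 where b0: "b0 > 0" "\<And>b. 0 < b \<Longrightarrow> b \<le> b0 \<Longrightarrow> \<exists>D S. finite D \<and> (\<forall>x\<in>D. \<exists>n::int. x = of_int n * b) \<and>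
      (\<forall>x. bounded_clinear (S x)) \<and>
      (\<forall>h. norm (convolve L (L h - (\<Sum>x\<in>D. point_mass x (S x h)))) \<le> e * norm h) \<and>
      (\<forall>y h. \<bar>y\<bar> \<le> Y \<longrightarrow> norm (fourier L y h - fourier (\<lambda>h. \<Sum>x\<in>D. point_mass x (S x h)) y h) \<le> e * norm h)"
    using lattice_approx[OF L tc tight e(1), of Y] by blast
  define b where "b = min b0 (a/2)"
  have b: "b > 0" "b \<le> b0" "b \<le> a/2" using a b0 by (auto simp: b_def)
  obtain D' S' where D': "finite D'" "\<forall>x\<in>D'. \<exists>n::int. x = of_int n * b" "\<forall>x. bounded_clinear (S' x)"
    "\<forall>h. norm (convolve L (L h - (\<Sum>x\<in>D'. point_mass x (S' x h)))) \<le> e * norm h"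
    "\<forall>y h. \<bar>y\<bar> \<le> Y \<longrightarrow> norm (fourier L y h - fourier (\<lambda>h. \<Sum>x\<in>D'. point_mass x (S' x h)) y h) \<le> e * norm h"
    using b0(2)[OF b(1,2)] by (elim exE conjE) (rule that)
  define D where "D = {n::int. of_int n * b \<in> D'}"
  define S where "S n = S' (of_int n * b)" for n :: int
  have inj: "inj_on (\<lambda>n::int. of_int n * b) A" for A using b(1) by (auto simp: inj_on_def)
  have img: "D' = (\<lambda>n. of_int n * b) ` D" using D'(2) by (auto simp: D_def)
  then have finD: "finite D" using D'(1) finite_imageD[OF _ inj] by metis
  have S: "bounded_clinear (S n)" for n by (simp add: S_def D'(3))
  define l where "l h = (\<Sum>n\<in>D. point_mass (of_int n * b) (S n h))" for h
  have l': "(\<Sum>x\<in>D'. point_mass x (S' x h)) = l h" for h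
    unfolding img l_def S_def by (subst sum.reindex[OF inj]) simp
  have bcl: "bounded_clinear l"
    unfolding l_def[abs_def] by (intro bounded_clinear_sum bounded_clinear_point_mass_comp S)
  have l1: "norm (convolve L (L h - l h)) \<le> e * norm h" for h using D'(4) by (simp add: l')
  have l2: "norm (fourier L y h - fourier l y h) \<le> e * norm h" if "\<bar>y\<bar> \<le> Y" for y h
    using D'(5) that by (simp add: l')
  have fl: "fourier l y h = (\<Sum>n\<in>D. echar y (of_int n * b) *\<^sub>C S n h)" for y h
    by (simp add: fourier_eq_ft l_def ft_sum ft_point_mass)
  define T where "T n = conv_op (point_mass (of_int n * b) :: 'h \<Rightarrow> (real, 'h) vmeasure)" for n :: int
  have ftT: "ft (blinfun_apply (T n) \<mu>) y = echar y (of_int n * b) *\<^sub>C ft \<mu> y" for n \<mu> y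
    unfolding T_def by (simp add: ft_conv_op bounded_clinear_point_mass) (simp add: fourier_eq_ft ft_point_mass)
  have Tt: "blinfun_apply (T n) \<mu> = shift (of_int n * b) \<mu>" for n \<mu>
    by (rule ft_inject) (simp add: ftT ft_shift)
  note fs = bounded_clinear_scaleC[OF bounded_clinear_fourier[OF L]]
  interpret lattice_action "conv_op L" T
  proof
    show "T 0 = id_blinfun" by (rule blinfun_eqI) (simp add: Tt shift_0)
    show "T (m + n) = T m \<odot> T n" for m n by (rule blinfun_eqI) (simp add: Tt shift_shift algebra_simps)
    show "norm (T n) \<le> 1" for n by (rule norm_blinfun_bound) (simp_all add: Tt norm_shift_le)
    show "T n \<odot> conv_op L = conv_op L \<odot> T n" for n
      by (intro blinfun_eqI ft_inject) (simp add: ftT ft_conv_op L fs)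
    show "scal c \<odot> T n = T n \<odot> scal c" for c n
      by (intro blinfun_eqI ft_inject) (simp add: ftT ft_scaleC scaleC_scaleC mult.commute)
    show "scal c \<odot> conv_op L = conv_op L \<odot> scal c" for c
      by (intro blinfun_eqI ft_inject) (simp add: ft_conv_op L ft_scaleC fs)
  qed
  define Lsh where "Lsh = (\<Sum>n\<in>D. T n \<odot> ptw (S n))"
  have Lsh: "Lsh = conv_op l"
    by (intro blinfun_eqI ft_inject)
      (simp add: Lsh_def blinfun.sum_left ft_sum ftT ft_ptw S ft_conv_op bcl fl)
  have LL: "norm (conv_op L \<odot> (conv_op L - Lsh)) \<le> e"
  proof -
    have lin: "convolve L (L h - l h) = convolve L (L h) - convolve L (l h)" for h
      by (intro linear_diff bounded_linear.linear bounded_linear_convolve bounded_clinear_bounded_linear L)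
    have bc: "bounded_clinear (\<lambda>h. convolve L (L h - l h))"
      by (rule bounded_clinear_compose[OF bounded_clinear_convolve[OF L] bounded_clinear_diff[OF L bcl]])
    have "conv_op L \<odot> (conv_op L - Lsh) = conv_op (\<lambda>h. convolve L (L h - l h))"
    proof (intro blinfun_eqI ft_inject)
      fix \<mu> y
      have "fourier (\<lambda>h. convolve L (L h - l h)) y g = fourier L y (fourier L y g) - fourier L y (fourier l y g)" for g
        by (simp only: fourier_eq_ft lin ft_diff ft_convolve[OF L])
      then show "ft (blinfun_apply (conv_op L \<odot> (conv_op L - Lsh)) \<mu>) y =
        ft (blinfun_apply (conv_op (\<lambda>h. convolve L (L h - l h))) \<mu>) y"
        unfolding Lsh
        by (simp add: ft_conv_op bc L bcl blinfun.diff_left blinfun.diff_right ft_diff)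
    qed
    then show ?thesis using norm_conv_op_le[OF bc l1] e(1) by simp
  qed
  \<comment> \<open>One constant for both regimes, using \<open>j \<le> a / b\<close> at high
    frequencies. It depends on the discretization but not on \<open>z\<close> or
    \<open>Q\<close>.\<close>
  define C where "C = max (4/3 * (a / b)) (2 * M * (\<Sum>n\<in>D. \<bar>real_of_int n\<bar> * norm (ptw (S n))))"
  have "N Q \<le> C * N (Q \<odot> (W z 1 - id_blinfun))" if z: "cmod z = 1" and Q: "Q \<odot> conv_op L = conv_op L \<odot> Q" for z Q
  proof -
    define \<theta> where "\<theta> = Arg z"
    have zt: "z = cis \<theta>" using z cis_Arg[of z] by (force simp: \<theta>_def sgn_eq)
    have tp: "\<bar>\<theta>\<bar> \<le> pi" using Arg_bounded[of z] by (auto simp: \<theta>_def)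
    \<comment> \<open>The frequency at which translation by \<open>b\<close> acts as
      \<open>1 / z\<close>, so that \<open>W z 1\<close> acts as the identity there.\<close>
    define y where "y = \<theta> / b"
    have bth: "b * y = \<theta>" using b by (simp add: y_def)
    show ?thesis
    proof (cases "\<bar>y\<bar> \<le> Y")
      case True
      obtain R where R: "bounded_clinear R" "(\<lambda>h. h + fourier L y h) \<circ> R = id"
        using inv[of y] by (auto simp: invertible_op_def)
      have R': "R h + fourier L y (R h) = h" for h using fun_cong[OF R(2), of h] by simp
      have bcf: "bounded_clinear (fourier L y)" by (rule bounded_clinear_fourier[OF L])
      have "N Q \<le> (2 * M * (\<Sum>n\<in>D. \<bar>real_of_int n\<bar> * norm (ptw (S n)))) * N (Q \<odot> (W z 1 - id_blinfun))"
      proof (rule low_frequency[OF z Q finD Lsh_def refl _ _ LL])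
        show "(id_blinfun + ptw (fourier L y)) \<odot> ptw R = id_blinfun"
          by (intro blinfun_eqI ft_inject) (simp add: blinfun.add_left ft_add ft_ptw bcf R(1) R')
        show "norm (ptw R) \<le> M"
          using M(2)[OF True, of "R _"] M(1) by (intro norm_ptw_le R) (auto simp: R')
        show "norm (ptw (fourier L y) - (\<Sum>n\<in>D. scal (z powi - n) \<odot> ptw (S n))) \<le> e"
        proof -
          have bc: "bounded_clinear (\<lambda>h. fourier L y h - fourier l y h)"
            by (rule bounded_clinear_diff[OF bcf bounded_clinear_fourier[OF bcl]])
          have "z powi - n = echar y (of_int n * b)" for n using echar_power_int[of b y n] by (simp add: zt bth)
          then have "ptw (fourier L y) - (\<Sum>n\<in>D. scal (z powi - n) \<odot> ptw (S n)) = ptw (\<lambda>h. fourier L y h - fourier l y h)"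
            by (intro blinfun_eqI ft_inject)
              (simp add: blinfun.diff_left blinfun.sum_left ft_diff ft_sum ft_ptw bcf S bc ft_scaleC, simp add: fl)
          then show ?thesis using norm_ptw_le[OF bc l2[OF True]] e(1) by simp
        qed
        show "M * e \<le> 1/4" using e(2) by simp
      qed
      also have "\<dots> \<le> C * N (Q \<odot> (W z 1 - id_blinfun))"
        by (intro mult_right_mono quot_onorm_nonneg) (simp add: C_def)
      finally show ?thesis .
    next
      case False
      have Y0: "Y > 0" using a by (simp add: Y_def)
      have t0: "\<theta> \<noteq> 0" using False Y0 by (auto simp: y_def)
      obtain j :: nat where j: "cmod (cis \<theta> ^ j - 1) \<ge> 1" "real j * \<bar>\<theta>\<bar> \<le> pi / 3 + \<bar>\<theta>\<bar>"
        using cis_power_far[OF t0 tp] by blast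
      have jb: "real j * b \<le> a"
      proof -
        have ty: "\<bar>\<theta>\<bar> = b * \<bar>y\<bar>" using b by (simp add: bth[symmetric] abs_mult)
        have y0: "\<bar>y\<bar> > 0" using False Y0 by linarith
        have "real j * b * \<bar>y\<bar> \<le> pi / 3 + b * \<bar>y\<bar>" using j(2) unfolding ty by (simp add: mult.assoc)
        also have "pi / 3 = a/2 * Y" using a by (simp add: Y_def)
        also have "a/2 * Y + b * \<bar>y\<bar> \<le> a/2 * \<bar>y\<bar> + a/2 * \<bar>y\<bar>"
          using False a b by (intro add_mono mult_left_mono mult_right_mono) auto
        also have "\<dots> = a * \<bar>y\<bar>" by simp
        finally show ?thesis using y0 by simp
      qed
      have "norm (T (int j) \<odot> conv_op L - conv_op L) \<le> 1/4"
      proof -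
        let ?k = "\<lambda>h. shift (real j * b) (L h) - L h"
        have bc: "bounded_clinear ?k"
          unfolding bounded_clinear_def
        proof (intro conjI allI)
          show "bounded_linear ?k"
            by (intro bounded_linear_sub bounded_linear_compose[OF bounded_linear_shift] bounded_clinear_bounded_linear L)
          show "?k (c *\<^sub>C x) = c *\<^sub>C ?k x" for c x
            by (rule ft_inject)
              (simp add: bounded_clinear_scaleC[OF L] ft_diff ft_shift ft_scaleC scaleC_scaleC
                mult.commute scaleC_diff_right)
        qed
        have "T (int j) \<odot> conv_op L - conv_op L = conv_op ?k"
        proof (intro blinfun_eqI ft_inject)
          fix \<mu> y
          have "fourier ?k y g = echar y (real j * b) *\<^sub>C fourier L y g - fourier L y g" for g
            by (simp add: fourier_eq_ft ft_diff ft_shift)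
          then show "ft (blinfun_apply (T (int j) \<odot> conv_op L - conv_op L) \<mu>) y = ft (blinfun_apply (conv_op ?k) \<mu>) y"
            by (simp add: blinfun.diff_left ft_diff ftT ft_conv_op L bc)
        qed
        moreover have "norm (conv_op ?k) \<le> 1/4"
          using a(2)[of "real j * b"] jb b by (intro norm_conv_op_le[OF bc]) auto
        ultimately show ?thesis by simp
      qed
      from high_frequency[OF z Q this] j(1)
      have "N Q \<le> (4/3 * real j) * N (Q \<odot> (W z 1 - id_blinfun))" by (simp add: zt)
      also have "\<dots> \<le> C * N (Q \<odot> (W z 1 - id_blinfun))"
      proof (intro mult_right_mono quot_onorm_nonneg)
        have "real j \<le> a / b" using jb b by (simp add: pos_le_divide_eq)
        then show "4/3 * real j \<le> C" by (simp add: C_def)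
      qed
      finally show ?thesis .
    qed
  qed
  then show ?thesis using right_inverse that by blast
qed

text \<open>Convolution with \<open>A\<close> is injective, because at every frequency the transform
  of \<open>A\<close> has a left inverse and the Fourier transform separates measures. Cancelling it
  turns the right inverse into a two-sided one: \<open>A * l * A\<close> and \<open>A * 1\<close>
  agree, hence \<open>l * A = 1\<close>.\<close>

lemma conv_invertibleI:
  fixes L :: "'h::complex_hilbert_space \<Rightarrow> (real, 'h) vmeasure"
  assumes L: "bounded_clinear L" and tc: "translation_continuous L" and tight: "tight L"
    and inv: "\<And>y. invertible_op (fourier (\<lambda>h. conv_unit h + L h) y)"
  shows "conv_invertible (\<lambda>h. conv_unit h + L h)"
proof -
  define A where "A h = conv_unit h + L h" for h
  have A: "bounded_clinear A" unfolding A_def[abs_def] by (intro bounded_clinear_add bounded_clinear_unit L)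
  have fA: "fourier A y h = h + fourier L y h" for y h
    unfolding A_def[abs_def] by (simp add: fourier_add fourier_unit)
  have invA: "invertible_op (fourier A y)" for y using inv[of y] by (simp add: A_def[abs_def])
  have "invertible_op (\<lambda>h. h + fourier L y h)" for y
    using invA[of y] by (simp add: fA[abs_def])
  then obtain B where B: "(id_blinfun + conv_op L) \<odot> B = id_blinfun"
    using convolve_right_inverse[OF L tc tight] by blast
  have cA: "convolve A \<mu> = \<mu> + convolve L \<mu>" for \<mu>
    unfolding A_def[abs_def] by (simp add: convolve_add bounded_clinear_unit L convolve_unit)
  have AB: "convolve A (blinfun_apply B \<mu>) = \<mu>" for \<mu>
    using arg_cong[OF B, of "\<lambda>Q. blinfun_apply Q \<mu>"] by (simp add: cA blinfun.add_left conv_op_apply L)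
  have clA: "bounded_clinear (convolve A)" by (rule bounded_clinear_convolve[OF A])
  have injA: "\<mu> = \<nu>" if "convolve A \<mu> = convolve A \<nu>" for \<mu> \<nu>
  proof (rule ft_inject)
    fix y
    obtain S where "S \<circ> fourier A y = id" using invA[of y] by (auto simp: invertible_op_def)
    from fun_cong[OF this] have "S (fourier A y h) = h" for h by simp
    then have e: "S (ft (convolve A \<mu>) y) = ft \<mu> y" for \<mu> by (simp add: ft_convolve A)
    show "ft \<mu> y = ft \<nu> y" using e[of \<mu>] e[of \<nu>] that by simp
  qed
  define l where "l h = blinfun_apply B (point_mass 0 h)" for h
  have "bounded_clinear (blinfun_apply B)"
    unfolding bounded_clinear_def
  proof (intro conjI allI)
    \<comment> \<open>\<open>B\<close> is only real-linear by type. Both sides have the same image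
      under convolution with \<open>A\<close>, which is injective and complex-linear.\<close>
    show "blinfun_apply B (c *\<^sub>C x) = c *\<^sub>C blinfun_apply B x" for c x
      by (rule injA) (simp add: AB bounded_clinear_scaleC[OF clA])
  qed (rule blinfun.bounded_linear_right)
  from bounded_clinear_compose[OF this bounded_clinear_point_mass] have l: "bounded_clinear l"
    unfolding l_def[abs_def] .
  have Al: "conv_mult A l = conv_unit" by (simp add: conv_mult_def l_def AB conv_unit_def fun_eq_iff)
  have "conv_mult l A = conv_unit"
  proof
    fix h
    have "convolve A (convolve l (A h)) = A h" by (simp add: convolve_convolve A l Al convolve_unit)
    also have "\<dots> = convolve A (conv_unit h)" by (simp add: convolve_unit_right A)
    finally show "conv_mult l A h = conv_unit h" unfolding conv_mult_def by (rule injA)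
  qed
  with A l Al have "conv_invertible A" by (auto simp: conv_invertible_def conv_alg_def)
  then show ?thesis by (simp add: A_def[abs_def])
qed

theorem theorem1p5:
  fixes chi :: "real \<Rightarrow> complex"
  assumes "continuous_on UNIV chi"
    and "compact (closure {t. chi t \<noteq> 0})"
    and "\<forall>\<^sub>F t in nhds 0. chi t = 1"
  shows "(\<forall>A :: 'h::complex_hilbert_space \<Rightarrow> (real, 'h) vmeasure. A \<in> conv_alg \<longrightarrow>
            conv_invertible A \<longrightarrow> (\<forall>\<omega>::real. invertible_op (fourier A \<omega>))) \<and>
         (\<forall>A L :: 'h \<Rightarrow> (real, 'h) vmeasure. A \<in> conv_alg \<longrightarrow> L \<in> conv_alg \<longrightarrow>
            A = (\<lambda>h. conv_unit h + L h) \<longrightarrow>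
            (\<forall>\<omega>::real. invertible_op (fourier A \<omega>)) \<longrightarrow>
            ((\<lambda>\<epsilon>::real. onorm (\<lambda>h. translate \<epsilon> L h - L h)) \<longlongrightarrow> 0) (at 0) \<longrightarrow>
            ((\<lambda>R::real. onorm (mult_fun (\<lambda>t. 1 - chi (t / R)) L)) \<longlongrightarrow> 0) at_top \<longrightarrow>
            conv_invertible A)"
proof (intro conjI allI impI)
  fix A :: "'h \<Rightarrow> (real, 'h) vmeasure" and \<omega> :: real
  assume "conv_invertible A"
  then show "invertible_op (fourier A \<omega>)" by (rule conv_invertible_imp_fourier)
next
  fix A L :: "'h \<Rightarrow> (real, 'h) vmeasure"
  assume L: "L \<in> conv_alg" and A: "A = (\<lambda>h. conv_unit h + L h)"
    and inv: "\<forall>\<omega>. invertible_op (fourier A \<omega>)"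
    and "((\<lambda>\<epsilon>. onorm (\<lambda>h. translate \<epsilon> L h - L h)) \<longlongrightarrow> 0) (at 0)"
    and "((\<lambda>R. onorm (mult_fun (\<lambda>t. 1 - chi (t / R)) L)) \<longlongrightarrow> 0) at_top"
  then have "bounded_clinear L" "translation_continuous L" "tight L"
    using translation_continuousI tightI[OF _ assms(1,2)] by (auto simp: conv_alg_def)
  then show "conv_invertible A" unfolding A using inv by (intro conv_invertibleI) (auto simp: A)
qed

end
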